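(* Let $(W,\mathfrak h)$ be an irreducible complex reflection group and let $\Gamma$ be either $\mathrm T$ (with $\dim\mathfrak h>1$), or $\mathrm{SL}_2$ (with $W$ a real reflection group and $\dim\mathfrak h>2$). Then for every conjugation-invariant function $c:\mathcal S\to\mathbb C$, $$\operatorname{gr} Z(H_{0,c}^{\Gamma})=Z(P^{\Gamma}\rtimes W),$$ an equality of subalgebras of $\operatorname{gr}H_{0,c}=P\rtimes W$.
   Context: $\mathfrak h$ is a finite-dimensional complex vector space. A complex reflection is a finite-order $s\in GL(\mathfrak h)$ with $\operatorname{rank}(s-1)=1$. A complex reflection group $(W,\mathfrak h)$ is a finite subgroup $W\subset GL(\mathfrak h)$ generated by complex reflections; it is irreducible if $\mathfrak h$ is an irreducible representation. $\mathcal S$ is the set of complex reflections in $W$. For $s\in\mathcal S$, $\alpha_s\in\mathfrak h^*$ is such that $\ker\alpha_s$ is the hyperplane fixed by $s$, and $\alpha_s^\vee\in\mathfrak h$ is an eigenvector of $s$ with eigenvalue $\ne1$. For $t\in\mathbb C$ and conjugation-invariant $c:\mathcal S\to\mathbb C$, the rational Cherednik algebra $H_{t,c}$ is the quotient of $T(\mathfrak h\oplus\mathfrak h^* )\rtimes W$ by $[x,x']=0$, $[y,y']=0$, $[y,x]=t\,x(y)-\sum_{s\in\mathcal S}\frac{2c_s}{\alpha_s(\alpha_s^\vee)}x(\alpha_s^\vee)\alpha_s(y)\,s$ for $x,x'\in\mathfrak h^*$, $y,y'\in\mathfrak h$. $\mathrm T=\mathbb C^\times$ acts on $H_{t,c}$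 by algebra automorphisms: $\lambda\cdot x=\lambda x$, $\lambda\cdot y=\lambda^{-1}y$, $\lambda\cdot w=w$ ($x\in\mathfrak h^*,y\in\mathfrak h,w\in W$). If $W$ is a real reflection group ($\mathfrak h$ the complexification of a real reflection representation), fix the $W$-equivariant isomorphism $\mathfrak h\to\mathfrak h^*$, $v\mapsto v^*=(v,\cdot)$, from an invariant inner product extended bilinearly; each $\begin{pmatrix}a&b\\c&d\end{pmatrix}\in\mathrm{SL}_2(\mathbb C)$ acts by the automorphism fixing $W$ with $v\mapsto av+bv^*$, $v^*\mapsto cv+dv^*$. $H^\Gamma_{t,c}$ denotes the subalgebra of $\Gamma$-fixed elements. $P=\mathbb C[\mathfrak h\times\mathfrak h^*]=\operatorname{Sym}(\mathfrak h\oplus\mathfrak h^* )$, with $\Gamma$ acting by the same formulas. $H_{t,c}$ is filtered by placing $W$ in degree $0$ and $\mathfrak h,\mathfrak h^*$ in degree $1$; all subalgebras get the restricted filtration, and $\operatorname{gr}H_{t,c}=P\rtimes W$ (PBW). $Z(-)$ denotes the centre. *)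

theory Defs
  imports
    "HOL-Analysis.Analysis"
    "HOL-Library.Poly_Mapping"
    "HOL-Algebra.QuotRing"
    "HOL-Algebra.Generated_Groups"
begin

text \<open>
  The space \<open>\<hh>\<close> is \<open>complex ^ 'n\<close> (column vectors), and \<open>\<hh>*\<close> is again \<open>complex ^ 'n\<close>, read as row
  vectors: \<open>x\<close> in \<open>\<hh>*\<close> takes the value \<open>pairing x y\<close> at \<open>y\<close> in \<open>\<hh>\<close>. Elements of \<open>\<hh> \<oplus> \<hh>*\<close> are
  pairs \<open>(y, x)\<close>.
\<close>

type_synonym 'n cmat = "complex ^ 'n ^ 'n"
type_synonym 'n hhd = "(complex ^ 'n) \<times> (complex ^ 'n)"

definition pairing :: "complex ^ 'n \<Rightarrow> complex ^ 'n \<Rightarrow> complex" where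
  "pairing x y = (\<Sum>i\<in>UNIV. x $ i * y $ i)"


section \<open>Complex reflection groups\<close>

definition GL :: "('n::finite) cmat monoid" where
  "GL = \<lparr>carrier = {A. invertible A}, mult = (**), one = mat 1\<rparr>"

definition complex_reflection :: "('n::finite) cmat \<Rightarrow> bool" where
  "complex_reflection s \<longleftrightarrow>
     invertible s \<and> (\<exists>k>0. (((**) s) ^^ k) (mat 1) = mat 1) \<and> rank (s - mat 1) = 1"

definition reflections :: "('n::finite) cmat set \<Rightarrow> 'n cmat set" where
  "reflections W = {s \<in> W. complex_reflection s}"

definition complex_reflection_group :: "('n::finite) cmat set \<Rightarrow> bool" where
  "complex_reflection_group W \<longleftrightarrow>
     subgroup W GL \<and> finite W \<and> generate GL (reflections W) = W"

definition irreducible_rep :: "('n::finite) cmat set \<Rightarrow> bool" where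
  "irreducible_rep W \<longleftrightarrow>
     (\<forall>U. vec.subspace U \<and> (\<forall>w\<in>W. \<forall>u\<in>U. w *v u \<in> U) \<longrightarrow> U = {0} \<or> U = UNIV)"

definition root_data ::
    "('n::finite) cmat set \<Rightarrow> ('n cmat \<Rightarrow> complex ^ 'n) \<Rightarrow> ('n cmat \<Rightarrow> complex ^ 'n) \<Rightarrow> bool" where
  "root_data W \<alpha> \<alpha>v \<longleftrightarrow>
     (\<forall>s\<in>reflections W.
        {y. pairing (\<alpha> s) y = 0} = {y. s *v y = y} \<and>
        \<alpha>v s \<noteq> 0 \<and> (\<exists>l. l \<noteq> 1 \<and> s *v \<alpha>v s = l *s \<alpha>v s))"

definition conj_invariant :: "('n::finite) cmat set \<Rightarrow> ('n cmat \<Rightarrow> complex) \<Rightarrow> bool" where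
  "conj_invariant W c \<longleftrightarrow>
     (\<forall>s\<in>reflections W. \<forall>w\<in>W. c (w ** s ** matrix_inv w) = c s)"

text \<open>
  \<open>U\<close> is a \<open>W\<close>-stable real form of \<open>\<hh>\<close>, and \<open>B\<close> is the Gram matrix of the complex bilinear extension
  \<open>(u, v) = pairing (u v* B) v\<close> of a \<open>W\<close>-invariant inner product on \<open>U\<close>.
\<close>

definition real_structure ::
    "('n::finite) cmat set \<Rightarrow> (complex ^ 'n) set \<Rightarrow> 'n cmat \<Rightarrow> bool" where
  "real_structure W U B \<longleftrightarrow>
     subspace U \<and>
     (\<forall>v. \<exists>!p. p \<in> U \<times> U \<and> v = fst p + \<i> *s snd p) \<and>
     (\<forall>w\<in>W. \<forall>u\<in>U. w *v u \<in> U) \<and>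
     (\<forall>u\<in>U. \<forall>v\<in>U. pairing (u v* B) v \<in> \<real> \<and> pairing (u v* B) v = pairing (v v* B) u) \<and>
     (\<forall>u\<in>U. u \<noteq> 0 \<longrightarrow> Re (pairing (u v* B) u) > 0) \<and>
     (\<forall>w\<in>W. \<forall>u\<in>U. \<forall>v\<in>U. pairing ((w *v u) v* B) (w *v v) = pairing (u v* B) v)"


section \<open>The algebras $T(\mathfrak h\oplus\mathfrak h^*)$ and $P=\operatorname{Sym}(\mathfrak h\oplus\mathfrak h^*)$\<close>

text \<open>
  The basis of \<open>\<hh> \<oplus> \<hh>*\<close> is indexed by \<open>'n + 'n\<close>: \<open>Inl i\<close> for the standard basis of \<open>\<hh>\<close>, \<open>Inr i\<close> for
  the dual basis of \<open>\<hh>*\<close>. The tensor algebra is the monoid algebra of the free monoid on this set,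
  the symmetric algebra that of the free commutative monoid; both products are the convolution of
  \<^typ>\<open>'a \<Rightarrow>\<^sub>0 'b\<close>. Lists are wrapped because their concatenation has to be called \<open>+\<close>.
\<close>

datatype 'a free_monoid = FM (letters: "'a list")

instantiation free_monoid :: (type) monoid_add
begin

definition zero_free_monoid :: "'a free_monoid" where
  "0 = FM []"

definition plus_free_monoid :: "'a free_monoid \<Rightarrow> 'a free_monoid \<Rightarrow> 'a free_monoid" where
  "u + v = FM (letters u @ letters v)"

instance
  by standard (auto simp: zero_free_monoid_def plus_free_monoid_def)

end

type_synonym 'n tens = "('n + 'n) free_monoid \<Rightarrow>\<^sub>0 complex"
type_synonym 'n sym = "(('n + 'n) \<Rightarrow>\<^sub>0 nat) \<Rightarrow>\<^sub>0 complex"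

definition const :: "complex \<Rightarrow> ('m::monoid_add \<Rightarrow>\<^sub>0 complex)" where
  "const a = Poly_Mapping.single 0 a"

definition basis :: "'n + 'n \<Rightarrow> ('n::finite) hhd" where
  "basis k = (case k of Inl i \<Rightarrow> (axis i 1, 0) | Inr i \<Rightarrow> (0, axis i 1))"

definition coord :: "('n::finite) hhd \<Rightarrow> 'n + 'n \<Rightarrow> complex" where
  "coord v k = (case k of Inl i \<Rightarrow> fst v $ i | Inr i \<Rightarrow> snd v $ i)"

definition tens_vec :: "('n::finite) hhd \<Rightarrow> 'n tens" where
  "tens_vec v = (\<Sum>k\<in>UNIV. Poly_Mapping.single (FM [k]) (coord v k))"

definition sym_vec :: "('n::finite) hhd \<Rightarrow> 'n sym" where
  "sym_vec v = (\<Sum>k\<in>UNIV. Poly_Mapping.single (Poly_Mapping.single k 1) (coord v k))"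

text \<open>The algebra endomorphisms induced by a linear endomorphism \<open>g\<close> of \<open>\<hh> \<oplus> \<hh>*\<close>.\<close>

definition tens_map :: "('n hhd \<Rightarrow> 'n hhd) \<Rightarrow> ('n::finite) tens \<Rightarrow> 'n tens" where
  "tens_map g p =
     (\<Sum>u\<in>Poly_Mapping.keys p.
        const (Poly_Mapping.lookup p u) * prod_list (map (\<lambda>k. tens_vec (g (basis k))) (letters u)))"

definition sym_map :: "('n hhd \<Rightarrow> 'n hhd) \<Rightarrow> ('n::finite) sym \<Rightarrow> 'n sym" where
  "sym_map g p =
     (\<Sum>m\<in>Poly_Mapping.keys p.
        const (Poly_Mapping.lookup p m) * (\<Prod>k\<in>UNIV. sym_vec (g (basis k)) ^ Poly_Mapping.lookup m k))"

definition word_deg :: "'a free_monoid \<Rightarrow> nat" where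
  "word_deg u = length (letters u)"

definition mon_deg :: "('a::finite \<Rightarrow>\<^sub>0 nat) \<Rightarrow> nat" where
  "mon_deg m = (\<Sum>k\<in>UNIV. Poly_Mapping.lookup m k)"

definition hom_part :: "nat \<Rightarrow> ('n::finite) sym \<Rightarrow> 'n sym" where
  "hom_part d p =
     (\<Sum>m\<in>{m \<in> Poly_Mapping.keys p. mon_deg m = d}. Poly_Mapping.single m (Poly_Mapping.lookup p m))"

text \<open>The canonical projection $T(\mathfrak h\oplus\mathfrak h^*)\to\operatorname{Sym}(\mathfrak h\oplus\mathfrak h^*)$.\<close>

definition symmetrize :: "('n::finite) tens \<Rightarrow> 'n sym" where
  "symmetrize p =
     (\<Sum>u\<in>Poly_Mapping.keys p.
        Poly_Mapping.single (\<Sum>k\<leftarrow>letters u. Poly_Mapping.single k 1) (Poly_Mapping.lookup p u))"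


section \<open>Group actions on $\mathfrak h\oplus\mathfrak h^*$\<close>

definition W_act :: "('n::finite) cmat \<Rightarrow> 'n hhd \<Rightarrow> 'n hhd" where
  "W_act w = (\<lambda>(y, x). (w *v y, x v* matrix_inv w))"

definition torus :: "(('n::finite) hhd \<Rightarrow> 'n hhd) set" where
  "torus = {\<lambda>(y, x). (inverse l *s y, l *s x) |l :: complex. l \<noteq> 0}"

text \<open>
  The isomorphism \<open>v \<mapsto> v*\<close> from \<open>\<hh>\<close> to \<open>\<hh>*\<close> determined by the Gram matrix \<open>B\<close> sends \<open>y\<close> to \<open>y v* B\<close>,
  so its inverse sends \<open>x\<close> to \<open>x v* matrix_inv B\<close>.
\<close>

definition SL2 :: "('n::finite) cmat \<Rightarrow> ('n hhd \<Rightarrow> 'n hhd) set" where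
  "SL2 B =
     {\<lambda>(y, x). (A $ 1 $ 1 *s y + A $ 2 $ 1 *s (x v* matrix_inv B),
                A $ 1 $ 2 *s (y v* B) + A $ 2 $ 2 *s x) |A :: complex ^ 2 ^ 2. det A = 1}"


section \<open>Crossed products, centres and associated graded rings\<close>

text \<open>
  The crossed product of a ring with \<open>W\<close>: the function \<open>f\<close> stands for $\sum_{w\in W} f(w)\,w$, and
  $w\,p = (\mathrm{act}\,w\,p)\,w$.
\<close>

definition crossed :: "('n::finite) cmat set \<Rightarrow> ('n cmat \<Rightarrow> 'r \<Rightarrow> 'r) \<Rightarrow> ('n cmat \<Rightarrow> 'r::ring_1) ring" where
  "crossed W act =
     \<lparr>carrier = {f. \<forall>w. w \<notin> W \<longrightarrow> f w = 0},
      mult = (\<lambda>f g w. \<Sum>u\<in>W. f u * act u (g (matrix_inv u ** w))),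
      one = (\<lambda>w. if w = mat 1 then 1 else 0),
      zero = (\<lambda>w. 0),
      add = (\<lambda>f g w. f w + g w)\<rparr>"

definition coeff_elt :: "'r \<Rightarrow> ('n::finite) cmat \<Rightarrow> 'r::ring_1" where
  "coeff_elt p = (\<lambda>w. if w = mat 1 then p else 0)"

definition group_elt :: "('n::finite) cmat \<Rightarrow> 'n cmat \<Rightarrow> 'r::ring_1" where
  "group_elt s = (\<lambda>w. if w = s then 1 else 0)"

definition centre :: "('a, 'b) ring_scheme \<Rightarrow> 'a set" where
  "centre R = {z \<in> carrier R. \<forall>a\<in>carrier R. z \<otimes>\<^bsub>R\<^esub> a = a \<otimes>\<^bsub>R\<^esub> z}"

text \<open>\<open>below R F d\<close> is $F_{d-1}$, with the convention $F_{-1}=0$.\<close>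

definition below :: "('a, 'b) ring_scheme \<Rightarrow> (nat \<Rightarrow> 'a set) \<Rightarrow> nat \<Rightarrow> 'a set" where
  "below R F d = (case d of 0 \<Rightarrow> {\<zero>\<^bsub>R\<^esub>} | Suc e \<Rightarrow> F e)"

text \<open>
  An element of the associated graded ring is given by its components, the one of degree \<open>d\<close> being a
  coset of $F_{d-1}$ in $F_d$. In the definitions of product and sum the unions are over all
  representatives, which all give the same coset.
\<close>

definition gr :: "('a, 'b) ring_scheme \<Rightarrow> (nat \<Rightarrow> 'a set) \<Rightarrow> (nat \<Rightarrow> 'a set) ring" where
  "gr R F =
     \<lparr>carrier = {\<phi>. (\<forall>d. \<exists>a\<in>F d. \<phi> d = below R F d +>\<^bsub>R\<^esub> a) \<and> finite {d. \<phi> d \<noteq> below R F d}},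
      mult = (\<lambda>\<phi> \<psi> d. \<Union>{below R F d +>\<^bsub>R\<^esub> (\<Oplus>\<^bsub>R\<^esub>i\<in>{..d}. a i \<otimes>\<^bsub>R\<^esub> b (d - i)) |a b.
                          (\<forall>i\<le>d. a i \<in> \<phi> i) \<and> (\<forall>i\<le>d. b i \<in> \<psi> i)}),
      one = (\<lambda>d. below R F d +>\<^bsub>R\<^esub> (if d = 0 then \<one>\<^bsub>R\<^esub> else \<zero>\<^bsub>R\<^esub>)),
      zero = below R F,
      add = (\<lambda>\<phi> \<psi> d. \<phi> d <+>\<^bsub>R\<^esub> \<psi> d)\<rparr>"

text \<open>
  For a subalgebra \<open>A\<close> with the restricted filtration, the image of $\operatorname{gr} A$ under the
  inclusion into $\operatorname{gr} R$.
\<close>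

definition gr_sub :: "('a, 'b) ring_scheme \<Rightarrow> (nat \<Rightarrow> 'a set) \<Rightarrow> 'a set \<Rightarrow> (nat \<Rightarrow> 'a set) set" where
  "gr_sub R F A = {\<phi> \<in> carrier (gr R F). \<forall>d. \<exists>a\<in>A \<inter> F d. \<phi> d = below R F d +>\<^bsub>R\<^esub> a}"


section \<open>The rational Cherednik algebra\<close>

definition TW :: "('n::finite) cmat set \<Rightarrow> ('n cmat \<Rightarrow> 'n tens) ring" where
  "TW W = crossed W (\<lambda>w. tens_map (W_act w))"

definition PW :: "('n::finite) cmat set \<Rightarrow> ('n cmat \<Rightarrow> 'n sym) ring" where
  "PW W = crossed W (\<lambda>w. sym_map (W_act w))"

definition y_elt :: "complex ^ 'n \<Rightarrow> ('n::finite) cmat \<Rightarrow> 'n tens" where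
  "y_elt y = coeff_elt (tens_vec (y, 0))"

definition x_elt :: "complex ^ 'n \<Rightarrow> ('n::finite) cmat \<Rightarrow> 'n tens" where
  "x_elt x = coeff_elt (tens_vec (0, x))"

definition scalar_elt :: "complex \<Rightarrow> ('n::finite) cmat \<Rightarrow> 'n tens" where
  "scalar_elt a = coeff_elt (const a)"

definition commutator :: "('a, 'b) ring_scheme \<Rightarrow> 'a \<Rightarrow> 'a \<Rightarrow> 'a" where
  "commutator R a b = a \<otimes>\<^bsub>R\<^esub> b \<ominus>\<^bsub>R\<^esub> b \<otimes>\<^bsub>R\<^esub> a"

context
  fixes W :: "('n::finite) cmat set"
    and \<alpha> \<alpha>v :: "'n cmat \<Rightarrow> complex ^ 'n"
    and t :: complex
    and c :: "'n cmat \<Rightarrow> complex"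
begin

definition cherednik_relations :: "('n cmat \<Rightarrow> 'n tens) set" where
  "cherednik_relations =
     {commutator (TW W) (x_elt x) (x_elt x') |x x'. True} \<union>
     {commutator (TW W) (y_elt y) (y_elt y') |y y'. True} \<union>
     {commutator (TW W) (y_elt y) (x_elt x) \<ominus>\<^bsub>TW W\<^esub>
        (scalar_elt (t * pairing x y) \<ominus>\<^bsub>TW W\<^esub>
         (\<Oplus>\<^bsub>TW W\<^esub>s\<in>reflections W.
            scalar_elt (2 * c s / pairing (\<alpha> s) (\<alpha>v s) * pairing x (\<alpha>v s) * pairing (\<alpha> s) y)
              \<otimes>\<^bsub>TW W\<^esub> group_elt s)) |y x. True}"

definition cherednik_ideal :: "('n cmat \<Rightarrow> 'n tens) set" where
  "cherednik_ideal = Idl\<^bsub>TW W\<^esub> cherednik_relations"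

definition cherednik :: "('n cmat \<Rightarrow> 'n tens) set ring" where
  "cherednik = TW W Quot cherednik_ideal"

definition cherednik_filtration :: "nat \<Rightarrow> ('n cmat \<Rightarrow> 'n tens) set set" where
  "cherednik_filtration d =
     (\<lambda>f. cherednik_ideal +>\<^bsub>TW W\<^esub> f) `
       {f \<in> carrier (TW W). \<forall>w. \<forall>u\<in>Poly_Mapping.keys (f w). word_deg u \<le> d}"

text \<open>
  An automorphism of the crossed product that preserves the ideal permutes its cosets, so the induced
  automorphism of the quotient sends a coset to its image.
\<close>

definition cherednik_invariants :: "('n hhd \<Rightarrow> 'n hhd) set \<Rightarrow> ('n cmat \<Rightarrow> 'n tens) set set" where
  "cherednik_invariants \<Gamma> =
     {C \<in> carrier cherednik. \<forall>g\<in>\<Gamma>. (\<lambda>f w. tens_map g (f w)) ` C = C}"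

text \<open>
  The PBW identification of $P\rtimes W$ with the associated graded ring: the degree \<open>d\<close> component of
  \<open>f\<close> goes to the class of any lift to the degree \<open>d\<close> part of $T(\mathfrak h\oplus\mathfrak h^*)\rtimes W$.
  The union is over all lifts, which all give the same coset because generators from
  $\mathfrak h\oplus\mathfrak h^*$ commute up to terms of degree \<open>0\<close>.
\<close>

definition pbw :: "('n cmat \<Rightarrow> 'n sym) \<Rightarrow> nat \<Rightarrow> ('n cmat \<Rightarrow> 'n tens) set set" where
  "pbw f d =
     \<Union>{below cherednik cherednik_filtration d +>\<^bsub>cherednik\<^esub> (cherednik_ideal +>\<^bsub>TW W\<^esub> q) |q.
         q \<in> carrier (TW W) \<and>
         (\<forall>w. \<forall>u\<in>Poly_Mapping.keys (q w). word_deg u = d) \<and>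
         (\<forall>w. symmetrize (q w) = hom_part d (f w))}"

end

text \<open>The subalgebra $P^\Gamma\rtimes W$ of $P\rtimes W$.\<close>

definition PW_invariant_coeffs ::
    "('n::finite) cmat set \<Rightarrow> ('n hhd \<Rightarrow> 'n hhd) set \<Rightarrow> ('n cmat \<Rightarrow> 'n sym) set" where
  "PW_invariant_coeffs W \<Gamma> = {f \<in> carrier (PW W). \<forall>w. \<forall>g\<in>\<Gamma>. sym_map g (f w) = f w}"

end

theory Submission
  imports Defs "HOL-Library.Function_Algebras"
begin

text \<open>
  Let \<open>H\<close> be the Cherednik algebra at \<open>t = 0\<close>, and let \<open>\<sigma>\<close> be the symmetrization map from the symmetric
  to the tensor algebra. Dunkl operators represent \<open>H\<close> on functions on a \<open>W\<close>-stable set of generic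
  points of \<open>\<hh>* \<times> \<hh>\<close>; comparing leading terms under scaling of the points shows that the representation
  is faithful and that symbols of elements of \<open>H\<close> are well defined. As \<open>\<sigma>\<close> is equivariant, the symbols of
  \<open>\<Gamma>\<close>-invariants are exactly the elements with \<open>\<Gamma>\<close>-invariant coefficients, so the symbol of a central
  invariant is central among these.

  Conversely, a central element of the crossed product of \<open>P\<^sup>\<Gamma>\<close> with \<open>W\<close> is supported on those \<open>w\<close> that act
  trivially on \<open>P\<^sup>\<Gamma>\<close>. They belong to \<open>\<Gamma>\<close>, hence commute with all \<open>\<Gamma>\<close>-invariants of \<open>H\<close>, and the
  coefficients are \<open>W\<close>-invariant. So it remains to lift a \<open>W\<close>- and \<open>\<Gamma>\<close>-invariant polynomial \<open>p\<close> to a central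
  \<open>\<Gamma>\<close>-invariant element. The function \<open>\<phi> = \<sigma>(p) 1\<close> is \<open>W\<close>-invariant, so multiplication by \<open>\<phi>\<close> commutes with
  \<open>H\<close> and maps \<open>H 1\<close> to itself. Lagrange interpolation shows that the leading coefficients of an operator
  with the latter property are polynomials, and induction on the degree shows that it is given by
  an element \<open>z\<close> of \<open>H\<close>. This \<open>z\<close> is \<open>\<Gamma>\<close>-invariant because \<open>z \<mapsto> z e\<close> is injective on the centre, where \<open>e\<close> is
  the trivial idempotent of \<open>W\<close>.
\<close>

section \<open>Linear maps on monoid algebras\<close>

text \<open>At t = 0 a Dunkl operator contains no derivative: it is multiplication by a linear
  function plus a combination of reflections whose coefficients have degree -1. Hence arbitrary
  functions on a set of points can serve as the module, degrees can be read off from scaling alone,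
  and W-invariant functions commute with the whole algebra. What remains is a question of
  integrality: the function attached to p may have poles along the reflection hyperplanes, and
  multiplication by it must be shown to come from H. Interpolation at an orbit controls the leading
  coefficients, but brings in denominators of its own; an orbit in \<open>h\<close> and an orbit in
  \<open>h*\<close> give coprime ones, so the coefficients are polynomials. The representation
  treats \<open>h\<close> and \<open>h*\<close> differently, so the action of \<Gamma> is not
  visible on it. Invariance of the lift is therefore proved inside H, from the relation (z -
  \<sigma>(p)) e = 0, in which \<Gamma> fixes both \<sigma>(p) and e. The centres are compared
  degree by degree: each homogeneous component of a central symbol has its own lift.\<close>

lemma sum_fun_apply [simp]: "(\<Sum>a\<in>A. f a) x = (\<Sum>a\<in>A. f a x)"
  by (induction A rule: infinite_finite_induct) auto

lemma poly_mapping_induct_single [case_names zero single add]: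
  fixes p :: "'m \<Rightarrow>\<^sub>0 'b::comm_monoid_add"
  assumes z: "P 0" and s: "\<And>u a. P (Poly_Mapping.single u a)" and a: "\<And>p q. P p \<Longrightarrow> P q \<Longrightarrow> P (p + q)"
  shows "P p"
proof -
  have "p = (\<Sum>u\<in>Poly_Mapping.keys p. Poly_Mapping.single u (Poly_Mapping.lookup p u))"
    by (rule poly_mapping_eqI)
      (auto simp: lookup_sum lookup_single when_def sum.delta in_keys_iff if_distrib cong: if_cong)
  moreover have "P (\<Sum>u\<in>A. Poly_Mapping.single u (Poly_Mapping.lookup p u))" if "finite A" for A
    using that by (induction A) (auto intro: z s a)
  ultimately show ?thesis by (metis finite_keys)
qed

text \<open>Passing the coefficient to \<open>h\<close> instead of multiplying \<open>h\<close> by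
  it lets the codomain be any abelian group. The same lemmas on sums then serve algebra maps,
  evaluation at a point and operators on fields.\<close>

locale linear_extension =
  fixes h :: "complex \<Rightarrow> 'm \<Rightarrow> 'b::ab_group_add" and F
  assumes F: "\<And>p. F p = (\<Sum>u\<in>Poly_Mapping.keys p. h (Poly_Mapping.lookup p u) u)"
    and h_add: "\<And>a b u. h (a + b) u = h a u + h b u"
begin

lemma h_0 [simp]: "h 0 u = 0"
  using h_add[of 0 0 u] by simp

lemma ext_superset:
  assumes "finite A" "Poly_Mapping.keys p \<subseteq> A"
  shows "F p = (\<Sum>u\<in>A. h (Poly_Mapping.lookup p u) u)"
  unfolding F using assms by (intro sum.mono_neutral_left) (auto simp: in_keys_iff)

lemma ext_add: "F (p + q) = F p + F q"
proof -
  let ?A = "Poly_Mapping.keys p \<union> Poly_Mapping.keys q"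
  have "Poly_Mapping.keys (p + q) \<subseteq> ?A" by (rule keys_add)
  then show ?thesis
    by (simp add: ext_superset[of ?A] lookup_add h_add sum.distrib)
qed

lemma ext_0: "F 0 = 0" by (simp add: F)

lemma ext_single: "F (Poly_Mapping.single u a) = h a u"
  by (cases "a = 0") (auto simp: F)

lemma ext_uminus: "F (- p) = - F p"
  using ext_add[of p "- p"] by (simp add: ext_0 eq_neg_iff_add_eq_0 add.commute)

lemma ext_diff: "F (p - q) = F p - F q"
  using ext_add[of p "- q"] by (simp add: ext_uminus)

lemma ext_sum: "F (\<Sum>i\<in>A. p i) = (\<Sum>i\<in>A. F (p i))"
  by (induction A rule: infinite_finite_induct) (auto simp: ext_add ext_0)

end

lemma mult_by_singles:
  assumes F: "\<And>p q. F (p + q) = F p + F q" and F0: "F 0 = 0"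
    and s: "\<And>u v a b. F (Poly_Mapping.single u a * Poly_Mapping.single v b) =
               F (Poly_Mapping.single u a) * F (Poly_Mapping.single v b)"
  shows "F (p * q) = F p * (F q :: 'r::ring)"
proof (induction p rule: poly_mapping_induct_single)
  case zero then show ?case by (simp add: F0)
next
  case (single u a)
  show ?case
    by (induction q rule: poly_mapping_induct_single) (auto simp: F0 F s distrib_left)
next
  case (add p q) then show ?case by (simp add: F distrib_right)
qed

lemma const_0 [simp]: "const 0 = 0" and const_1 [simp]: "const 1 = 1"
  by (auto simp: const_def single_one)

lemma const_add: "const (a + b) = const a + const b"
  by (simp add: const_def single_add)

lemma const_uminus: "const (- a) = - const a"
  by (simp add: const_def single_uminus)

lemma const_mult: "const (a * b) = const a * const b"
  by (simp add: const_def mult_single)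

lemma const_single: "const a * Poly_Mapping.single u b = Poly_Mapping.single u (a * b)"
  by (simp add: const_def mult_single)

lemma single_const: "Poly_Mapping.single u b * const a = Poly_Mapping.single u (a * b)"
  by (simp add: const_def mult_single mult.commute)

lemma const_commute: "const a * p = p * const a"
  by (induction p rule: poly_mapping_induct_single) (auto simp: distrib_left distrib_right const_single single_const)

lemma lookup_const_mult: "Poly_Mapping.lookup (const a * p) u = a * Poly_Mapping.lookup p u"
  by (induction p rule: poly_mapping_induct_single)
     (auto simp: distrib_left const_single lookup_add lookup_single when_def)

lemma keys_const_mult: "Poly_Mapping.keys (const a * p) \<subseteq> Poly_Mapping.keys p"
  by (auto simp: in_keys_iff lookup_const_mult)

abbreviation word :: "'a list \<Rightarrow> complex \<Rightarrow> 'a free_monoid \<Rightarrow>\<^sub>0 complex" where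
  "word ks \<equiv> Poly_Mapping.single (FM ks)"

lemma FM_plus [simp]: "FM u + FM v = FM (u @ v)" by (simp add: plus_free_monoid_def)
lemma FM_Nil: "FM [] = 0" by (rule zero_free_monoid_def[symmetric])
lemma letters_0 [simp]: "letters 0 = []" unfolding zero_free_monoid_def by (rule free_monoid.sel)
lemma letters_plus [simp]: "letters (u + v) = letters u @ letters v" by (simp add: plus_free_monoid_def)

lemma word_mult: "word u a * word v b = word (u @ v) (a * b)"
  by (simp add: mult_single)

lemma tens_induct [case_names zero word add]:
  fixes p :: "'a free_monoid \<Rightarrow>\<^sub>0 complex"
  assumes "P 0" "\<And>ks a. P (word ks a)" "\<And>p q. P p \<Longrightarrow> P q \<Longrightarrow> P (p + q)"
  shows "P p"
  by (induction p rule: poly_mapping_induct_single) (metis assms free_monoid.collapse)+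

section \<open>The vectors of \<open>h + h*\<close> inside the tensor and symmetric algebras\<close>

definition scaleV :: "complex \<Rightarrow> 'n hhd \<Rightarrow> ('n::finite) hhd" where
  "scaleV a v = (a *s fst v, a *s snd v)"

lemma coord_add [simp]: "coord (u + v) k = coord u k + coord v k"
  by (auto simp: coord_def split: sum.splits)
lemma coord_scaleV [simp]: "coord (scaleV a v) k = a * coord v k"
  by (auto simp: coord_def scaleV_def split: sum.splits)
lemma coord_0 [simp]: "coord 0 k = 0"
  by (auto simp: coord_def split: sum.splits)
lemma coord_basis: "coord (basis j) k = (if j = k then 1 else 0)"
  by (auto simp: coord_def basis_def axis_def split: sum.splits)
lemma coord_eqI: "(\<And>k. coord u k = coord v k) \<Longrightarrow> u = v"
  apply (rule prod_eqI; rule vec_eq_iff[THEN iffD2]; rule allI)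
   apply (metis coord_def old.sum.simps(5))
  apply (metis coord_def old.sum.simps(6))
  done
lemma coord_sum: "coord (\<Sum>i\<in>A. f i) k = (\<Sum>i\<in>A. coord (f i) k)"
  by (induction A rule: infinite_finite_induct) auto
lemma basis_expansion_hhd: "v = (\<Sum>k\<in>UNIV. scaleV (coord v k) (basis k))"
  by (rule coord_eqI) (simp add: coord_sum coord_basis if_distrib cong: if_cong)

lemma tens_vec_add: "tens_vec (u + v) = tens_vec u + tens_vec v"
  by (simp add: tens_vec_def single_add sum.distrib)
lemma tens_vec_scaleV: "tens_vec (scaleV a v) = const a * tens_vec v"
  by (simp add: tens_vec_def sum_distrib_left const_single)
lemma tens_vec_sum: "tens_vec (\<Sum>i\<in>A. f i) = (\<Sum>i\<in>A. tens_vec (f i))"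
  by (induction A rule: infinite_finite_induct) (auto simp: tens_vec_add, auto simp: tens_vec_def)
lemma tens_vec_basis: "tens_vec (basis k) = word [k] 1"
proof -
  have "word [j] (coord (basis k) j) = (if j = k then word [k] 1 else 0)" for j
    by (auto simp: coord_basis)
  then show ?thesis by (simp add: tens_vec_def)
qed

lemma sym_vec_add: "sym_vec (u + v) = sym_vec u + sym_vec v"
  by (simp add: sym_vec_def single_add sum.distrib)
lemma sym_vec_scaleV: "sym_vec (scaleV a v) = const a * sym_vec v"
  by (simp add: sym_vec_def sum_distrib_left const_single)
lemma sym_vec_sum: "sym_vec (\<Sum>i\<in>A. f i) = (\<Sum>i\<in>A. sym_vec (f i))"
  by (induction A rule: infinite_finite_induct) (auto simp: sym_vec_add, auto simp: sym_vec_def)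
lemma sym_vec_basis: "sym_vec (basis k) = Poly_Mapping.single (Poly_Mapping.single k 1) 1"
proof -
  have "Poly_Mapping.single (Poly_Mapping.single j 1) (coord (basis k) j) =
      (if j = k then Poly_Mapping.single (Poly_Mapping.single k (1::nat)) 1 else 0)" for j
    by (auto simp: coord_basis)
  then show ?thesis by (simp add: sym_vec_def)
qed

definition linV :: "(('n::finite) hhd \<Rightarrow> 'n hhd) \<Rightarrow> bool" where
  "linV g \<longleftrightarrow> (\<forall>u v. g (u + v) = g u + g v) \<and> (\<forall>a v. g (scaleV a v) = scaleV a (g v))"

lemma linV_add: "linV g \<Longrightarrow> g (u + v) = g u + g v"
  and linV_scale: "linV g \<Longrightarrow> g (scaleV a v) = scaleV a (g v)"
  unfolding linV_def by blast+

lemma linV_comp: "linV g \<Longrightarrow> linV h \<Longrightarrow> linV (g \<circ> h)"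
  by (simp add: linV_def del: split_paired_All)
lemma linV_0: "linV g \<Longrightarrow> g 0 = 0"
  using linV_add[of g 0 0] by simp
lemma linV_sum: "linV g \<Longrightarrow> g (\<Sum>i\<in>A. f i) = (\<Sum>i\<in>A. g (f i))"
  by (induction A rule: infinite_finite_induct) (auto simp: linV_add linV_0)
lemma linV_expand: "linV g \<Longrightarrow> g v = (\<Sum>k\<in>UNIV. scaleV (coord v k) (g (basis k)))"
  by (subst basis_expansion_hhd[of v]) (simp add: linV_sum linV_scale)

section \<open>Algebra endomorphisms induced by linear maps\<close>

interpretation tens_map: linear_extension
  "\<lambda>a u. const a * prod_list (map (\<lambda>k. tens_vec (g (basis k))) (letters u))" "tens_map g"
  by unfold_locales (auto simp: tens_map_def const_add distrib_right)

interpretation sym_map: linear_extension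
  "\<lambda>a m. const a * (\<Prod>k\<in>UNIV. sym_vec (g (basis k)) ^ Poly_Mapping.lookup m k)" "sym_map g"
  by unfold_locales (auto simp: sym_map_def const_add distrib_right)

interpretation symmetrize: linear_extension
  "\<lambda>a u. Poly_Mapping.single (\<Sum>k\<leftarrow>letters u. Poly_Mapping.single k 1) a" symmetrize
  by unfold_locales (auto simp: symmetrize_def single_add)

lemma tens_map_word: "tens_map g (word ks a) = const a * prod_list (map (\<lambda>k. tens_vec (g (basis k))) ks)"
  by (simp add: tens_map.ext_single)

lemma tens_map_const: "tens_map g (const a) = const a"
  by (simp add: const_def tens_map.ext_single)
lemma tens_map_1: "tens_map g 1 = 1" using tens_map_const[of g 1] by simp

lemma tens_map_mult: "tens_map g (p * q) = tens_map g p * tens_map g q"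
proof (rule mult_by_singles)
  fix u v :: "('a + 'a) free_monoid" and a b
  have "c * x * (d * y) = c * d * (x * y)" if "c = const a" "d = const b" for c d x y :: "'a tens"
    using that by (metis const_commute mult.assoc)
  then show "tens_map g (Poly_Mapping.single u a * Poly_Mapping.single v b) =
          tens_map g (Poly_Mapping.single u a) * tens_map g (Poly_Mapping.single v b)"
    by (simp add: mult_single tens_map.ext_single const_mult)
qed (auto simp: tens_map.ext_add tens_map.ext_0)

lemma tens_map_prod_list: "tens_map g (prod_list xs) = prod_list (map (tens_map g) xs)"
  by (induction xs) (auto simp: tens_map_mult tens_map_1)

lemma tens_map_vec:
  assumes "linV g" shows "tens_map g (tens_vec v) = tens_vec (g v)"
proof -
  have "tens_map g (tens_vec v) = (\<Sum>k\<in>UNIV. const (coord v k) * tens_vec (g (basis k)))"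
    by (subst tens_vec_def) (simp add: tens_map.ext_sum tens_map_word)
  also have "\<dots> = tens_vec (g v)"
    by (subst (2) linV_expand[OF assms]) (simp add: tens_vec_sum tens_vec_scaleV)
  finally show ?thesis .
qed

lemma tens_map_comp:
  assumes "linV g" shows "tens_map g (tens_map h p) = tens_map (g \<circ> h) p"
  by (induction p rule: tens_induct)
    (auto simp: tens_map.ext_0 tens_map.ext_add tens_map_word tens_map_mult tens_map_const
        tens_map_prod_list comp_def tens_map_vec[OF assms])

lemma word_eq_prod: "word ks a = const a * prod_list (map (\<lambda>k. tens_vec (basis k)) ks)"
proof -
  have "prod_list (map (\<lambda>k. tens_vec (basis k)) ks) = word ks 1"
    by (induction ks) (auto simp: tens_vec_basis word_mult FM_Nil)
  then show ?thesis by (simp add: const_single)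
qed

lemma tens_map_id: "tens_map (\<lambda>v. v) p = p"
  by (induction p rule: tens_induct)
    (auto simp: tens_map.ext_0 tens_map.ext_add tens_map_word word_eq_prod[symmetric])

lemma sym_map_const: "sym_map g (const a) = const a"
  by (simp add: const_def sym_map.ext_single)
lemma sym_map_1: "sym_map g 1 = 1" using sym_map_const[of g 1] by simp

lemma sym_map_mult: "sym_map g (p * q) = sym_map g p * sym_map g q"
  by (rule mult_by_singles)
    (auto simp: sym_map.ext_add sym_map.ext_0 mult_single sym_map.ext_single const_mult lookup_add
        power_add prod.distrib algebra_simps)

lemma sym_map_basis: "sym_map g (sym_vec (basis k)) = sym_vec (g (basis k))"
proof -
  have "sym_vec (g (basis j)) ^ Poly_Mapping.lookup (Poly_Mapping.single k 1) j =
     (if j = k then sym_vec (g (basis k)) else 1)" for j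
    by (auto simp: lookup_single when_def)
  then show ?thesis by (simp add: sym_vec_basis sym_map.ext_single)
qed

lemma sym_map_vec:
  assumes "linV g" shows "sym_map g (sym_vec v) = sym_vec (g v)"
proof -
  have "sym_map g (sym_vec v) = (\<Sum>k\<in>UNIV. const (coord v k) * sym_vec (g (basis k)))"
    by (subst basis_expansion_hhd)
      (simp add: sym_vec_sum sym_vec_scaleV sym_map.ext_sum sym_map_mult sym_map_const sym_map_basis)
  also have "\<dots> = sym_vec (g v)"
    by (subst (2) linV_expand[OF assms]) (simp add: sym_vec_sum sym_vec_scaleV)
  finally show ?thesis .
qed

section \<open>Words, monomials and the projection from tensors to polynomials\<close>

definition mon :: "'a list \<Rightarrow> 'a \<Rightarrow>\<^sub>0 nat" where
  "mon ks = (\<Sum>k\<leftarrow>ks. Poly_Mapping.single k 1)"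

lemma mon_simps [simp]: "mon [] = 0" "mon (k # ks) = Poly_Mapping.single k 1 + mon ks"
  "mon (ks @ js) = mon ks + mon js"
  by (auto simp: mon_def)

lemma lookup_mon: "Poly_Mapping.lookup (mon ks) k = count (mset ks) k"
  by (induction ks) (auto simp: lookup_add lookup_single when_def)

lemma mon_eq_iff: "mon ks = mon js \<longleftrightarrow> mset ks = mset js"
  by (auto simp: poly_mapping_eq_iff fun_eq_iff lookup_mon multiset_eq_iff)

lemma mon_surj: "\<exists>ks. mon ks = (m :: ('a::finite) \<Rightarrow>\<^sub>0 nat)"
proof (induction m rule: poly_mapping_induct_single)
  case (single u a)
  have "mon (replicate a u) = Poly_Mapping.single u a"
    by (rule poly_mapping_eqI) (auto simp: lookup_mon lookup_single when_def)
  then show ?case by blast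
next
  case (add p q) then show ?case by (metis mon_simps(3))
qed (use mon_simps(1) in blast)

lemma mon_deg_mon: "mon_deg (mon ks) = length ks"
  by (simp add: mon_deg_def lookup_mon) (metis size_mset size_multiset_overloaded_eq
     sum.mono_neutral_left finite finite_set_mset subset_UNIV Diff_iff not_in_iff)

lemma symmetrize_word: "symmetrize (word ks a) = Poly_Mapping.single (mon ks) a"
  by (simp add: symmetrize.ext_single mon_def)

lemma symmetrize_mult: "symmetrize (p * q) = symmetrize p * symmetrize q"
  by (rule mult_by_singles)
    (auto simp: symmetrize.ext_0 symmetrize.ext_add symmetrize.ext_single mult_single)

lemma symmetrize_const: "symmetrize (const a) = const a"
  by (simp add: const_def symmetrize.ext_single)
lemma symmetrize_1: "symmetrize 1 = 1" using symmetrize_const[of 1] by simp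

lemma symmetrize_tens_vec: "symmetrize (tens_vec v) = sym_vec v"
  by (simp add: tens_vec_def symmetrize.ext_sum symmetrize_word sym_vec_def)

lemma symmetrize_prod_list: "symmetrize (prod_list xs) = prod_list (map symmetrize xs)"
  by (induction xs) (auto simp: symmetrize_mult symmetrize_1)

lemma symmetrize_tens_map:
  assumes "linV g" shows "symmetrize (tens_map g p) = sym_map g (symmetrize p)"
proof (induction p rule: tens_induct)
  case (word ks a)
  have "sym_map g (prod_list xs) = prod_list (map (sym_map g) xs)" for xs
    by (induction xs) (auto simp: sym_map_mult sym_map_1)
  then show ?case
    by (simp add: word_eq_prod[of ks a] tens_map_mult tens_map_const tens_map_prod_list symmetrize_mult
        symmetrize_const symmetrize_prod_list sym_map_mult sym_map_const comp_def symmetrize_tens_vec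
        tens_map_vec[OF assms] sym_map_vec[OF assms])
qed (auto simp: tens_map.ext_0 symmetrize.ext_0 sym_map.ext_0 tens_map.ext_add symmetrize.ext_add sym_map.ext_add)

text \<open>This lets identities for polynomials be proved on words and pushed down along the
  projection, as in \<open>sym_map_comp\<close> and \<open>dvd_diff_elim\<close>.\<close>

lemma symmetrize_surj: "\<exists>a. symmetrize a = p"
proof (induction p rule: poly_mapping_induct_single)
  case zero show ?case using symmetrize.ext_0 by blast
next
  case (single m a) then show ?case using mon_surj[of m] symmetrize_word by metis
next
  case (add p q) then show ?case by (metis symmetrize.ext_add)
qed

lemma sym_map_comp:
  assumes "linV g" "linV h" shows "sym_map g (sym_map h p) = sym_map (g \<circ> h) p"
proof -
  have "linV (g \<circ> h)" using assms by (rule linV_comp)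
  moreover obtain a where "p = symmetrize a" using symmetrize_surj by metis
  ultimately show ?thesis using assms by (metis symmetrize_tens_map tens_map_comp)
qed

lemma sym_map_id: "sym_map (\<lambda>v. v) p = p"
proof -
  have "linV (\<lambda>v. v)" by (simp add: linV_def)
  moreover obtain a where "p = symmetrize a" using symmetrize_surj by metis
  ultimately show ?thesis by (metis symmetrize_tens_map tens_map_id)
qed

section \<open>Homogeneous components of polynomials\<close>

lemma lookup_hom_part:
  "Poly_Mapping.lookup (hom_part d p) m = (if mon_deg m = d then Poly_Mapping.lookup p m else 0)"
  by (auto simp: hom_part_def lookup_sum lookup_single when_def in_keys_iff if_distrib cong: if_cong)

lemma hom_part_add: "hom_part d (p + q) = hom_part d p + hom_part d q"
  by (rule poly_mapping_eqI) (simp add: lookup_hom_part lookup_add)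
lemma hom_part_0 [simp]: "hom_part d 0 = 0"
  by (rule poly_mapping_eqI) (simp add: lookup_hom_part)
lemma hom_part_diff: "hom_part d (p - q) = hom_part d p - hom_part d q"
  by (rule poly_mapping_eqI) (simp add: lookup_hom_part lookup_minus)
lemma hom_part_sum: "hom_part d (\<Sum>i\<in>A. p i) = (\<Sum>i\<in>A. hom_part d (p i))"
  by (induction A rule: infinite_finite_induct) (auto simp: hom_part_add)
lemma hom_part_hom_part: "hom_part d (hom_part e p) = (if d = e then hom_part d p else 0)"
  by (rule poly_mapping_eqI) (simp add: lookup_hom_part)
lemma hom_part_const: "hom_part d (const a * p) = const a * hom_part d p"
  by (rule poly_mapping_eqI) (simp add: lookup_hom_part lookup_const_mult)

lemma mon_deg_add: "mon_deg (m + m') = mon_deg m + mon_deg m'"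
  by (simp add: mon_deg_def lookup_add sum.distrib)

lemma sum_hom_part:
  assumes "\<And>m. m \<in> Poly_Mapping.keys p \<Longrightarrow> mon_deg m < N"
  shows "p = (\<Sum>d<N. hom_part d p)"
  by (rule poly_mapping_eqI) (use assms in \<open>auto simp: lookup_sum lookup_hom_part in_keys_iff\<close>)

lemma ex_deg_bound: "\<exists>N. \<forall>m\<in>Poly_Mapping.keys p. mon_deg m < N"
  by (metis finite_imageI finite_keys finite_nat_set_iff_bounded imageI)

definition homog :: "nat \<Rightarrow> ('n::finite) sym \<Rightarrow> bool" where
  "homog d p \<longleftrightarrow> hom_part d p = p"

lemma homog_hom_part [simp]: "homog d (hom_part d p)"
  by (simp add: homog_def hom_part_hom_part)
lemma homog_iff: "homog d p \<longleftrightarrow> (\<forall>m\<in>Poly_Mapping.keys p. mon_deg m = d)"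
  by (auto simp: homog_def poly_mapping_eq_iff fun_eq_iff lookup_hom_part in_keys_iff)
lemma homog_diff: "homog d p \<Longrightarrow> homog d q \<Longrightarrow> homog d (p - q)"
  by (simp add: homog_def hom_part_diff)
lemma homog_0 [simp]: "homog d 0" by (simp add: homog_def)
lemma homog_sum: "(\<And>i. i \<in> A \<Longrightarrow> homog d (p i)) \<Longrightarrow> homog d (\<Sum>i\<in>A. p i)"
  by (simp add: homog_def hom_part_sum)
lemma homog_const: "homog d p \<Longrightarrow> homog d (const a * p)"
  by (simp add: homog_def hom_part_const)
lemma homog_mult: "homog d p \<Longrightarrow> homog e q \<Longrightarrow> homog (d + e) (p * q)"
  using keys_mult[of p q] by (fastforce simp: homog_iff mon_deg_add)
lemma homog_sym_vec: "homog 1 (sym_vec v)"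
proof -
  have "homog 1 (Poly_Mapping.single (Poly_Mapping.single k 1) a)" for k and a :: complex
    by (auto simp: homog_iff mon_deg_def lookup_single when_def)
  then show ?thesis unfolding sym_vec_def by (intro homog_sum)
qed
lemma homog_one [simp]: "homog 0 1"
  by (auto simp: homog_iff mon_deg_def)
lemma homog_hom_part_other: "homog d p \<Longrightarrow> e \<noteq> d \<Longrightarrow> hom_part e p = 0"
  unfolding homog_def using hom_part_hom_part[of e d p] by simp
lemma homog_power: "homog d p \<Longrightarrow> homog (d * n) (p ^ n)"
  by (induction n) (auto dest: homog_mult)
lemma homog_prod: "(\<And>i. i \<in> A \<Longrightarrow> homog (d i) (p i)) \<Longrightarrow> homog (\<Sum>i\<in>A. d i) (\<Prod>i\<in>A. p i)"
  by (induction A rule: infinite_finite_induct) (auto intro!: homog_mult)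

lemma homog_sym_map:
  assumes "homog d p" shows "homog d (sym_map g p)"
  unfolding sym_map_def
proof (intro homog_sum homog_const)
  fix m assume "m \<in> Poly_Mapping.keys p"
  then have d: "d = (\<Sum>k\<in>UNIV. 1 * Poly_Mapping.lookup m k)" using assms by (simp add: homog_iff mon_deg_def)
  show "homog d (\<Prod>k\<in>UNIV. sym_vec (g (basis k)) ^ Poly_Mapping.lookup m k)"
    unfolding d by (intro homog_prod homog_power homog_sym_vec)
qed

lemma hom_part_sym_map: "hom_part d (sym_map g p) = sym_map g (hom_part d p)"
proof -
  obtain N where "\<forall>m\<in>Poly_Mapping.keys p. mon_deg m < N" using ex_deg_bound by blast
  \<comment> \<open>The bound is raised above d so that the sum certainly contains the summand of
    index d.\<close>
  then have p: "p = (\<Sum>d<max N (Suc d). hom_part d p)" by (intro sum_hom_part) auto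
  have "hom_part d (sym_map g (hom_part e p)) = (if e = d then sym_map g (hom_part d p) else 0)" for e
    using homog_sym_map[of e "hom_part e p" g] homog_hom_part_other homog_def by (metis homog_hom_part)
  then show ?thesis by (subst p) (simp add: sym_map.ext_sum hom_part_sum)
qed

section \<open>Symmetrization\<close>

definition words_of :: "('a::finite \<Rightarrow>\<^sub>0 nat) \<Rightarrow> 'a list set" where
  "words_of m = {ks. mon ks = m}"

lemma finite_words_of [simp]: "finite (words_of m)"
proof (rule finite_subset)
  show "words_of m \<subseteq> {ks. set ks \<subseteq> UNIV \<and> length ks = mon_deg m}"
    by (auto simp: words_of_def mon_deg_mon)
qed (rule finite_lists_length_eq, simp)

lemma card_words_of: "card (words_of m) \<noteq> 0"
proof -
  obtain ks where "ks \<in> words_of m" using mon_surj[of m] by (auto simp: words_of_def)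
  then show ?thesis by (auto simp: card_eq_0_iff)
qed

text \<open>The section of \<open>symmetrize\<close> with symmetric values. Averaging over the
  distinct words of a monomial agrees with averaging over all permutations of one word, because
  every word arises from equally many permutations.\<close>

definition sigma :: "('n::finite) sym \<Rightarrow> 'n tens" where
  "sigma p = (\<Sum>m\<in>Poly_Mapping.keys p. \<Sum>ks\<in>words_of m.
     word ks (Poly_Mapping.lookup p m / of_nat (card (words_of m))))"

interpretation sigma: linear_extension "\<lambda>a m. \<Sum>ks\<in>words_of m. word ks (a / of_nat (card (words_of m)))" sigma
  by unfold_locales (auto simp: sigma_def single_add add_divide_distrib sum.distrib)

lemma lookup_sigma:
  "Poly_Mapping.lookup (sigma p) (FM ks) = Poly_Mapping.lookup p (mon ks) / of_nat (card (words_of (mon ks)))"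
proof (induction p rule: poly_mapping_induct_single)
  case (single m a)
  have "(\<Sum>js\<in>words_of m. Poly_Mapping.lookup (word js b) (FM ks)) = (if ks \<in> words_of m then b else 0)" for b
    by (simp add: lookup_single when_def)
  then show ?case
    by (auto simp: sigma.ext_single lookup_sum lookup_single when_def words_of_def)
qed (auto simp: sigma.ext_0 sigma.ext_add lookup_add add_divide_distrib)

lemma lookup_symmetrize:
  fixes a :: "('n::finite) tens"
  shows "Poly_Mapping.lookup (symmetrize a) m = (\<Sum>ks\<in>words_of m. Poly_Mapping.lookup a (FM ks))"
proof (induction a rule: tens_induct)
  case (word js b)
  have "(\<Sum>ks\<in>words_of m. Poly_Mapping.lookup (word js b) (FM ks)) = (if js \<in> words_of m then b else 0)"
    by (simp add: lookup_single when_def)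
  then show ?case
    by (auto simp: symmetrize_word lookup_single when_def words_of_def)
qed (auto simp: symmetrize.ext_0 symmetrize.ext_add lookup_add sum.distrib)

lemma symmetrize_sigma [simp]: "symmetrize (sigma p) = p"
proof (rule poly_mapping_eqI)
  fix m
  have "(\<Sum>ks\<in>words_of m. Poly_Mapping.lookup (sigma p) (FM ks)) =
      (\<Sum>ks\<in>words_of m. Poly_Mapping.lookup p m / of_nat (card (words_of m)))"
    by (intro sum.cong) (auto simp: lookup_sigma words_of_def)
  then show "Poly_Mapping.lookup (symmetrize (sigma p)) m = Poly_Mapping.lookup p m"
    using card_words_of[of m] by (simp add: lookup_symmetrize)
qed

text \<open>Invariance under permutation of the tensor factors, which on coefficients means
  dependence on the multiset of letters only. By \<open>symmetric_tensor_sigma\<close> and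
  \<open>sigma_symmetrize\<close> these tensors are exactly the values of
  \<open>sigma\<close>.\<close>

definition symmetric_tensor :: "('n::finite) tens \<Rightarrow> bool" where
  "symmetric_tensor a \<longleftrightarrow>
     (\<forall>ks js. mset ks = mset js \<longrightarrow> Poly_Mapping.lookup a (FM ks) = Poly_Mapping.lookup a (FM js))"

lemma symmetric_tensor_sigma: "symmetric_tensor (sigma p)"
  by (simp add: symmetric_tensor_def lookup_sigma mon_eq_iff[symmetric])

lemma sigma_symmetrize:
  fixes a :: "('n::finite) tens"
  assumes "symmetric_tensor a" shows "sigma (symmetrize a) = a"
proof (rule poly_mapping_eqI)
  fix u :: "('n + 'n) free_monoid"
  obtain ks where u: "u = FM ks" by (cases u)
  have "Poly_Mapping.lookup a (FM js) = Poly_Mapping.lookup a (FM ks)" if "js \<in> words_of (mon ks)" for js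
    using assms that unfolding symmetric_tensor_def words_of_def mem_Collect_eq mon_eq_iff by blast
  then have "(\<Sum>js\<in>words_of (mon ks). Poly_Mapping.lookup a (FM js)) =
      of_nat (card (words_of (mon ks))) * Poly_Mapping.lookup a (FM ks)"
    by simp
  moreover have "of_nat (card (words_of (mon ks))) \<noteq> (0 :: complex)"
    using card_words_of[of "mon ks"] by simp
  ultimately show "Poly_Mapping.lookup (sigma (symmetrize a)) u = Poly_Mapping.lookup a u"
    unfolding u lookup_sigma lookup_symmetrize by (metis nonzero_mult_div_cancel_left)
qed

lemma lookup_tens_vec_mult:
  fixes q :: "('n::finite) tens"
  shows "Poly_Mapping.lookup (tens_vec v * q) (FM ks) =
     (case ks of [] \<Rightarrow> 0 | k # ks' \<Rightarrow> coord v k * Poly_Mapping.lookup q (FM ks'))"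
proof (induction q rule: tens_induct)
  case (word js b)
  have "tens_vec v * word js b = (\<Sum>k\<in>UNIV. word (k # js) (coord v k * b))"
    by (simp add: tens_vec_def sum_distrib_right word_mult)
  moreover have "(\<Sum>x\<in>UNIV. if x = k \<and> js = ks' then coord v x * b else 0) =
      (if js = ks' then coord v k * b else 0)" for k ks'
    by (cases "js = ks'") auto
  ultimately show ?case
    by (cases ks) (auto simp: lookup_sum lookup_single when_def)
qed (auto simp: distrib_left lookup_add split: list.splits)

lemma lookup_prod_tens_vec:
  "Poly_Mapping.lookup (prod_list (map tens_vec vs)) (FM ks) =
     (if length ks = length vs then \<Prod>i<length ks. coord (vs ! i) (ks ! i) else 0)"
proof (induction vs arbitrary: ks)
  case Nil
  then show ?case by (auto simp: lookup_one when_def FM_Nil[symmetric])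
next
  case (Cons v vs)
  show ?case
  proof (cases ks)
    case (Cons k ks')
    have "(\<Prod>i<length (k # ks'). coord ((v # vs) ! i) ((k # ks') ! i)) =
        coord v k * (\<Prod>i<length ks'. coord (vs ! i) (ks' ! i))"
      by (simp add: prod.lessThan_Suc_shift del: prod.lessThan_Suc)
    then show ?thesis using Cons Cons.IH[of ks']
      by (auto simp: lookup_tens_vec_mult simp del: prod.lessThan_Suc)
  qed (simp add: lookup_tens_vec_mult)
qed

lemma lookup_tens_map:
  "Poly_Mapping.lookup (tens_map g a) (FM ks) =
     (\<Sum>js | length js = length ks. Poly_Mapping.lookup a (FM js) *
        (\<Prod>i<length ks. coord (g (basis (js ! i))) (ks ! i)))"
proof (induction a rule: tens_induct)
  case (word js b)
  have fin: "finite {js :: ('a + 'a) list. length js = length ks}"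
    using finite_lists_length_eq[of "UNIV :: ('a + 'a) set" "length ks"] by simp
  have m: "prod_list (map (\<lambda>k. tens_vec (g (basis k))) js) =
      prod_list (map tens_vec (map (\<lambda>k. g (basis k)) js))"
    by (simp add: comp_def)
  have "(\<Sum>js' | length js' = length ks. Poly_Mapping.lookup (word js b) (FM js') *
        (\<Prod>i<length ks. coord (g (basis (js' ! i))) (ks ! i))) =
      (\<Sum>js' | length js' = length ks. if js = js' then b *
        (\<Prod>i<length ks. coord (g (basis (js ! i))) (ks ! i)) else 0)"
    by (intro sum.cong) (auto simp: lookup_single when_def)
  then show ?case unfolding tens_map_word m lookup_const_mult lookup_prod_tens_vec
    by (simp add: sum.delta'[OF fin])
qed (auto simp: tens_map.ext_0 tens_map.ext_add lookup_add sum.distrib distrib_right)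

text \<open>The map \<open>g\<close> acts by the same matrix in every tensor factor, so a
  permutation of the target word can be undone by the same permutation of the source word, which
  leaves the coefficient of \<open>a\<close> unchanged.\<close>

lemma symmetric_tensor_tens_map:
  assumes "symmetric_tensor a" shows "symmetric_tensor (tens_map g a)"
  unfolding symmetric_tensor_def
proof (intro allI impI)
  fix ks js :: "('a + 'a) list" assume mset: "mset ks = mset js"
  then obtain p where P: "p permutes {..<length js}" "permute_list p js = ks"
    by (rule mset_eq_permutation)
  let ?n = "length js"
  have len: "length ks = ?n" using mset by (metis size_mset)
  have inv: "inv_into UNIV p permutes {..<?n}" using P(1) by (rule permutes_inv)
  have "(\<Sum>ls | length ls = ?n. Poly_Mapping.lookup a (FM ls) *
          (\<Prod>i<?n. coord (g (basis (ls ! i))) (ks ! i))) =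
        (\<Sum>ls | length ls = ?n. Poly_Mapping.lookup a (FM ls) *
          (\<Prod>i<?n. coord (g (basis (ls ! i))) (js ! i)))"
  proof (rule sum.reindex_bij_witness[where i = "permute_list p" and j = "permute_list (inv_into UNIV p)"])
    fix ls :: "('a + 'a) list" assume "ls \<in> {ls. length ls = ?n}"
    then have l: "length ls = ?n" by simp
    show "permute_list p (permute_list (inv_into UNIV p) ls) = ls"
      using permute_list_compose[of p ls "inv_into UNIV p"] P(1) l by (simp add: permutes_inv_o)
    show l': "permute_list (inv_into UNIV p) ls \<in> {ls. length ls = ?n}" using l by simp
    have "Poly_Mapping.lookup a (FM (permute_list (inv_into UNIV p) ls)) = Poly_Mapping.lookup a (FM ls)"
      using assms inv l unfolding symmetric_tensor_def by (metis mset_permute_list)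
    moreover have "(\<Prod>i<?n. coord (g (basis (permute_list (inv_into UNIV p) ls ! i))) (js ! i)) =
       (\<Prod>i<?n. coord (g (basis (permute_list (inv_into UNIV p) ls ! p i))) (js ! p i))"
      using prod.permute[OF P(1), of "\<lambda>i. coord (g (basis (permute_list (inv_into UNIV p) ls ! i))) (js ! i)"]
      by (simp add: comp_def)
    moreover have "\<dots> = (\<Prod>i<?n. coord (g (basis (ls ! i))) (ks ! i))"
    proof (rule prod.cong)
      fix i assume i: "i \<in> {..<?n}"
      then have "p i \<in> {..<?n}" using permutes_in_image[OF P(1)] by blast
      then have "permute_list (inv_into UNIV p) ls ! p i = ls ! i"
        using inv l P(1) by (simp add: permute_list_nth permutes_inverses)
      moreover have "js ! p i = ks ! i" using P i by (metis lessThan_iff permute_list_nth)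
      ultimately show "coord (g (basis (permute_list (inv_into UNIV p) ls ! p i))) (js ! p i) =
          coord (g (basis (ls ! i))) (ks ! i)" by simp
    qed simp
    ultimately show "Poly_Mapping.lookup a (FM (permute_list (inv_into UNIV p) ls)) *
          (\<Prod>i<?n. coord (g (basis (permute_list (inv_into UNIV p) ls ! i))) (js ! i)) =
        Poly_Mapping.lookup a (FM ls) * (\<Prod>i<?n. coord (g (basis (ls ! i))) (ks ! i))" by simp
  next
    fix ls :: "('a + 'a) list" assume "ls \<in> {ls. length ls = ?n}"
    then have l: "length ls = ?n" by simp
    show "permute_list (inv_into UNIV p) (permute_list p ls) = ls"
      using permute_list_compose[of "inv_into UNIV p" ls p] P(1) inv l by (simp add: permutes_inv_o)
    show "permute_list p ls \<in> {ls. length ls = ?n}" using l by simp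
  qed
  then show "Poly_Mapping.lookup (tens_map g a) (FM ks) = Poly_Mapping.lookup (tens_map g a) (FM js)"
    by (simp add: lookup_tens_map len)
qed

text \<open>Both sides are symmetric tensors with the same image in the symmetric algebra, and that
  image determines a symmetric tensor. This equivariance ties \<Gamma>-invariants of H to
  \<Gamma>-invariant polynomials.\<close>

lemma tens_map_sigma:
  assumes "linV g" shows "tens_map g (sigma p) = sigma (sym_map g p)"
  using sigma_symmetrize[OF symmetric_tensor_tens_map[OF symmetric_tensor_sigma], of g p]
  by (simp add: symmetrize_tens_map[OF assms])

lemma keys_sigma_homog:
  assumes "homog d p" "u \<in> Poly_Mapping.keys (sigma p)" shows "word_deg u = d"
proof -
  obtain ks where u: "u = FM ks" by (cases u)
  then have "mon ks \<in> Poly_Mapping.keys p" using assms(2) by (auto simp: in_keys_iff lookup_sigma)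
  then show ?thesis using assms(1) by (auto simp: homog_iff u mon_deg_mon word_deg_def)
qed

section \<open>Crossed products\<close>

locale matrix_group =
  fixes W :: "('n::finite) cmat set"
  assumes finite_W [simp]: "finite W"
    and one_W [simp]: "mat 1 \<in> W"
    and mult_W [simp]: "u \<in> W \<Longrightarrow> v \<in> W \<Longrightarrow> u ** v \<in> W"
    and inv_W [simp]: "w \<in> W \<Longrightarrow> matrix_inv w \<in> W"
    and r_inv: "w \<in> W \<Longrightarrow> w ** matrix_inv w = mat 1"
    and l_inv: "w \<in> W \<Longrightarrow> matrix_inv w ** w = mat 1"
begin

lemma mul_inv_cancel [simp]: "w \<in> W \<Longrightarrow> w ** (matrix_inv w ** x) = x"
  "w \<in> W \<Longrightarrow> matrix_inv w ** (w ** x) = x" for x :: "'n cmat"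
  by (simp_all add: matrix_mul_assoc r_inv l_inv)

lemma inv_unique: "u \<in> W \<Longrightarrow> u ** v = mat 1 \<Longrightarrow> v = matrix_inv u"
  by (metis l_inv matrix_mul_assoc matrix_mul_lid matrix_mul_rid)

lemma inv_mult: "u \<in> W \<Longrightarrow> v \<in> W \<Longrightarrow> matrix_inv (u ** v) = matrix_inv v ** matrix_inv u"
  by (rule inv_unique[symmetric]) (auto simp: matrix_mul_assoc[symmetric] r_inv)

lemma inv_inv [simp]: "w \<in> W \<Longrightarrow> matrix_inv (matrix_inv w) = w"
  by (rule inv_unique[symmetric]) (auto simp: l_inv)

lemma inv_one [simp]: "matrix_inv (mat 1) = (mat 1 :: 'n cmat)"
  by (rule inv_unique[symmetric]) auto

lemma inv_mult_in_W: "u \<in> W \<Longrightarrow> matrix_inv u ** w \<in> W \<longleftrightarrow> w \<in> W"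
  by (metis inv_W mul_inv_cancel(1) mult_W)

lemma sum_left_translate:
  assumes "u \<in> W" shows "(\<Sum>w\<in>W. f w) = (\<Sum>w\<in>W. f (u ** w))"
  by (rule sum.reindex_bij_witness[where i = "\<lambda>w. u ** w" and j = "\<lambda>w. matrix_inv u ** w"])
    (use assms in auto)

end

locale crossed_product = matrix_group W for W :: "('n::finite) cmat set" +
  fixes act :: "'n cmat \<Rightarrow> 'r \<Rightarrow> 'r::ring_1"
  assumes act_add: "act u (p + q) = act u p + act u q"
    and act_mult: "act u (p * q) = act u p * act u q"
    and act_1: "act u 1 = 1"
    and act_comp: "u \<in> W \<Longrightarrow> v \<in> W \<Longrightarrow> act (u ** v) p = act u (act v p)"
    and act_id: "act (mat 1) p = p"
begin

abbreviation R where "R \<equiv> crossed W act"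

lemma act_0 [simp]: "act u 0 = 0" using act_add[of u 0 0] by simp

lemma act_sum: "act u (\<Sum>i\<in>A. f i) = (\<Sum>i\<in>A. act u (f i))"
  by (induction A rule: infinite_finite_induct) (auto simp: act_add)

lemma carrier_R: "f \<in> carrier R \<longleftrightarrow> (\<forall>w. w \<notin> W \<longrightarrow> f w = 0)"
  by (simp add: crossed_def)

lemma mult_R: "(f \<otimes>\<^bsub>R\<^esub> g) w = (\<Sum>u\<in>W. f u * act u (g (matrix_inv u ** w)))"
  by (simp add: crossed_def)

lemma add_R [simp]: "f \<oplus>\<^bsub>R\<^esub> g = f + g"
  by (simp add: crossed_def plus_fun_def)

lemma zero_R [simp]: "\<zero>\<^bsub>R\<^esub> = 0"
  by (simp add: crossed_def zero_fun_def)

definition mono :: "'n cmat \<Rightarrow> 'r \<Rightarrow> 'n cmat \<Rightarrow> 'r" where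
  "mono u p = (\<lambda>w. if w = u then p else 0)"

lemma one_R: "\<one>\<^bsub>R\<^esub> = mono (mat 1) 1"
  by (simp add: crossed_def mono_def)

lemma mono_carrier [simp]: "u \<in> W \<Longrightarrow> mono u p \<in> carrier R"
  by (auto simp: carrier_R mono_def)

lemma mult_closed_R [simp]: "f \<in> carrier R \<Longrightarrow> g \<in> carrier R \<Longrightarrow> f \<otimes>\<^bsub>R\<^esub> g \<in> carrier R"
  by (auto simp: carrier_R mult_R inv_mult_in_W)

lemma mult_R_assoc: "(f \<otimes>\<^bsub>R\<^esub> g) \<otimes>\<^bsub>R\<^esub> h = f \<otimes>\<^bsub>R\<^esub> (g \<otimes>\<^bsub>R\<^esub> h)"
proof
  fix w
  have "((f \<otimes>\<^bsub>R\<^esub> g) \<otimes>\<^bsub>R\<^esub> h) w =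
      (\<Sum>u\<in>W. \<Sum>v\<in>W. f v * act v (g (matrix_inv v ** u)) * act u (h (matrix_inv u ** w)))"
    by (simp add: mult_R sum_distrib_right)
  also have "\<dots> = (\<Sum>v\<in>W. \<Sum>u\<in>W. f v * act v (g (matrix_inv v ** u)) * act u (h (matrix_inv u ** w)))"
    by (rule sum.swap)
  also have "\<dots> = (\<Sum>v\<in>W. \<Sum>x\<in>W. f v * act v (g x * act x (h (matrix_inv x ** (matrix_inv v ** w)))))"
  proof (rule sum.cong[OF refl])
    fix v assume v: "v \<in> W"
    \<comment> \<open>The summation index u is replaced by \<open>v ** x\<close>.\<close>
    show "(\<Sum>u\<in>W. f v * act v (g (matrix_inv v ** u)) * act u (h (matrix_inv u ** w))) =
       (\<Sum>x\<in>W. f v * act v (g x * act x (h (matrix_inv x ** (matrix_inv v ** w)))))"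
      by (subst sum_left_translate[OF v], rule sum.cong)
        (use v in \<open>auto simp: act_mult act_comp inv_mult matrix_mul_assoc[symmetric] mult.assoc\<close>)
  qed
  also have "\<dots> = (f \<otimes>\<^bsub>R\<^esub> (g \<otimes>\<^bsub>R\<^esub> h)) w"
    by (simp add: mult_R act_sum sum_distrib_left)
  finally show "((f \<otimes>\<^bsub>R\<^esub> g) \<otimes>\<^bsub>R\<^esub> h) w = (f \<otimes>\<^bsub>R\<^esub> (g \<otimes>\<^bsub>R\<^esub> h)) w" .
qed

lemma mono_mult_left: "u \<in> W \<Longrightarrow> mono u p \<otimes>\<^bsub>R\<^esub> f = (\<lambda>w. p * act u (f (matrix_inv u ** w)))"
  by (rule ext) (simp add: mult_R mono_def if_distrib[of "\<lambda>x. x * _"] cong: if_cong)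

lemma mono_mult_right: "f \<in> carrier R \<Longrightarrow> v \<in> W \<Longrightarrow>
    (f \<otimes>\<^bsub>R\<^esub> mono v q) w = f (w ** matrix_inv v) * act (w ** matrix_inv v) q"
proof -
  assume f: "f \<in> carrier R" and v: "v \<in> W"
  have iff: "matrix_inv u ** w = v \<longleftrightarrow> u = w ** matrix_inv v" if "u \<in> W" for u
    using v that by (metis l_inv r_inv matrix_mul_assoc matrix_mul_rid matrix_mul_lid)
  have "(f \<otimes>\<^bsub>R\<^esub> mono v q) w = (\<Sum>u\<in>W. if u = w ** matrix_inv v then f u * act u q else 0)"
    unfolding mult_R by (rule sum.cong) (auto simp: mono_def iff)
  also have "\<dots> = f (w ** matrix_inv v) * act (w ** matrix_inv v) q"
    using f by (auto simp: carrier_R)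
  finally show ?thesis .
qed

lemma mono_mult_mono: "u \<in> W \<Longrightarrow> v \<in> W \<Longrightarrow> mono u p \<otimes>\<^bsub>R\<^esub> mono v q = mono (u ** v) (p * act u q)"
proof
  fix w assume "u \<in> W" "v \<in> W"
  moreover from this have "matrix_inv u ** w = v \<longleftrightarrow> w = u ** v"
    by (metis mul_inv_cancel)
  ultimately show "(mono u p \<otimes>\<^bsub>R\<^esub> mono v q) w = mono (u ** v) (p * act u q) w"
    by (simp add: mono_mult_left) (simp add: mono_def)
qed

lemma mono_add: "mono u (p + q) = mono u p + mono u q"
  by (auto simp: mono_def fun_eq_iff)
lemma mono_0 [simp]: "mono u 0 = 0"
  by (auto simp: mono_def fun_eq_iff)
lemma mono_diff: "mono u (p - q) = mono u p - mono u q"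
  by (auto simp: mono_def fun_eq_iff)
lemma mono_sum: "mono u (\<Sum>i\<in>A. f i) = (\<Sum>i\<in>A. mono u (f i))"
  by (induction A rule: infinite_finite_induct) (auto simp: mono_add)

lemma expand_mono: "f \<in> carrier R \<Longrightarrow> f = (\<Sum>u\<in>W. mono u (f u))"
  by (rule ext) (auto simp: carrier_R mono_def)

lemma add_carrier: "f \<in> carrier R \<Longrightarrow> g \<in> carrier R \<Longrightarrow> f + g \<in> carrier R"
  and uminus_carrier: "f \<in> carrier R \<Longrightarrow> - f \<in> carrier R"
  and diff_carrier: "f \<in> carrier R \<Longrightarrow> g \<in> carrier R \<Longrightarrow> f - g \<in> carrier R"
  and zero_carrier: "0 \<in> carrier R"
  by (auto simp: carrier_R)

lemma sum_carrier: "(\<And>i. i \<in> A \<Longrightarrow> f i \<in> carrier R) \<Longrightarrow> (\<Sum>i\<in>A. f i) \<in> carrier R"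
  by (auto simp: carrier_R)

lemmas carrier_intros [simp, intro] = add_carrier uminus_carrier diff_carrier zero_carrier sum_carrier

lemma mult_R_add_left: "(f + g) \<otimes>\<^bsub>R\<^esub> h = f \<otimes>\<^bsub>R\<^esub> h + g \<otimes>\<^bsub>R\<^esub> h"
  by (rule ext) (simp add: mult_R distrib_right sum.distrib)
lemma mult_R_add_right: "h \<otimes>\<^bsub>R\<^esub> (f + g) = h \<otimes>\<^bsub>R\<^esub> f + h \<otimes>\<^bsub>R\<^esub> g"
  by (rule ext) (simp add: mult_R act_add distrib_left sum.distrib)

sublocale ring R
proof (rule ringI)
  show "abelian_group R"
  proof (rule abelian_groupI)
    fix x assume "x \<in> carrier R"
    then show "\<exists>y\<in>carrier R. y \<oplus>\<^bsub>R\<^esub> x = \<zero>\<^bsub>R\<^esub>" by (intro bexI[of _ "- x"]) auto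
  qed (auto simp: add.assoc add.commute)
  show "Group.monoid R"
  proof (rule Group.monoidI)
    show "\<one>\<^bsub>R\<^esub> \<in> carrier R" by (simp add: one_R)
    show "\<one>\<^bsub>R\<^esub> \<otimes>\<^bsub>R\<^esub> x = x" if "x \<in> carrier R" for x
      by (simp add: one_R mono_mult_left act_id)
    show "x \<otimes>\<^bsub>R\<^esub> \<one>\<^bsub>R\<^esub> = x" if "x \<in> carrier R" for x
      by (rule ext) (simp add: one_R mono_mult_right that act_1)
  qed (auto simp: mult_R_assoc)
qed (auto simp: mult_R_add_left mult_R_add_right)

lemma a_inv_R [simp]: "f \<in> carrier R \<Longrightarrow> \<ominus>\<^bsub>R\<^esub> f = - f"
  by (rule minus_equality) auto

lemma a_minus_R [simp]: "f \<in> carrier R \<Longrightarrow> g \<in> carrier R \<Longrightarrow> f \<ominus>\<^bsub>R\<^esub> g = f - g"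
  by (simp add: a_minus_def)

lemma finsum_R: "finite A \<Longrightarrow> (\<And>i. i \<in> A \<Longrightarrow> f i \<in> carrier R) \<Longrightarrow> finsum R f A = (\<Sum>i\<in>A. f i)"
proof (induction A rule: finite_induct)
  case (insert x F)
  then have "finsum R f (insert x F) = f x \<oplus>\<^bsub>R\<^esub> finsum R f F" by (intro finsum_insert) auto
  then show ?case using insert by simp
qed simp

lemma mult_R_diff_left: "f \<in> carrier R \<Longrightarrow> (f - g) \<otimes>\<^bsub>R\<^esub> h = f \<otimes>\<^bsub>R\<^esub> h - g \<otimes>\<^bsub>R\<^esub> h"
  using mult_R_add_left[of "f - g" g h] by simp
lemma mult_R_diff_right: "h \<otimes>\<^bsub>R\<^esub> (f - g) = h \<otimes>\<^bsub>R\<^esub> f - h \<otimes>\<^bsub>R\<^esub> g"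
  using mult_R_add_right[of h "f - g" g] by simp
lemma mult_R_sum_left: "(\<Sum>i\<in>A. f i) \<otimes>\<^bsub>R\<^esub> h = (\<Sum>i\<in>A. f i \<otimes>\<^bsub>R\<^esub> h)"
  by (rule ext) (simp add: mult_R sum_distrib_right, rule sum.swap)
lemma mult_R_sum_right: "h \<otimes>\<^bsub>R\<^esub> (\<Sum>i\<in>A. f i) = (\<Sum>i\<in>A. h \<otimes>\<^bsub>R\<^esub> f i)"
  by (rule ext) (simp add: mult_R sum_distrib_left act_sum, rule sum.swap)

lemma expand_mult_R: "f \<in> carrier R \<Longrightarrow> g \<in> carrier R \<Longrightarrow>
    f \<otimes>\<^bsub>R\<^esub> g = (\<Sum>u\<in>W. \<Sum>v\<in>W. mono (u ** v) (f u * act u (g v)))"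
  by (subst expand_mono[of f], assumption, subst expand_mono[of g], assumption)
    (simp add: mult_R_sum_left mult_R_sum_right mono_mult_mono, rule sum.swap)

end

section \<open>Normal forms in the Cherednik algebra\<close>

lemma keys_mult_word_deg:
  assumes "u \<in> Poly_Mapping.keys (p * q)"
  obtains v w where "v \<in> Poly_Mapping.keys p" "w \<in> Poly_Mapping.keys q" "word_deg u = word_deg v + word_deg w"
  using assms keys_mult[of p q] by (force simp: word_deg_def)

lemma keys_tens_map:
  assumes "u \<in> Poly_Mapping.keys (tens_map g a)"
  shows "\<exists>v\<in>Poly_Mapping.keys a. word_deg v = word_deg u"
proof -
  obtain ks where u: "u = FM ks" by (cases u)
  have "(\<Sum>js | length js = length ks. Poly_Mapping.lookup a (FM js) *
        (\<Prod>i<length ks. coord (g (basis (js ! i))) (ks ! i))) \<noteq> 0"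
    using assms by (simp add: in_keys_iff u lookup_tens_map)
  then obtain js where "length js = length ks" "Poly_Mapping.lookup a (FM js) \<noteq> 0"
    by (metis (mono_tags, lifting) mem_Collect_eq mult_eq_0_iff sum.neutral)
  then show ?thesis by (intro bexI[of _ "FM js"]) (auto simp: in_keys_iff u word_deg_def)
qed

definition tens_part :: "nat \<Rightarrow> ('n::finite) tens \<Rightarrow> 'n tens" where
  "tens_part d a = (\<Sum>u\<in>{u \<in> Poly_Mapping.keys a. word_deg u = d}. Poly_Mapping.single u (Poly_Mapping.lookup a u))"

lemma lookup_tens_part:
  "Poly_Mapping.lookup (tens_part d a) u = (if word_deg u = d then Poly_Mapping.lookup a u else 0)"
  by (auto simp: tens_part_def lookup_sum lookup_single when_def in_keys_iff if_distrib cong: if_cong)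

lemma tens_part_add: "tens_part d (a + b) = tens_part d a + tens_part d b"
  by (rule poly_mapping_eqI) (simp add: lookup_tens_part lookup_add)
lemma tens_part_0 [simp]: "tens_part d 0 = 0"
  by (rule poly_mapping_eqI) (simp add: lookup_tens_part)

lemma symmetrize_tens_part: "symmetrize (tens_part d a) = hom_part d (symmetrize a)"
proof (induction a rule: tens_induct)
  case (word ks b)
  have "tens_part d (word ks b) = (if length ks = d then word ks b else 0)"
    by (rule poly_mapping_eqI) (auto simp: lookup_tens_part lookup_single when_def word_deg_def)
  moreover have "hom_part d (Poly_Mapping.single (mon ks) b) = (if length ks = d then Poly_Mapping.single (mon ks) b else 0)"
    by (rule poly_mapping_eqI) (auto simp: lookup_hom_part lookup_single when_def mon_deg_mon)
  ultimately show ?case by (simp add: symmetrize_word symmetrize.ext_0)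
qed (auto simp: symmetrize.ext_0 symmetrize.ext_add tens_part_add hom_part_add)

lemma sym_eq_sum_words: "sigma (symmetrize (word ks b)) =
    (\<Sum>js\<in>words_of (mon ks). word js (b / of_nat (card (words_of (mon ks)))))"
  by (simp add: symmetrize_word sigma.ext_single)

lemma pairing_add_left: "pairing (x + x') y = pairing x y + pairing x' y"
  and pairing_add_right: "pairing x (y + y') = pairing x y + pairing x y'"
  and pairing_scale_left: "pairing (a *s x) y = a * pairing x y"
  and pairing_scale_right: "pairing x (a *s y) = a * pairing x y"
  and pairing_0_left [simp]: "pairing 0 y = 0"
  and pairing_0_right [simp]: "pairing x 0 = 0"
  by (auto simp: pairing_def distrib_left distrib_right sum.distrib sum_distrib_left mult_ac)

lemma pairing_diff_right: "pairing x (y - y') = pairing x y - pairing x y'"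
  using pairing_add_right[of x "y - y'" y'] by simp

lemma pairing_matrix: "pairing (x v* A) y = pairing x (A *v y)"
  unfolding pairing_def matrix_vector_mult_def vector_matrix_mult_def
  by (simp add: sum_distrib_left sum_distrib_right mult_ac, rule sum.swap)

lemma W_act_apply: "W_act w v = (w *v fst v, snd v v* matrix_inv w)"
  by (simp add: W_act_def split_beta)

lemma linV_W_act [simp]: "linV (W_act w)"
  unfolding linV_def
  by (simp add: W_act_apply scaleV_def matrix_vector_right_distrib vector_matrix_left_distrib
      vector_scalar_commute scalar_vector_matrix_assoc del: split_paired_All)

context matrix_group begin

lemma W_act_mult: "u \<in> W \<Longrightarrow> v \<in> W \<Longrightarrow> W_act (u ** v) = W_act u \<circ> W_act v"
  by (rule ext) (simp add: W_act_apply inv_mult matrix_vector_mul_assoc vector_matrix_mul_assoc)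

lemma W_act_one: "W_act (mat 1 :: 'n cmat) = (\<lambda>v. v)"
  by (rule ext) (simp add: W_act_apply)

end

lemma crossed_product_tens: "matrix_group W \<Longrightarrow> crossed_product W (\<lambda>w. tens_map (W_act w))"
  unfolding crossed_product_def
  by (intro conjI crossed_product_axioms.intro)
    (auto simp: tens_map.ext_add tens_map_mult tens_map_1 tens_map_comp matrix_group.W_act_mult
        matrix_group.W_act_one tens_map_id)

lemma crossed_product_sym: "matrix_group W \<Longrightarrow> crossed_product W (\<lambda>w. sym_map (W_act w))"
  unfolding crossed_product_def
  by (intro conjI crossed_product_axioms.intro)
    (auto simp: sym_map.ext_add sym_map_mult sym_map_1 sym_map_comp matrix_group.W_act_mult
        matrix_group.W_act_one sym_map_id)

section \<open>The relations of the Cherednik algebra in uniform form\<close>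

locale reflection_data = matrix_group W for W :: "('n::finite) cmat set" +
  fixes \<alpha> \<alpha>v :: "'n cmat \<Rightarrow> complex ^ 'n" and c :: "'n cmat \<Rightarrow> complex"
  assumes root_data: "root_data W \<alpha> \<alpha>v" and conj_invariant: "conj_invariant W c"
begin

sublocale TW: crossed_product W "\<lambda>w. tens_map (W_act w)"
  by (rule crossed_product_tens) (rule matrix_group_axioms)
sublocale PW: crossed_product W "\<lambda>w. sym_map (W_act w)"
  by (rule crossed_product_sym) (rule matrix_group_axioms)

abbreviation S where "S \<equiv> reflections W"

lemma S_W [simp]: "s \<in> S \<Longrightarrow> s \<in> W" by (simp add: reflections_def)
lemma finite_S [simp]: "finite S" using finite_subset[of S W] finite_W S_W by blast

text \<open>The alternating form on \<open>h + h*\<close> attached to s. With it the three families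
  of relations become one: the commutator of u and v is the sum of
  \<open>kappa_coeff s * kappa s u v\<close> times s, for arbitrary u and v. A form of this kind is
  wanted because SL2 mixes \<open>h\<close> with \<open>h*\<close>.\<close>

definition kappa :: "'n cmat \<Rightarrow> 'n hhd \<Rightarrow> 'n hhd \<Rightarrow> complex" where
  "kappa s u v = pairing (snd v) (\<alpha>v s) * pairing (\<alpha> s) (fst u) - pairing (snd u) (\<alpha>v s) * pairing (\<alpha> s) (fst v)"

definition kappa_coeff :: "'n cmat \<Rightarrow> complex" where
  "kappa_coeff s = - (2 * c s / pairing (\<alpha> s) (\<alpha>v s))"

definition Rel :: "'n hhd \<Rightarrow> 'n hhd \<Rightarrow> 'n cmat \<Rightarrow> 'n tens" where
  "Rel u v = TW.mono (mat 1) (tens_vec u * tens_vec v - tens_vec v * tens_vec u) -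
     (\<Sum>s\<in>S. TW.mono s (const (kappa_coeff s * kappa s u v)))"

abbreviation I where "I \<equiv> cherednik_ideal W \<alpha> \<alpha>v 0 c"

lemma Rel_carrier [simp]: "Rel u v \<in> carrier TW.R"
  by (simp add: Rel_def)

lemma kappa_add_left: "kappa s (u + u') v = kappa s u v + kappa s u' v"
  and kappa_swap: "kappa s v u = - kappa s u v"
  by (auto simp: kappa_def pairing_add_left pairing_add_right algebra_simps)

lemma Rel_add_left: "Rel (u + u') v = Rel u v + Rel u' v"
  by (simp add: Rel_def kappa_add_left tens_vec_add TW.mono_add TW.mono_diff const_add sum.distrib algebra_simps)
lemma Rel_swap: "Rel v u = - Rel u v"
proof -
  have "TW.mono s (- p) = - TW.mono s p" for s p
    using TW.mono_diff[of s 0 p] by simp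
  then show ?thesis
    unfolding Rel_def kappa_swap[of _ v u]
    by (simp add: TW.mono_diff const_uminus sum_negf)
qed
lemma Rel_add_right: "Rel u (v + v') = Rel u v + Rel u v'"
  by (metis Rel_swap Rel_add_left minus_add_distrib)

lemma coeff_elt_mono: "coeff_elt p = TW.mono (mat 1) p" "group_elt s = TW.mono s 1"
  by (auto simp: coeff_elt_def group_elt_def TW.mono_def)

lemma relations_eq:
  "cherednik_relations W \<alpha> \<alpha>v 0 c = {Rel (0, x) (0, x') |x x'. True} \<union> {Rel (y, 0) (y', 0) |y y'. True} \<union>
     {Rel (y, 0) (0, x) |y x. True}"
proof -
  have com: "commutator (TW W) (coeff_elt p) (coeff_elt q) = TW.mono (mat 1) (p * q - q * p)" for p q :: "'n tens"
    by (simp add: commutator_def TW_def coeff_elt_mono TW.mono_mult_mono TW.mono_diff tens_map_id W_act_one)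
  have 1: "commutator (TW W) (x_elt x) (x_elt x') = Rel (0, x) (0, x')" for x x'
    unfolding x_elt_def com by (simp add: Rel_def kappa_def)
  have 2: "commutator (TW W) (y_elt y) (y_elt y') = Rel (y, 0) (y', 0)" for y y'
    unfolding y_elt_def com by (simp add: Rel_def kappa_def)
  have s: "(\<Oplus>\<^bsub>TW W\<^esub>s\<in>S. scalar_elt (2 * c s / pairing (\<alpha> s) (\<alpha>v s) * pairing x (\<alpha>v s) * pairing (\<alpha> s) y)
              \<otimes>\<^bsub>TW W\<^esub> group_elt s) = - (\<Sum>s\<in>S. TW.mono s (const (kappa_coeff s * kappa s (y, 0) (0, x))))" for x y
  proof -
    have "scalar_elt (2 * c s / pairing (\<alpha> s) (\<alpha>v s) * pairing x (\<alpha>v s) * pairing (\<alpha> s) y)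
              \<otimes>\<^bsub>TW W\<^esub> group_elt s = - TW.mono s (const (kappa_coeff s * kappa s (y, 0) (0, x)))" if "s \<in> S" for s
      using that TW.mono_diff[of s 0]
      by (simp add: TW_def scalar_elt_def coeff_elt_mono TW.mono_mult_mono tens_map_1 kappa_coeff_def kappa_def
          const_uminus mult.assoc)
    then show ?thesis
      unfolding TW_def by (subst TW.finsum_R) (auto simp: sum_negf)
  qed
  have 3: "commutator (TW W) (y_elt y) (x_elt x) \<ominus>\<^bsub>TW W\<^esub>
        (scalar_elt (0 * pairing x y) \<ominus>\<^bsub>TW W\<^esub>
         (\<Oplus>\<^bsub>TW W\<^esub>s\<in>S.
            scalar_elt (2 * c s / pairing (\<alpha> s) (\<alpha>v s) * pairing x (\<alpha>v s) * pairing (\<alpha> s) y)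
              \<otimes>\<^bsub>TW W\<^esub> group_elt s)) = Rel (y, 0) (0, x)" for x y
    unfolding s y_elt_def x_elt_def com
    by (simp add: TW_def scalar_elt_def coeff_elt_mono Rel_def TW.mono_def[of _ 0] zero_fun_def[symmetric])
  show ?thesis unfolding cherednik_relations_def 1 2 3 ..
qed

lemma I_ideal: "ideal I TW.R"
  unfolding cherednik_ideal_def relations_eq TW_def by (rule TW.genideal_ideal) auto

lemma relations_I: "cherednik_relations W \<alpha> \<alpha>v 0 c \<subseteq> I"
  unfolding cherednik_ideal_def TW_def relations_eq by (rule TW.genideal_self) auto

lemma I_minimal:
  assumes "ideal J TW.R" "\<And>u v. Rel u v \<in> J" shows "I \<subseteq> J"
  unfolding cherednik_ideal_def TW_def relations_eq
  by (rule TW.genideal_minimal) (use assms in auto)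

lemma I_carrier: "f \<in> I \<Longrightarrow> f \<in> carrier TW.R"
  using ideal.Icarr[OF I_ideal] by blast
lemma I_add: "f \<in> I \<Longrightarrow> g \<in> I \<Longrightarrow> f + g \<in> I"
  using additive_subgroup.a_closed[OF ideal.axioms(1)[OF I_ideal]] by simp
lemma I_zero [simp]: "0 \<in> I"
  using additive_subgroup.zero_closed[OF ideal.axioms(1)[OF I_ideal]] by simp
lemma I_uminus: "f \<in> I \<Longrightarrow> - f \<in> I"
  using additive_subgroup.a_inv_closed[OF ideal.axioms(1)[OF I_ideal]] TW.a_inv_R[OF I_carrier] by fastforce
lemma I_diff: "f \<in> I \<Longrightarrow> g \<in> I \<Longrightarrow> f - g \<in> I"
  using I_add[of f "- g"] I_uminus[of g] by simp
lemma I_sum: "(\<And>i. i \<in> A \<Longrightarrow> f i \<in> I) \<Longrightarrow> (\<Sum>i\<in>A. f i) \<in> I"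
  by (induction A rule: infinite_finite_induct) (auto simp: I_add)
lemma I_left: "a \<in> carrier TW.R \<Longrightarrow> f \<in> I \<Longrightarrow> a \<otimes>\<^bsub>TW.R\<^esub> f \<in> I"
  by (rule ideal.I_l_closed[OF I_ideal])
lemma I_right: "a \<in> carrier TW.R \<Longrightarrow> f \<in> I \<Longrightarrow> f \<otimes>\<^bsub>TW.R\<^esub> a \<in> I"
  by (rule ideal.I_r_closed[OF I_ideal])
text \<open>By biadditivity both vectors split into their components in \<open>h\<close> and
  \<open>h*\<close>, and antisymmetry brings mixed pairs into the order of the generators.\<close>

lemma Rel_I: "Rel u v \<in> I"
proof -
  have I: "Rel (0, x) (0, x') \<in> I" "Rel (y, 0) (y', 0) \<in> I" "Rel (y, 0) (0, x) \<in> I" for x x' y y'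
    using relations_I unfolding relations_eq by blast+
  have I': "Rel (0, x) (y, 0) \<in> I" for x y
    using I_uminus[OF I(3)] Rel_swap by metis
  have "u = (fst u, 0) + (0, snd u)" "v = (fst v, 0) + (0, snd v)" by auto
  then show ?thesis by (metis I I' Rel_add_left Rel_add_right I_add)
qed

text \<open>A strict bound, so that \<open>deg_lt 0\<close> holds only for 0 and
  \<open>deg_lt d\<close> describes the filtration step d - 1 for every d, including the convention
  that step -1 is zero.\<close>

definition deg_lt :: "nat \<Rightarrow> ('n cmat \<Rightarrow> 'n tens) \<Rightarrow> bool" where
  "deg_lt d f \<longleftrightarrow> (\<forall>w. \<forall>u\<in>Poly_Mapping.keys (f w). word_deg u < d)"

lemma deg_lt_add: "deg_lt d f \<Longrightarrow> deg_lt d g \<Longrightarrow> deg_lt d (f + g)"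
  unfolding deg_lt_def plus_fun_def by (auto dest!: subsetD[OF keys_add])
lemma deg_lt_uminus: "deg_lt d f \<Longrightarrow> deg_lt d (- f)"
  unfolding deg_lt_def by (simp add: in_keys_iff)
lemma deg_lt_zero [simp]: "deg_lt d 0"
  unfolding deg_lt_def by simp
lemma deg_lt_sum: "(\<And>i. i \<in> A \<Longrightarrow> deg_lt d (f i)) \<Longrightarrow> deg_lt d (\<Sum>i\<in>A. f i)"
  by (induction A rule: infinite_finite_induct) (auto simp: deg_lt_add)
lemma deg_lt_diff: "deg_lt d f \<Longrightarrow> deg_lt d g \<Longrightarrow> deg_lt d (f - g)"
  using deg_lt_add[of d f "- g"] deg_lt_uminus[of d g] by simp
lemma deg_lt_mono: "deg_lt d (TW.mono w a) \<longleftrightarrow> (\<forall>u\<in>Poly_Mapping.keys a. word_deg u < d)"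
  by (auto simp: deg_lt_def TW.mono_def)

text \<open>The preimage in the tensor crossed product of the filtration step d - 1 of H. Two
  elements of degree at most d have the same class in degree d of the graded ring exactly when they
  are congruent modulo \<open>J d\<close>.\<close>

definition J :: "nat \<Rightarrow> ('n cmat \<Rightarrow> 'n tens) set" where
  "J d = {f \<in> carrier TW.R. \<exists>g\<in>carrier TW.R. deg_lt d g \<and> f - g \<in> I}"

lemma J_add: "f \<in> J d \<Longrightarrow> g \<in> J d \<Longrightarrow> f + g \<in> J d"
proof -
  assume "f \<in> J d" "g \<in> J d"
  then obtain f' g' where "f' \<in> carrier TW.R" "g' \<in> carrier TW.R" "deg_lt d f'" "deg_lt d g'" "f - f' \<in> I" "g - g' \<in> I"
      "f \<in> carrier TW.R" "g \<in> carrier TW.R"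
    by (auto simp: J_def)
  moreover from this have "f + g - (f' + g') \<in> I" 
    using I_add[of "f - f'" "g - g'"] by (simp only: add_diff_add)
  ultimately show ?thesis unfolding J_def by (auto intro!: bexI[of _ "f' + g'"] deg_lt_add simp: I_add)
qed
lemma J_zero [simp]: "0 \<in> J d" by (auto simp: J_def intro!: bexI[of _ 0])
lemma J_sum: "(\<And>i. i \<in> A \<Longrightarrow> f i \<in> J d) \<Longrightarrow> (\<Sum>i\<in>A. f i) \<in> J d"
  by (induction A rule: infinite_finite_induct) (auto simp: J_add)
lemma J_uminus: "f \<in> J d \<Longrightarrow> - f \<in> J d"
proof -
  assume "f \<in> J d"
  then obtain f' where f': "f' \<in> carrier TW.R" "deg_lt d f'" "f - f' \<in> I" "f \<in> carrier TW.R"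
    by (auto simp: J_def)
  have "- f - (- f') = - (f - f')" by simp
  then have "- f - (- f') \<in> I" using I_uminus f' by metis
  then show ?thesis unfolding J_def using f' by (auto intro!: bexI[of _ "- f'"] deg_lt_uminus)
qed

lemma J_trans: "f - g \<in> J d \<Longrightarrow> g - h \<in> J d \<Longrightarrow> f - h \<in> J d"
  using J_add[of "f - g" d "g - h"] by simp
lemma J_sym: "f - g \<in> J d \<Longrightarrow> g - f \<in> J d"
  by (metis J_uminus minus_diff_eq)

section \<open>Reordering letters modulo lower degree\<close>

lemma deg_lt_word_mult: "deg_lt d g \<Longrightarrow> deg_lt (Suc d) (TW.mono (mat 1) (word [k] 1) \<otimes>\<^bsub>TW.R\<^esub> g)"
  unfolding deg_lt_def
proof (intro allI ballI)
  fix w u assume g: "\<forall>w. \<forall>u\<in>Poly_Mapping.keys (g w). word_deg u < d"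
    and "u \<in> Poly_Mapping.keys ((TW.mono (mat 1) (word [k] 1) \<otimes>\<^bsub>TW.R\<^esub> g) w)"
  then have "u \<in> Poly_Mapping.keys (word [k] 1 * g w)"
    by (simp add: TW.mono_mult_left tens_map_id W_act_one)
  then show "word_deg u < Suc d" using g
    by (elim keys_mult_word_deg) (auto simp: word_deg_def)
qed

lemma J_word_mult: "f \<in> J d \<Longrightarrow> TW.mono (mat 1) (word [k] 1) \<otimes>\<^bsub>TW.R\<^esub> f \<in> J (Suc d)"
proof -
  assume "f \<in> J d"
  then obtain g where g: "g \<in> carrier TW.R" "deg_lt d g" "f - g \<in> I" "f \<in> carrier TW.R" by (auto simp: J_def)
  have "TW.mono (mat 1) (word [k] 1) \<otimes>\<^bsub>TW.R\<^esub> (f - g) \<in> I" by (rule I_left) (use g in auto)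
  then show ?thesis unfolding J_def using g
    by (auto intro!: bexI[of _ "TW.mono (mat 1) (word [k] 1) \<otimes>\<^bsub>TW.R\<^esub> g"] deg_lt_word_mult
        simp: TW.mult_R_diff_right)
qed

lemma word_mult_mono: "w \<in> W \<Longrightarrow>
    TW.mono (mat 1) (word [k] 1) \<otimes>\<^bsub>TW.R\<^esub> TW.mono w (word ks a) = TW.mono w (word (k # ks) a)"
  by (simp add: TW.mono_mult_mono tens_map_id W_act_one word_mult)

text \<open>Multiplying a relation on the right by the remaining letters exchanges the first two.
  The correction terms carry a group element in place of these two letters, so their degree is at
  most \<open>length ks\<close>.\<close>

lemma J_swap:
  assumes w: "w \<in> W"
  shows "TW.mono w (word (k # l # ks) a) - TW.mono w (word (l # k # ks) a) \<in> J (Suc (Suc (length ks)))"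
proof -
  let ?X = "Rel (basis k) (basis l) \<otimes>\<^bsub>TW.R\<^esub> TW.mono w (word ks a)"
  let ?g = "\<Sum>s\<in>S. TW.mono (s ** w) (const (kappa_coeff s * kappa s (basis k) (basis l)) * tens_map (W_act s) (word ks a))"
  have X: "?X = TW.mono w (word (k # l # ks) a) - TW.mono w (word (l # k # ks) a) - ?g"
    unfolding Rel_def tens_vec_basis using w
    by (simp add: TW.mult_R_diff_left TW.mult_R_sum_left TW.mono_mult_mono tens_map_id W_act_one
        left_diff_distrib word_mult TW.mono_diff)
  have "?X \<in> I" using w by (intro I_right Rel_I) simp
  moreover have "deg_lt (Suc (Suc (length ks))) ?g"
  proof (rule deg_lt_sum)
    fix s
    have "word_deg u < Suc (Suc (length ks))" if "u \<in> Poly_Mapping.keys (tens_map (W_act s) (word ks a))" for u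
      using keys_tens_map[OF that] by (auto simp: word_deg_def split: if_splits)
    then show "deg_lt (Suc (Suc (length ks)))
       (TW.mono (s ** w) (const (kappa_coeff s * kappa s (basis k) (basis l)) * tens_map (W_act s) (word ks a)))"
      unfolding deg_lt_mono using keys_const_mult by blast
  qed
  ultimately show ?thesis unfolding J_def X using w
    by (auto intro!: bexI[of _ ?g])
qed

lemma J_move:
  assumes w: "w \<in> W"
  shows "TW.mono w (word (js @ k # ks) a) - TW.mono w (word (k # js @ ks) a) \<in> J (Suc (length js + length ks))"
proof (induction js)
  case (Cons l js)
  have "TW.mono (mat 1) (word [l] 1) \<otimes>\<^bsub>TW.R\<^esub>
      (TW.mono w (word (js @ k # ks) a) - TW.mono w (word (k # js @ ks) a)) \<in> J (Suc (Suc (length js + length ks)))"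
    by (rule J_word_mult[OF Cons.IH])
  then have "TW.mono w (word (l # js @ k # ks) a) - TW.mono w (word (l # k # js @ ks) a) \<in> J (Suc (Suc (length js + length ks)))"
    using w by (simp add: TW.mult_R_diff_right word_mult_mono)
  from J_trans[OF this] J_swap[OF w, of l k "js @ ks" a]
  have "TW.mono w (word (l # js @ k # ks) a) - TW.mono w (word (k # l # js @ ks) a) \<in> J (Suc (Suc (length js + length ks)))"
    by (simp only: length_append)
  then show ?case by (simp only: append_Cons list.size add_Suc add_Suc_right add_0_right)
qed (simp only: append_Nil diff_self J_zero)

text \<open>A sorting argument: the first letter of \<open>ks\<close> is brought to the front of
  \<open>js\<close> by adjacent exchanges, and the rest follows by induction, since multiplication
  by a letter on the left raises the degree by one.\<close>

lemma J_mset: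
  assumes w: "w \<in> W" and "mset ks = mset js"
  shows "TW.mono w (word ks a) - TW.mono w (word js a) \<in> J (length ks)"
  using assms(2)
proof (induction ks arbitrary: js)
  case (Cons k ks)
  then have "k \<in> set js" by (metis list.set_intros(1) mset_eq_setD)
  then obtain js1 js2 where js: "js = js1 @ k # js2" by (meson split_list)
  then have "mset ks = mset (js1 @ js2)" using Cons.prems by simp
  then have "TW.mono w (word ks a) - TW.mono w (word (js1 @ js2) a) \<in> J (length ks)" by (rule Cons.IH)
  from J_word_mult[OF this, of k]
  have 1: "TW.mono w (word (k # ks) a) - TW.mono w (word (k # js1 @ js2) a) \<in> J (length (k # ks))"
    using w by (simp add: TW.mult_R_diff_right word_mult_mono)
  have "length ks = length js1 + length js2"
    using \<open>mset ks = mset (js1 @ js2)\<close> by (metis length_append size_mset)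
  then have "TW.mono w (word js a) - TW.mono w (word (k # js1 @ js2) a) \<in> J (length (k # ks))"
    using J_move[OF w, of js1 k js2 a] by (simp add: js)
  from J_trans[OF 1 J_sym[OF this]] show ?case .
qed simp

lemma J_symmetrize_word:
  assumes w: "w \<in> W"
  shows "TW.mono w (word ks a - sigma (symmetrize (word ks a))) \<in> J (length ks)"
proof -
  let ?N = "of_nat (card (words_of (mon ks))) :: complex"
  have N: "?N \<noteq> 0" using card_words_of[of "mon ks"] by simp
  \<comment> \<open>The word is written as an average of copies of itself, to be compared summand by
    summand with the words in its symmetrization.\<close>
  have "(\<Sum>js\<in>words_of (mon ks). word ks (a / ?N)) = word ks a"
  proof (rule poly_mapping_eqI)
    fix u
    show "Poly_Mapping.lookup (\<Sum>js\<in>words_of (mon ks). word ks (a / ?N)) u = Poly_Mapping.lookup (word ks a) u"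
      unfolding lookup_sum lookup_single using N by (cases "FM ks = u") simp_all
  qed
  then have "TW.mono w (word ks a - sigma (symmetrize (word ks a))) =
    (\<Sum>js\<in>words_of (mon ks). TW.mono w (word ks (a / ?N)) - TW.mono w (word js (a / ?N)))"
    unfolding sym_eq_sum_words TW.mono_diff[symmetric] TW.mono_sum[symmetric] sum_subtractf by simp
  also have "\<dots> \<in> J (length ks)"
    by (rule J_sum, rule J_mset[OF w]) (simp add: words_of_def mon_eq_iff)
  finally show ?thesis .
qed

lemma J_symmetrize:
  assumes f: "f \<in> carrier TW.R" and d: "\<And>w u. u \<in> Poly_Mapping.keys (f w) \<Longrightarrow> word_deg u = d"
  shows "f - (\<lambda>w. sigma (symmetrize (f w))) \<in> J d"
proof -
  have a: "TW.mono w (a - sigma (symmetrize a)) \<in> J d"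
    if "w \<in> W" "\<And>u. u \<in> Poly_Mapping.keys a \<Longrightarrow> word_deg u = d" for w a
  proof -
    let ?s = "\<lambda>u. Poly_Mapping.single u (Poly_Mapping.lookup a u)"
    have "a = (\<Sum>u\<in>Poly_Mapping.keys a. ?s u)"
      by (rule poly_mapping_eqI)
        (auto simp: lookup_sum lookup_single when_def in_keys_iff if_distrib cong: if_cong)
    then have "TW.mono w (a - sigma (symmetrize a)) =
        TW.mono w ((\<Sum>u\<in>Poly_Mapping.keys a. ?s u) - sigma (symmetrize (\<Sum>u\<in>Poly_Mapping.keys a. ?s u)))"
      by simp
    also have "\<dots> = (\<Sum>u\<in>Poly_Mapping.keys a. TW.mono w (?s u - sigma (symmetrize (?s u))))"
      by (simp add: symmetrize.ext_sum sigma.ext_sum sum_subtractf TW.mono_sum TW.mono_diff)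
    also have "\<dots> \<in> J d"
    proof (rule J_sum)
      fix u assume u: "u \<in> Poly_Mapping.keys a"
      obtain ks where ks: "u = FM ks" by (cases u)
      have "length ks = d" using that(2)[OF u] by (simp add: ks word_deg_def)
      then show "TW.mono w (?s u - sigma (symmetrize (?s u))) \<in> J d"
        using J_symmetrize_word[OF that(1), of ks] by (auto simp: ks)
    qed
    finally show ?thesis .
  qed
  have "f - (\<lambda>w. sigma (symmetrize (f w))) = (\<Sum>w\<in>W. TW.mono w (f w - sigma (symmetrize (f w))))"
    by (subst TW.expand_mono) (use f in \<open>auto simp: TW.carrier_R symmetrize.ext_0 sigma.ext_0\<close>)
  then show ?thesis using a d by (auto intro: J_sum)
qed

abbreviation sig :: "('n cmat \<Rightarrow> 'n sym) \<Rightarrow> 'n cmat \<Rightarrow> 'n tens" where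
  "sig p \<equiv> (\<lambda>w. sigma (p w))"

lemma sig_carrier [simp]: "p \<in> carrier PW.R \<Longrightarrow> sig p \<in> carrier TW.R"
  by (simp add: TW.carrier_R PW.carrier_R sigma.ext_0)

text \<open>The spanning half of the PBW theorem: the top degree part is replaced by its
  symmetrization modulo lower degree, and the remainder is treated by induction. The middle clause
  records that the top component survives. For \<open>n = 0\<close> the truncated
  \<open>n - 1\<close> does no harm because \<open>f\<close> is then 0.\<close>

lemma normal_form:
  assumes "f \<in> carrier TW.R" "deg_lt n f"
  shows "\<exists>p\<in>carrier PW.R. (\<forall>w. \<forall>m\<in>Poly_Mapping.keys (p w). mon_deg m < n) \<and>
     (\<forall>w. hom_part (n - 1) (p w) = hom_part (n - 1) (symmetrize (f w))) \<and> f - sig p \<in> I"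
  using assms
proof (induction n arbitrary: f)
  case 0
  then have "f w = 0" for w by (simp add: deg_lt_def)
  then have "f = 0" by (simp add: fun_eq_iff)
  then show ?case
    by (intro bexI[of _ 0]) (auto simp: sigma.ext_0 symmetrize.ext_0 zero_fun_def[symmetric])
next
  case (Suc n)
  define h where "h = (\<lambda>w. tens_part n (f w))"
  have h: "h \<in> carrier TW.R" using Suc.prems(1) by (simp add: h_def TW.carrier_R)
  have hd: "word_deg u = n" if "u \<in> Poly_Mapping.keys (h w)" for u w
    using that by (auto simp: h_def in_keys_iff lookup_tens_part split: if_splits)
  have "h - (\<lambda>w. sigma (symmetrize (h w))) \<in> J n" by (rule J_symmetrize[OF h hd])
  then obtain g where g: "g \<in> carrier TW.R" "deg_lt n g" "h - (\<lambda>w. sigma (symmetrize (h w))) - g \<in> I"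
    by (auto simp: J_def)
  have "deg_lt n (f - h)"
    unfolding deg_lt_def
  proof (intro allI ballI)
    fix w u assume "u \<in> Poly_Mapping.keys ((f - h) w)"
    then have "word_deg u \<noteq> n" "u \<in> Poly_Mapping.keys (f w)"
      by (auto simp: h_def in_keys_iff lookup_minus lookup_tens_part split: if_splits)
    then show "word_deg u < n" using Suc.prems(2) unfolding deg_lt_def by (metis less_SucE)
  qed
  \<comment> \<open>The remainder consists of the lower degree part of \<open>f\<close> and of the
    correction \<open>g\<close> due to reordering.\<close>
  then have "deg_lt n (f - h + g)" using g by (intro deg_lt_add)
  moreover have "f - h + g \<in> carrier TW.R" using Suc.prems g h by simp
  moreover note Suc.IH[of "f - h + g"]
  ultimately obtain p where p: "p \<in> carrier PW.R" "\<And>w m. m \<in> Poly_Mapping.keys (p w) \<Longrightarrow> mon_deg m < n"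
      "f - h + g - sig p \<in> I"
    by blast
  define q where "q = (\<lambda>w. symmetrize (h w)) + p"
  have q: "q \<in> carrier PW.R" using p(1) h by (auto simp: q_def PW.carrier_R TW.carrier_R symmetrize.ext_0)
  have sh: "symmetrize (h w) = hom_part n (symmetrize (f w))" for w
    by (simp add: h_def symmetrize_tens_part)
  have "f - sig q = (f - h + g - sig p) + (h - (\<lambda>w. sigma (symmetrize (h w))) - g)"
    by (simp add: q_def fun_eq_iff sigma.ext_add)
  then have "f - sig q \<in> I" using I_add[OF p(3) g(3)] by (simp only:)
  moreover have "mon_deg m < Suc n" if "m \<in> Poly_Mapping.keys (q w)" for m w
    using that p(2)[of m w] keys_add[of "symmetrize (h w)" "p w"]
    by (auto simp: q_def sh in_keys_iff lookup_hom_part lookup_add split: if_splits)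
  moreover have "hom_part n (q w) = hom_part n (symmetrize (f w))" for w
  proof -
    have "hom_part n (p w) = 0"
      by (rule poly_mapping_eqI) (use p(2) in \<open>auto simp: lookup_hom_part in_keys_iff\<close>)
    then show ?thesis by (simp add: q_def hom_part_add sh hom_part_hom_part)
  qed
  ultimately show ?case using q unfolding diff_Suc_1 by blast
qed

end

declare split_paired_All [simp del] split_paired_Ex [simp del]

section \<open>Polynomial functions and generic points\<close>

text \<open>Points are pairs \<open>(\<eta>, \<xi>)\<close> with \<open>\<eta>\<close> in \<open>\<hh>*\<close> and \<open>\<xi>\<close> in \<open>\<hh>\<close>, the opposite order to that of vectors.\<close>

definition veval :: "('n::finite) hhd \<Rightarrow> 'n hhd \<Rightarrow> complex" where
  "veval v \<pi> = pairing (fst \<pi>) (fst v) + pairing (snd v) (snd \<pi>)"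

lemma veval_add: "veval (u + v) \<pi> = veval u \<pi> + veval v \<pi>"
  and veval_scaleV: "veval (scaleV a v) \<pi> = a * veval v \<pi>"
  and veval_scaleV_right: "veval v (scaleV a \<pi>) = a * veval v \<pi>"
  and veval_0 [simp]: "veval 0 \<pi> = 0"
  by (auto simp: veval_def scaleV_def pairing_add_left pairing_add_right pairing_scale_left pairing_scale_right
      algebra_simps)

lemma veval_sum: "veval (\<Sum>i\<in>A. f i) \<pi> = (\<Sum>i\<in>A. veval (f i) \<pi>)"
  by (induction A rule: infinite_finite_induct) (auto simp: veval_add)

lemma veval_diff: "veval (u - v) \<pi> = veval u \<pi> - veval v \<pi>"
  using veval_add[of "u - v" v \<pi>] by simp

lemma veval_basis: "veval (basis k) \<pi> = (case k of Inl i \<Rightarrow> fst \<pi> $ i | Inr i \<Rightarrow> snd \<pi> $ i)"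
  by (cases k) (auto simp: veval_def basis_def pairing_def axis_def if_distrib if_distribR cong: if_cong)

lemma veval_expand: "veval v \<pi> = (\<Sum>k\<in>UNIV. coord v k * veval (basis k) \<pi>)"
  by (subst basis_expansion_hhd) (simp add: veval_sum veval_scaleV)

lemma ex_point: "\<exists>\<pi>. \<forall>k. veval (basis k) \<pi> = f k"
  by (rule exI[of _ "(\<chi> i. f (Inl i), \<chi> i. f (Inr i))"]) (auto simp: veval_basis split: sum.splits)

definition peval :: "('n::finite) sym \<Rightarrow> 'n hhd \<Rightarrow> complex" where
  "peval p \<pi> = (\<Sum>m\<in>Poly_Mapping.keys p.
     Poly_Mapping.lookup p m * (\<Prod>k\<in>UNIV. veval (basis k) \<pi> ^ Poly_Mapping.lookup m k))"

interpretation peval: linear_extension "\<lambda>a m. a * (\<Prod>k\<in>UNIV. veval (basis k) \<pi> ^ Poly_Mapping.lookup m k)" "\<lambda>p. peval p \<pi>"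
  by unfold_locales (auto simp: peval_def distrib_right)

lemma peval_mult: "peval (p * q) \<pi> = peval p \<pi> * peval q \<pi>"
  by (rule mult_by_singles[where F = "\<lambda>p. peval p \<pi>"])
    (auto simp: peval.ext_add peval.ext_0 mult_single peval.ext_single lookup_add power_add prod.distrib)

lemma peval_const: "peval (const a) \<pi> = a"
  by (simp add: const_def peval.ext_single)
lemma peval_1 [simp]: "peval 1 \<pi> = 1" using peval_const[of 1] by simp

lemma peval_sym_vec: "peval (sym_vec v) \<pi> = veval v \<pi>"
proof -
  have "(\<Prod>j\<in>UNIV. veval (basis j) \<pi> ^ Poly_Mapping.lookup (Poly_Mapping.single k 1) j) = veval (basis k) \<pi>" for k :: "'a + 'a"
  proof -
    have "veval (basis j) \<pi> ^ Poly_Mapping.lookup (Poly_Mapping.single k 1) j = (if j = k then veval (basis k) \<pi> else 1)" for j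
      by (auto simp: lookup_single when_def)
    then show ?thesis by simp
  qed
  then show ?thesis
    by (subst veval_expand) (simp add: sym_vec_def peval.ext_sum peval.ext_single)
qed

lemma peval_power: "peval (p ^ n) \<pi> = peval p \<pi> ^ n"
  by (induction n) (auto simp: peval_mult)

lemma peval_prod: "peval (\<Prod>i\<in>A. f i) \<pi> = (\<Prod>i\<in>A. peval (f i) \<pi>)"
  by (induction A rule: infinite_finite_induct) (auto simp: peval_mult)

lemma peval_sym_map:
  assumes "\<And>k. veval (g (basis k)) \<pi> = veval (basis k) \<pi>'"
  shows "peval (sym_map g p) \<pi> = peval p \<pi>'"
  unfolding sym_map_def peval_def[of _ \<pi>']
  by (simp add: peval.ext_sum peval_mult peval_const peval_prod peval_power peval_sym_vec assms)

lemma peval_scaleV_homog: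
  assumes "homog d p" shows "peval p (scaleV a \<pi>) = a ^ d * peval p \<pi>"
proof -
  have "Poly_Mapping.lookup p m * (\<Prod>k\<in>UNIV. veval (basis k) (scaleV a \<pi>) ^ Poly_Mapping.lookup m k) =
      a ^ d * (Poly_Mapping.lookup p m * (\<Prod>k\<in>UNIV. veval (basis k) \<pi> ^ Poly_Mapping.lookup m k))"
    if "m \<in> Poly_Mapping.keys p" for m
  proof -
    have "d = (\<Sum>k\<in>UNIV. Poly_Mapping.lookup m k)" using assms that by (simp add: homog_iff mon_deg_def)
    then have "(\<Prod>k\<in>UNIV. a ^ Poly_Mapping.lookup m k) = a ^ d" by (simp add: power_sum)
    then show ?thesis by (simp add: veval_scaleV_right power_mult_distrib prod.distrib)
  qed
  then show ?thesis unfolding peval_def sum_distrib_left by (rule sum.cong[OF refl])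
qed

lemma base_expansion_less:
  fixes a :: "nat \<Rightarrow> nat"
  assumes "\<And>i. i < N \<Longrightarrow> a i < B" shows "(\<Sum>i<N. a i * B ^ i) < B ^ N"
  using assms
proof (induction N)
  case (Suc N)
  have "(\<Sum>i<N. a i * B ^ i) < B ^ N" using Suc by simp
  moreover have "a N * B ^ N + B ^ N \<le> B * B ^ N"
    using Suc.prems[of N] mult_le_mono1[of "Suc (a N)" B "B ^ N"] by simp
  ultimately show ?case by simp
qed simp

lemma base_expansion_inj:
  fixes a b :: "nat \<Rightarrow> nat"
  assumes "\<And>i. i < N \<Longrightarrow> a i < B" "\<And>i. i < N \<Longrightarrow> b i < B"
    and "(\<Sum>i<N. a i * B ^ i) = (\<Sum>i<N. b i * B ^ i)" "i < N"
  shows "a i = b i"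
  using assms
proof (induction N)
  case (Suc N)
  let ?r = "\<Sum>i<N. a i * B ^ i" and ?r' = "\<Sum>i<N. b i * B ^ i"
  have r: "?r < B ^ N" "?r' < B ^ N" using Suc.prems by (auto intro!: base_expansion_less)
  have eq: "?r + a N * B ^ N = ?r' + b N * B ^ N" using Suc.prems(3) by simp
  have nz: "B ^ N \<noteq> 0" using r by linarith
  have "a N = (?r + a N * B ^ N) div B ^ N" "b N = (?r' + b N * B ^ N) div B ^ N"
    unfolding div_mult_self1[OF nz] using r by simp_all
  then have "a N = b N" using eq by simp
  then show ?case using Suc eq by (cases "i = N") auto
qed simp

text \<open>The Kronecker substitution \<open>x\<^sub>k = t ^ (B ^ idx k)\<close> separates monomials with exponents below \<open>B\<close>.\<close>

lemma generic_point:
  fixes F :: "('n::finite) sym set"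
  assumes "finite F" "0 \<notin> F" shows "\<exists>\<pi>. \<forall>p\<in>F. peval p \<pi> \<noteq> 0"
proof -
  obtain idx :: "'n + 'n \<Rightarrow> nat" and N where idx: "bij_betw idx UNIV {..<N}"
    using ex_bij_betw_finite_nat[of "UNIV :: ('n + 'n) set"] by (auto simp: atLeast0LessThan)
  define E where "E = (\<lambda>(p, m, k). Poly_Mapping.lookup m k) `
     (SIGMA p:F. Poly_Mapping.keys p \<times> (UNIV :: ('n + 'n) set))"
  have "finite E" unfolding E_def using assms by auto
  then obtain B where "\<forall>e\<in>E. e < B" using finite_nat_set_iff_bounded by blast
  then have B: "Poly_Mapping.lookup m k < B" if "p \<in> F" "m \<in> Poly_Mapping.keys p" for p m k
    using that by (force simp: E_def)
  define wt where "wt m = (\<Sum>k\<in>UNIV. Poly_Mapping.lookup m k * B ^ idx k)" for m :: "'n + 'n \<Rightarrow>\<^sub>0 nat"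
  have inj: "m = m'" if "p \<in> F" "m \<in> Poly_Mapping.keys p" "m' \<in> Poly_Mapping.keys p" "wt m = wt m'" for p m m'
  proof (rule poly_mapping_eqI)
    fix k
    let ?j = "inv_into UNIV idx"
    have wt: "wt m = (\<Sum>i<N. Poly_Mapping.lookup m (?j i) * B ^ i)" for m
      unfolding wt_def using idx
      by (subst sum.reindex_bij_betw[OF bij_betw_inv_into[OF idx], symmetric])
        (auto intro!: sum.cong simp: bij_betw_inv_into_right)
    have "idx k < N" using idx by (auto simp: bij_betw_def)
    from base_expansion_inj[OF _ _ that(4)[unfolded wt] this]
    have "Poly_Mapping.lookup m (?j (idx k)) = Poly_Mapping.lookup m' (?j (idx k))" using B that by blast
    then show "Poly_Mapping.lookup m k = Poly_Mapping.lookup m' k"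
      using idx by (simp add: bij_betw_inv_into_left)
  qed
  define P where "P p = (\<Sum>m\<in>Poly_Mapping.keys p. monom (Poly_Mapping.lookup p m) (wt m))" for p :: "'n sym"
  have nz: "P p \<noteq> 0" if p: "p \<in> F" for p
  proof -
    have "p \<noteq> 0" using p assms(2) by metis
    then obtain m0 where m0: "m0 \<in> Poly_Mapping.keys p"
      by (metis poly_mapping_eqI in_keys_iff lookup_zero)
    have "coeff (P p) (wt m0) = (\<Sum>m\<in>Poly_Mapping.keys p. if m = m0 then Poly_Mapping.lookup p m else 0)"
      unfolding P_def coeff_sum using inj[OF p _ m0] by (intro sum.cong) auto
    also have "\<dots> = Poly_Mapping.lookup p m0" using m0 by simp
    finally show ?thesis using m0 by (auto simp: in_keys_iff)
  qed
  have "finite (\<Union>p\<in>F. {t. poly (P p) t = 0})"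
    using assms nz by (intro finite_UN_I) (auto intro: poly_roots_finite)
  then obtain t where t: "t \<notin> (\<Union>p\<in>F. {t. poly (P p) t = 0})"
    using ex_new_if_finite[OF infinite_UNIV_char_0] by blast
  obtain \<pi> where \<pi>: "\<And>k. veval (basis k) \<pi> = t ^ (B ^ idx k)" using ex_point[of "\<lambda>k. t ^ (B ^ idx k)"] by blast
  have "peval p \<pi> = poly (P p) t" for p
    by (auto simp: peval_def P_def poly_sum poly_monom wt_def \<pi> power_sum power_mult[symmetric] mult.commute
        intro!: sum.cong prod.cong)
  then show ?thesis using t by (intro exI[of _ \<pi>]) auto
qed

section \<open>Divisibility by linear forms\<close>

lemma sym_no_zero_divisors: "p * q = 0 \<Longrightarrow> p = 0 \<or> q = (0 :: ('n::finite) sym)"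
proof (rule ccontr)
  assume pq: "p * q = 0" "\<not> (p = 0 \<or> q = 0)"
  then obtain \<pi> where "peval p \<pi> \<noteq> 0" "peval q \<pi> \<noteq> 0" using generic_point[of "{p, q}"] by auto
  then show False using peval_mult[of p q \<pi>] pq(1) by (simp add: peval.ext_0)
qed

lemma sym_mult_cancel:
  assumes "(p :: ('n::finite) sym) \<noteq> 0" "p * q = p * r" shows "q = r"
proof -
  have "p * (q - r) = 0" using assms by (simp add: right_diff_distrib)
  then show ?thesis using sym_no_zero_divisors assms(1) by fastforce
qed

lemma sym_vec_nonzero: "v \<noteq> 0 \<Longrightarrow> sym_vec v \<noteq> 0"
proof -
  assume "v \<noteq> 0"
  then obtain k where k: "coord v k \<noteq> 0" using coord_eqI[of v 0] by auto
  obtain \<pi> where \<pi>: "\<And>j. veval (basis j) \<pi> = (if j = k then 1 else 0)" using ex_point[of "\<lambda>j. if j = k then 1 else 0"] by blast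
  then have "peval (sym_vec v) \<pi> = coord v k"
    unfolding peval_sym_vec by (subst veval_expand) (simp add: \<pi> if_distrib cong: if_cong del: split_paired_All)
  then show ?thesis using k by (auto simp: peval.ext_0)
qed

text \<open>If \<open>coord v k\<close> is nonzero, this is the projection along \<open>v\<close>
  onto the vectors with vanishing k-th coordinate. Substituting it into polynomials solves the
  equation v = 0 for the k-th variable, that is, it passes to the quotient by the linear form of
  \<open>v\<close>.\<close>

definition elim_vec :: "('n::finite) hhd \<Rightarrow> 'n + 'n \<Rightarrow> 'n hhd \<Rightarrow> 'n hhd" where
  "elim_vec v k u = u - scaleV (coord u k / coord v k) v"

lemma scaleV_one [simp]: "scaleV 1 v = v" and scaleV_zero [simp]: "scaleV 0 v = 0"
  by (auto intro!: coord_eqI simp: distrib_right distrib_left)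

lemma coord_diff [simp]: "coord (u - v) k = coord u k - coord v k"
  using coord_add[of "u - v" v k] by simp

lemma linV_elim_vec: "linV (elim_vec v k)"
  unfolding linV_def elim_vec_def
  by (auto intro!: coord_eqI simp: algebra_simps add_divide_distrib simp del: split_paired_All)

text \<open>On generators the difference is a multiple of \<open>sym_vec v\<close>, and congruences
  are preserved by products and sums. If \<open>coord v k\<close> is 0, division by zero makes
  \<open>elim_vec v k\<close> the identity and the difference vanishes.\<close>

lemma dvd_diff_elim: "sym_vec v dvd p - sym_map (elim_vec v k) p"
proof -
  let ?g = "elim_vec v k"
  have mult: "sym_vec v dvd p * q - sym_map ?g (p * q)"
    if "sym_vec v dvd p - sym_map ?g p" "sym_vec v dvd q - sym_map ?g q" for p q
  proof -
    have "p * q - sym_map ?g (p * q) = (p - sym_map ?g p) * q + sym_map ?g p * (q - sym_map ?g q)"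
      by (simp add: sym_map_mult algebra_simps)
    then show ?thesis using that by (metis dvd_add dvd_mult dvd_mult2)
  qed
  have vec: "sym_vec v dvd sym_vec u - sym_map ?g (sym_vec u)" for u
  proof -
    have "sym_vec u = sym_vec (?g u) + const (coord u k / coord v k) * sym_vec v"
      by (simp add: sym_vec_add[symmetric] sym_vec_scaleV[symmetric] elim_vec_def)
    then have "sym_vec u - sym_map ?g (sym_vec u) = const (coord u k / coord v k) * sym_vec v"
      unfolding sym_map_vec[OF linV_elim_vec] by simp
    then show ?thesis by simp
  qed
  have "sym_vec v dvd symmetrize a - sym_map ?g (symmetrize a)" for a
  proof (induction a rule: tens_induct)
    case (word ks b)
    have "sym_vec v dvd prod_list (map (\<lambda>k. sym_vec (basis k)) ks) - sym_map ?g (prod_list (map (\<lambda>k. sym_vec (basis k)) ks))"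
      by (induction ks) (auto simp: sym_map_1 intro: mult vec)
    then have "sym_vec v dvd const b * prod_list (map (\<lambda>k. sym_vec (basis k)) ks) -
       sym_map ?g (const b * prod_list (map (\<lambda>k. sym_vec (basis k)) ks))"
      by (intro mult) (auto simp: sym_map_const)
    then show ?case
      by (simp add: word_eq_prod symmetrize_mult symmetrize_const symmetrize_prod_list symmetrize_tens_vec comp_def)
  next
    case (add p q)
    have "symmetrize (p + q) - sym_map ?g (symmetrize (p + q)) =
        (symmetrize p - sym_map ?g (symmetrize p)) + (symmetrize q - sym_map ?g (symmetrize q))"
      by (simp add: symmetrize.ext_add sym_map.ext_add)
    then show ?case using add by (metis dvd_add)
  qed (simp add: symmetrize.ext_0 sym_map.ext_0)
  then show ?thesis by (metis symmetrize_surj)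
qed

text \<open>The linear form of \<open>v\<close> thus generates the kernel of a ring homomorphism
  into a domain, which makes it prime.\<close>

lemma sym_vec_dvd_iff:
  assumes "coord v k \<noteq> 0" shows "sym_vec v dvd p \<longleftrightarrow> sym_map (elim_vec v k) p = 0"
proof
  assume "sym_map (elim_vec v k) p = 0"
  then show "sym_vec v dvd p" using dvd_diff_elim[of v p k] by simp
next
  assume "sym_vec v dvd p"
  then obtain q where "p = sym_vec v * q" by blast
  moreover have "elim_vec v k v = 0" using assms by (simp add: elim_vec_def)
  ultimately show "sym_map (elim_vec v k) p = 0"
    by (simp add: sym_map_mult sym_map_vec[OF linV_elim_vec]) (simp add: sym_vec_def)
qed

text \<open>The linear form of \<open>(y, 0)\<close> is prime and does not divide that of
  \<open>(0, x)\<close>: a coordinate at which \<open>(y, 0)\<close> is nonzero belongs to the half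
  \<open>h\<close>, so eliminating it leaves \<open>(0, x)\<close> unchanged.\<close>

lemma coprime_vec:
  assumes "y \<noteq> 0" "x \<noteq> 0" "sym_vec (y, 0) dvd sym_vec (0, x) * p" shows "sym_vec (y, 0) dvd p"
proof -
  obtain k where k: "coord (y, 0 :: complex ^ 'a) k \<noteq> 0" using coord_eqI[of "(y, 0)" 0] assms(1) by (metis coord_0 fst_conv fst_zero)
  then have "coord (0, x) k = 0" by (auto simp: coord_def split: sum.splits)
  then have "elim_vec (y, 0) k (0, x) = (0, x)" by (simp add: elim_vec_def)
  then have "sym_vec (0, x) * sym_map (elim_vec (y, 0) k) p = 0"
    using assms(3) unfolding sym_vec_dvd_iff[OF k] by (simp add: sym_map_mult sym_map_vec[OF linV_elim_vec])
  moreover have "sym_vec (0, x) \<noteq> 0" using assms(2) by (intro sym_vec_nonzero) (auto simp: zero_prod_def)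
  ultimately show ?thesis unfolding sym_vec_dvd_iff[OF k] using sym_no_zero_divisors by blast
qed

lemma coprime_vec_prod:
  assumes "finite B" "y \<noteq> 0" "\<And>j. j \<in> B \<Longrightarrow> x j \<noteq> 0" "sym_vec (y, 0) dvd (\<Prod>j\<in>B. sym_vec (0, x j)) * p"
  shows "sym_vec (y, 0) dvd p"
  using assms
proof (induction B arbitrary: p rule: finite_induct)
  case (insert j B)
  have "sym_vec (y, 0) dvd sym_vec (0, x j) * ((\<Prod>j\<in>B. sym_vec (0, x j)) * p)"
    using insert.prems(3) insert.hyps by (simp add: mult.assoc)
  then have "sym_vec (y, 0) dvd (\<Prod>j\<in>B. sym_vec (0, x j)) * p"
    by (rule coprime_vec[OF insert.prems(1) insert.prems(2)[OF insertI1]])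
  then show ?case using insert.IH[OF insert.prems(1)] insert.prems(2) by blast
qed simp

text \<open>The prime factors indexed by \<open>A\<close> are split off from \<open>p\<close> one at
  a time; each is then cancelled on both sides of the equation, the polynomial ring being a
  domain.\<close>

lemma coprime_prod_prod:
  assumes "finite A" "finite B" "\<And>i. i \<in> A \<Longrightarrow> y i \<noteq> 0" "\<And>j. j \<in> B \<Longrightarrow> x j \<noteq> 0"
    and "(\<Prod>j\<in>B. sym_vec (0, x j)) * p = (\<Prod>i\<in>A. sym_vec (y i, 0)) * q"
  shows "\<exists>r. p = (\<Prod>i\<in>A. sym_vec (y i, 0)) * r"
  using assms(1,3,5)
proof (induction A arbitrary: p rule: finite_induct)
  case (insert i A)
  have "sym_vec (y i, 0) dvd (\<Prod>j\<in>B. sym_vec (0, x j)) * p"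
    using insert.hyps insert.prems(2) by (simp add: mult.assoc)
  then have "sym_vec (y i, 0) dvd p"
    using coprime_vec_prod[where x = x, OF assms(2) insert.prems(1)[OF insertI1]] assms(4) by blast
  then obtain p' where p': "p = sym_vec (y i, 0) * p'" by (rule dvdE)
  have "sym_vec (y i, 0) \<noteq> 0" using insert.prems by (intro sym_vec_nonzero) (auto simp: zero_prod_def)
  moreover have "sym_vec (y i, 0) * ((\<Prod>j\<in>B. sym_vec (0, x j)) * p') =
      sym_vec (y i, 0) * ((\<Prod>i\<in>A. sym_vec (y i, 0)) * q)"
    using insert.prems(2) insert.hyps by (simp add: p' mult_ac)
  ultimately have "(\<Prod>j\<in>B. sym_vec (0, x j)) * p' = (\<Prod>i\<in>A. sym_vec (y i, 0)) * q" by (rule sym_mult_cancel)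
  then obtain r where "p' = (\<Prod>i\<in>A. sym_vec (y i, 0)) * r" using insert.IH[of p'] insert.prems(1) by auto
  then show ?case using insert.hyps p' by (auto simp: mult_ac)
qed simp

section \<open>The action of the group on points, and the set of generic points\<close>

definition point_act :: "('n::finite) cmat \<Rightarrow> 'n hhd \<Rightarrow> 'n hhd" where
  "point_act w \<pi> = (fst \<pi> v* matrix_inv w, w *v snd \<pi>)"

lemma point_act_scaleV: "point_act w (scaleV a \<pi>) = scaleV a (point_act w \<pi>)"
  by (simp add: point_act_def scaleV_def vector_scalar_commute scalar_vector_matrix_assoc)

lemma linV_diff: "linV g \<Longrightarrow> g (u - v) = g u - g v"
  using linV_add[of g "u - v" v] by simp

context matrix_group begin

lemma veval_point_act: "w \<in> W \<Longrightarrow> veval v (point_act (matrix_inv w) \<pi>) = veval (W_act w v) \<pi>"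
  by (simp add: veval_def point_act_def W_act_apply pairing_matrix)

lemma point_act_mult: "u \<in> W \<Longrightarrow> v \<in> W \<Longrightarrow> point_act (u ** v) \<pi> = point_act u (point_act v \<pi>)"
  by (simp add: point_act_def inv_mult matrix_vector_mul_assoc vector_matrix_mul_assoc)

lemma point_act_one [simp]: "point_act (mat 1 :: 'n cmat) \<pi> = \<pi>"
  by (simp add: point_act_def)

lemma peval_W_act: "w \<in> W \<Longrightarrow> peval (sym_map (W_act w) p) \<pi> = peval p (point_act (matrix_inv w) \<pi>)"
  by (rule peval_sym_map) (simp add: veval_point_act)

lemma W_act_inv: "w \<in> W \<Longrightarrow> W_act (matrix_inv w) (W_act w v) = v"
  "w \<in> W \<Longrightarrow> W_act w (W_act (matrix_inv w) v) = v"
  using fun_cong[OF W_act_mult[of "matrix_inv w" w], of v] fun_cong[OF W_act_mult[of w "matrix_inv w"], of v]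
  by (simp_all add: l_inv r_inv W_act_one)

text \<open>For \<open>w\<close> different from 1 the fixed spaces of \<open>w\<close> on
  \<open>h\<close> and on \<open>h*\<close> are proper, so each lies in the kernel of a nonzero
  linear form. A single point outside the kernels of these finitely many forms supplies both
  vectors.\<close>

lemma ex_generic_vectors:
  "\<exists>y x. \<forall>w\<in>W. w \<noteq> mat 1 \<longrightarrow> w *v y \<noteq> y \<and> x v* matrix_inv w \<noteq> x"
proof -
  have row: "\<exists>i. M $ i \<noteq> 0" if "M \<noteq> 0" for M :: "'n cmat"
    using that by (metis vec_eq_iff zero_index)
  have mv: "(M *v y) $ i = pairing (M $ i) y" for M :: "'n cmat" and y i
    by (simp add: matrix_vector_mult_def pairing_def)
  have vm: "(x v* M) $ i = pairing x (transpose M $ i)" for M :: "'n cmat" and x i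
    by (simp add: vector_matrix_mult_def pairing_def transpose_def mult.commute)
  have ne: "\<exists>r. r \<noteq> 0 \<and> (\<forall>y. w *v y = y \<longrightarrow> pairing r y = 0)" if "w \<in> W" "w \<noteq> mat 1" for w
  proof -
    \<comment> \<open>Every row of \<open>w - mat 1\<close> vanishes on the fixed vectors, and some
      row is nonzero.\<close>
    obtain i where "(w - mat 1) $ i \<noteq> 0" using row[of "w - mat 1"] \<open>w \<noteq> mat 1\<close> right_minus_eq by blast
    moreover have "pairing ((w - mat 1) $ i) y = 0" if "w *v y = y" for y
      using that mv[of "w - mat 1" y i] by (simp add: matrix_vector_mult_diff_rdistrib)
    ultimately show ?thesis by blast
  qed
  have ne': "\<exists>r. r \<noteq> 0 \<and> (\<forall>x. x v* matrix_inv w = x \<longrightarrow> pairing x r = 0)" if "w \<in> W" "w \<noteq> mat 1" for w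
  proof -
    have "matrix_inv w \<noteq> mat 1" using that by (metis inv_inv inv_one)
    then have "transpose (matrix_inv w - mat 1) \<noteq> 0"
      by (auto simp: transpose_def vec_eq_iff)
    then obtain i where "transpose (matrix_inv w - mat 1) $ i \<noteq> 0" using row by blast
    moreover have "pairing x (transpose (matrix_inv w - mat 1) $ i) = 0" if "x v* matrix_inv w = x" for x
      using that vm[of x "matrix_inv w - mat 1" i] by (simp add: vector_matrix_mult_diff_rdistrib)
    ultimately show ?thesis by blast
  qed
  obtain r where r: "\<And>w. w \<in> W - {mat 1} \<Longrightarrow> r w \<noteq> 0 \<and> (\<forall>y. w *v y = y \<longrightarrow> pairing (r w) y = 0)"
    using ne by (metis Diff_iff insertI1)
  obtain r' where r': "\<And>w. w \<in> W - {mat 1} \<Longrightarrow> r' w \<noteq> 0 \<and> (\<forall>x. x v* matrix_inv w = x \<longrightarrow> pairing x (r' w) = 0)"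
    using ne' by (metis Diff_iff insertI1)
  let ?F = "(\<lambda>w. sym_vec (0, r w)) ` (W - {mat 1}) \<union> (\<lambda>w. sym_vec (r' w, 0)) ` (W - {mat 1})"
  have "sym_vec (0, r w) \<noteq> 0" "sym_vec (r' w, 0) \<noteq> 0" if "w \<in> W - {mat 1}" for w
    using r[OF that] r'[OF that] by (auto intro!: sym_vec_nonzero simp: zero_prod_def)
  then have "0 \<notin> ?F" by fastforce
  then obtain \<pi> where "\<forall>p\<in>?F. peval p \<pi> \<noteq> 0" using generic_point[of ?F] by auto
  then have "pairing (r w) (snd \<pi>) \<noteq> 0" "pairing (fst \<pi>) (r' w) \<noteq> 0" if "w \<in> W - {mat 1}" for w
    using that by (auto simp: peval_sym_vec veval_def ball_Un)
  then have "w *v snd \<pi> \<noteq> snd \<pi> \<and> fst \<pi> v* matrix_inv w \<noteq> fst \<pi>" if "w \<in> W - {mat 1}" for w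
    using r[OF that] r'[OF that] that by metis
  then show ?thesis by (metis Diff_iff singletonD)
qed

text \<open>Vectors of \<open>h\<close> and \<open>h*\<close> with trivial stabilizer. Their orbits
  have one point for each element of \<open>W\<close> and serve as interpolation nodes.\<close>

definition vy :: "complex ^ 'n" where
  "vy = (SOME y. \<exists>x. \<forall>w\<in>W. w \<noteq> mat 1 \<longrightarrow> w *v y \<noteq> y \<and> x v* matrix_inv w \<noteq> x)"
definition vx :: "complex ^ 'n" where
  "vx = (SOME x. \<forall>w\<in>W. w \<noteq> mat 1 \<longrightarrow> w *v vy \<noteq> vy \<and> x v* matrix_inv w \<noteq> x)"

lemma vy_vx: "w \<in> W \<Longrightarrow> w \<noteq> mat 1 \<Longrightarrow> w *v vy \<noteq> vy \<and> vx v* matrix_inv w \<noteq> vx"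
  using someI_ex[OF someI_ex[OF ex_generic_vectors, folded vy_def], folded vx_def] by blast

lemma W_act_vy_vx:
  assumes "u \<in> W" "w \<in> W" "u \<noteq> w"
  shows "W_act u (vy, 0) \<noteq> W_act w (vy, 0)" "W_act u (0, vx) \<noteq> W_act w (0, vx)"
proof -
  have g: "matrix_inv w ** u \<in> W" "matrix_inv w ** u \<noteq> mat 1"
    using assms by (auto, metis inv_W inv_inv inv_unique)
  have "W_act (matrix_inv w ** u) v = W_act (matrix_inv w) (W_act u v)" for v
    using assms by (simp add: W_act_mult)
  then show "W_act u (vy, 0) \<noteq> W_act w (vy, 0)" "W_act u (0, vx) \<noteq> W_act w (0, vx)"
    using vy_vx[OF g] assms W_act_inv(1)[of w] by (auto simp: W_act_apply)
qed

text \<open>On \<open>G\<close> the group acts freely, no reflection hyperplane is met, and the denominators of the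
  Lagrange interpolation below do not vanish.\<close>

definition G :: "'n hhd set" where
  "G = {\<pi>. \<forall>u\<in>W. \<forall>w\<in>W. u \<noteq> w \<longrightarrow>
     veval (W_act u (vy, 0) - W_act w (vy, 0)) \<pi> \<noteq> 0 \<and> veval (W_act u (0, vx) - W_act w (0, vx)) \<pi> \<noteq> 0}"

text \<open>Translation by \<open>w\<close> carries a pair of distinct group elements to another
  such pair, so it permutes the conditions that define \<open>G\<close>.\<close>

lemma G_point_act: "\<pi> \<in> G \<Longrightarrow> w \<in> W \<Longrightarrow> point_act w \<pi> \<in> G"
proof -
  assume \<pi>: "\<pi> \<in> G" and w: "w \<in> W"
  have e: "veval (W_act u v - W_act u' v) (point_act w \<pi>) = veval (W_act (matrix_inv w ** u) v - W_act (matrix_inv w ** u') v) \<pi>"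
    if "u \<in> W" "u' \<in> W" for u u' v
    using veval_point_act[of "matrix_inv w" _ \<pi>] w that by (simp add: veval_diff W_act_mult linV_diff[OF linV_W_act])
  have "matrix_inv w ** u \<noteq> matrix_inv w ** u'" if "u \<noteq> u'" for u u' :: "'n cmat"
    using that mul_inv_cancel(1)[OF w, of u] mul_inv_cancel(1)[OF w, of u'] by auto
  then show ?thesis using \<pi> w unfolding G_def by (simp add: e)
qed

lemma G_scaleV: "\<pi> \<in> G \<Longrightarrow> a \<noteq> 0 \<Longrightarrow> scaleV a \<pi> \<in> G"
  by (simp add: G_def veval_scaleV_right)

text \<open>The set \<open>G\<close> is the complement of finitely many hyperplanes, and a nonzero
  \<open>p\<close> together with the equations of these hyperplanes has a common point of
  nonvanishing.\<close>

lemma peval_zero_on_G: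
  assumes "\<And>\<pi>. \<pi> \<in> G \<Longrightarrow> peval p \<pi> = 0" shows "p = 0"
proof (rule ccontr)
  assume "p \<noteq> 0"
  define F where "F = (\<lambda>(u, w). sym_vec (W_act u (vy, 0) - W_act w (vy, 0))) ` {(u, w) \<in> W \<times> W. u \<noteq> w} \<union>
    (\<lambda>(u, w). sym_vec (W_act u (0, vx) - W_act w (0, vx))) ` {(u, w) \<in> W \<times> W. u \<noteq> w}"
  have "finite {(u, w) \<in> W \<times> W. u \<noteq> w}" by (rule finite_subset[of _ "W \<times> W"]) auto
  then have "finite (insert p F)" unfolding F_def by blast
  moreover have "0 \<notin> insert p F"
  proof -
    have "sym_vec (W_act u (vy, 0) - W_act w (vy, 0)) \<noteq> 0" "sym_vec (W_act u (0, vx) - W_act w (0, vx)) \<noteq> 0"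
      if "u \<in> W" "w \<in> W" "u \<noteq> w" for u w
      using W_act_vy_vx[OF that] by (auto intro!: sym_vec_nonzero)
    then show ?thesis using \<open>p \<noteq> 0\<close> unfolding F_def by fastforce
  qed
  ultimately obtain \<pi> where \<pi>: "\<forall>q\<in>insert p F. peval q \<pi> \<noteq> 0" using generic_point by blast
  have "\<pi> \<in> G" unfolding G_def
  proof (intro CollectI ballI impI)
    fix u w assume "u \<in> W" "w \<in> W" "u \<noteq> w"
    then have "sym_vec (W_act u (vy, 0) - W_act w (vy, 0)) \<in> insert p F" "sym_vec (W_act u (0, vx) - W_act w (0, vx)) \<in> insert p F"
      unfolding F_def by force+
    then show "veval (W_act u (vy, 0) - W_act w (vy, 0)) \<pi> \<noteq> 0 \<and> veval (W_act u (0, vx) - W_act w (0, vx)) \<pi> \<noteq> 0"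
      using \<pi> unfolding peval_sym_vec[symmetric] by blast
  qed
  then show False using assms \<pi> by blast
qed

lemma peval_eq_on_G: "(\<And>\<pi>. \<pi> \<in> G \<Longrightarrow> peval p \<pi> = peval q \<pi>) \<Longrightarrow> p = q"
  using peval_zero_on_G[of "p - q"] by (simp add: peval.ext_diff)

end

section \<open>Dunkl operators\<close>

text \<open>Linear forms with the same kernel are proportional, and the factor cancels in the
  quotient. At a common zero \<open>z\<close> both quotients are 0 by division by zero.\<close>

lemma pairing_ratio:
  assumes "\<And>z. pairing a z = 0 \<longleftrightarrow> pairing b z = 0"
  shows "pairing a y / pairing a z = pairing b y / pairing b z"
proof (cases "pairing b z = 0")
  case False
  then have z: "pairing a z \<noteq> 0" using assms by blast
  have "pairing b (y - (pairing b y / pairing b z) *s z) = 0"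
    using False by (simp add: pairing_diff_right pairing_scale_right)
  then have "pairing a (y - (pairing b y / pairing b z) *s z) = 0" using assms by blast
  then have "pairing a y = (pairing b y / pairing b z) * pairing a z"
    by (simp add: pairing_diff_right pairing_scale_right)
  then show ?thesis using z by simp
qed (use assms in simp)

lemma pairing_eqI: "(\<And>z. pairing x z = pairing x' z) \<Longrightarrow> x = x'"
proof -
  assume a: "\<And>z. pairing x z = pairing x' z"
  have "pairing x (axis i 1) = x $ i" for x :: "complex ^ 'a" and i
    by (simp add: pairing_def axis_def if_distrib cong: if_cong)
  then show ?thesis using a by (metis vec_eq_iff)
qed

lemma rank_one:
  fixes M :: "('n::finite) cmat"
  assumes M: "\<And>z. M *v z = pairing b z *s v" and "b \<noteq> 0" "v \<noteq> 0"
  shows "rank M = 1"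
proof -
  have row: "row i M = v $ i *s b" for i
  proof (rule pairing_eqI)
    fix z
    have "pairing (row i M) z = (M *v z) $ i"
      by (simp add: pairing_def row_def matrix_vector_mult_def)
    then show "pairing (row i M) z = pairing (v $ i *s b) z"
      by (simp add: M pairing_scale_left)
  qed
  obtain i where i: "v $ i \<noteq> 0" using assms(3) by (metis vec_eq_iff zero_index)
  have "vec.dim (rows M) = 1"
  proof (rule vec.dim_unique)
    show "{row i M} \<subseteq> rows M" by (auto simp: rows_def)
    have "row j M = (v $ j / v $ i) *s row i M" for j using i by (simp add: row)
    then have "row j M \<in> vec.span {row i M}" for j by (metis vec.span_base vec.span_scale singletonI)
    then show "rows M \<subseteq> vec.span {row i M}" by (auto simp: rows_def)
    show "vec.independent {row i M}" using i assms(2) by (simp add: row)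
  qed simp
  then show ?thesis by (simp add: row_rank_def_gen)
qed

context reflection_data begin

abbreviation conj :: "'n cmat \<Rightarrow> 'n cmat \<Rightarrow> 'n cmat" where
  "conj u s \<equiv> u ** s ** matrix_inv u"

lemma refl_ker: "s \<in> S \<Longrightarrow> pairing (\<alpha> s) y = 0 \<longleftrightarrow> s *v y = y"
  using root_data unfolding root_data_def by blast

definition eigval :: "'n cmat \<Rightarrow> complex" where
  "eigval s = (SOME l. l \<noteq> 1 \<and> s *v \<alpha>v s = l *s \<alpha>v s)"

lemma eigval: "s \<in> S \<Longrightarrow> eigval s \<noteq> 1 \<and> s *v \<alpha>v s = eigval s *s \<alpha>v s"
  unfolding eigval_def by (rule someI_ex) (use root_data in \<open>auto simp: root_data_def\<close>)

lemma \<alpha>v_nonzero: "s \<in> S \<Longrightarrow> \<alpha>v s \<noteq> 0"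
  using root_data unfolding root_data_def by blast

lemma vec_scale_eq: "a *s v = b *s v \<Longrightarrow> v \<noteq> 0 \<Longrightarrow> a = (b :: complex)"
  by (metis vec.scale_right_imp_eq)

definition root_norm :: "'n cmat \<Rightarrow> complex" where "root_norm s = pairing (\<alpha> s) (\<alpha>v s)"

lemma root_norm: "s \<in> S \<Longrightarrow> root_norm s \<noteq> 0"
  unfolding root_norm_def refl_ker using eigval[of s] \<alpha>v_nonzero[of s] vec_scale_eq[of "eigval s" "\<alpha>v s" 1] by auto

lemma eigval_nonzero: "s \<in> S \<Longrightarrow> eigval s \<noteq> 0"
proof
  assume s: "s \<in> S" "eigval s = 0"
  then have "s *v \<alpha>v s = 0" using eigval[of s] by simp
  then have "matrix_inv s *v (s *v \<alpha>v s) = 0" by simp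
  then show False using s \<alpha>v_nonzero[of s] by (simp add: matrix_vector_mul_assoc l_inv)
qed

lemma refl_apply: "s \<in> S \<Longrightarrow> s *v y = y + ((eigval s - 1) / root_norm s * pairing (\<alpha> s) y) *s \<alpha>v s"
proof -
  assume s: "s \<in> S"
  let ?t = "pairing (\<alpha> s) y / root_norm s"
  have "pairing (\<alpha> s) (y - ?t *s \<alpha>v s) = 0"
    using root_norm[OF s] by (simp add: pairing_diff_right pairing_scale_right root_norm_def)
  then have "s *v (y - ?t *s \<alpha>v s) = y - ?t *s \<alpha>v s" using refl_ker[OF s] by simp
  then have "s *v y = y - ?t *s \<alpha>v s + ?t *s (eigval s *s \<alpha>v s)"
    using eigval[OF s] by (simp add: matrix_vector_mult_diff_distrib vector_scalar_commute algebra_simps)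
  then show ?thesis
    by (simp add: vec_eq_iff algebra_simps diff_divide_distrib)
qed

lemma refl_inv_apply: "s \<in> S \<Longrightarrow> matrix_inv s *v y = y + ((1 / eigval s - 1) / root_norm s * pairing (\<alpha> s) y) *s \<alpha>v s"
proof -
  assume s: "s \<in> S"
  let ?z = "y + ((1 / eigval s - 1) / root_norm s * pairing (\<alpha> s) y) *s \<alpha>v s"
  have "s *v ?z = y"
    unfolding refl_apply[OF s, of ?z] using root_norm[OF s] eigval_nonzero[OF s]
    by (simp add: vec_eq_iff pairing_add_right pairing_scale_right root_norm_def[symmetric] field_simps)
  then have "matrix_inv s *v y = matrix_inv s *v (s *v ?z)" by simp
  then show ?thesis using s by (simp add: matrix_vector_mul_assoc l_inv)
qed

definition dual_coeff :: "'n cmat \<Rightarrow> complex" where "dual_coeff s = (1 / eigval s - 1) / root_norm s"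

lemma refl_dual_apply: "s \<in> S \<Longrightarrow> x v* matrix_inv s = x + (dual_coeff s * pairing x (\<alpha>v s)) *s \<alpha> s"
  by (rule pairing_eqI)
    (simp add: pairing_matrix refl_inv_apply pairing_add_right pairing_add_left pairing_scale_left pairing_scale_right dual_coeff_def)

lemma vec_cancel [simp]: "u \<in> W \<Longrightarrow> u *v (matrix_inv u *v z) = z" "u \<in> W \<Longrightarrow> matrix_inv u *v (u *v z) = z"
  for z :: "complex ^ 'n"
  by (simp_all add: matrix_vector_mul_assoc r_inv l_inv)

lemma conj_vec: "conj u s *v z = u *v (s *v (matrix_inv u *v z))" for z :: "complex ^ 'n"
  by (simp add: matrix_vector_mul_assoc matrix_mul_assoc)

text \<open>Invertibility and finite order pass to conjugates. For the rank, the conjugate minus 1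
  is exhibited as a nonzero linear form times a nonzero vector.\<close>

lemma conj_in_S [simp]:
  assumes u: "u \<in> W" and s: "s \<in> S" shows "conj u s \<in> S"
proof -
  have W: "conj u s \<in> W" using assms by simp
  have inv: "invertible (conj u s)" unfolding invertible_def using r_inv[OF W] l_inv[OF W] by blast
  have sr: "complex_reflection s" using s unfolding reflections_def by blast
  then obtain k where k: "k > 0" "(((**) s) ^^ k) (mat 1) = mat 1" by (auto simp: complex_reflection_def)
  have "(((**) (conj u s)) ^^ j) (mat 1) = conj u ((((**) s) ^^ j) (mat 1))" for j
  proof (induction j)
    case (Suc j)
    then show ?case using u by (simp add: matrix_mul_assoc[symmetric])
  qed (simp add: u r_inv)
  then have ord: "(((**) (conj u s)) ^^ k) (mat 1) = mat 1" using k u by (simp add: r_inv)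
  have "rank (conj u s - mat 1) = 1"
  proof (rule rank_one)
    fix z
    have "conj u s *v z = u *v (s *v (matrix_inv u *v z))" by (rule conj_vec)
    also have "\<dots> = z + ((eigval s - 1) / root_norm s * pairing (\<alpha> s) (matrix_inv u *v z)) *s (u *v \<alpha>v s)"
      unfolding refl_apply[OF s] using u
      by (simp add: matrix_vector_right_distrib vector_scalar_commute matrix_vector_mul_assoc r_inv)
    finally show "(conj u s - mat 1) *v z = pairing (((eigval s - 1) / root_norm s) *s (\<alpha> s v* matrix_inv u)) z *s (u *v \<alpha>v s)"
      by (simp add: matrix_vector_mult_diff_rdistrib pairing_scale_left pairing_matrix)
  next
    have "u *v \<alpha>v s \<noteq> 0"
      using \<alpha>v_nonzero[OF s] u by (metis matrix_vector_mul_assoc l_inv matrix_vector_mul_lid matrix_vector_mult_0_right)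
    then show "u *v \<alpha>v s \<noteq> 0" .
    have "pairing (((eigval s - 1) / root_norm s) *s (\<alpha> s v* matrix_inv u)) (u *v \<alpha>v s) = eigval s - 1"
      using u root_norm[OF s] by (simp add: pairing_scale_left pairing_matrix matrix_vector_mul_assoc l_inv root_norm_def)
    then show "((eigval s - 1) / root_norm s) *s (\<alpha> s v* matrix_inv u) \<noteq> 0"
      using eigval[OF s] by auto
  qed
  then show ?thesis using W inv ord k(1) unfolding reflections_def complex_reflection_def by blast
qed

lemma ker_conj:
  assumes u: "u \<in> W" and s: "s \<in> S"
  shows "pairing (\<alpha> (conj u s)) z = 0 \<longleftrightarrow> pairing (\<alpha> s v* matrix_inv u) z = 0"
proof -
  have "conj u s *v z = z \<longleftrightarrow> s *v (matrix_inv u *v z) = matrix_inv u *v z"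
    unfolding conj_vec by (metis u vec_cancel)
  then show ?thesis using refl_ker[OF conj_in_S[OF u s]] refl_ker[OF s] by (simp add: pairing_matrix)
qed

text \<open>Roots are chosen separately for each reflection, so the root of a conjugate agrees with
  the translated root only up to a scalar; the quotient does not see that scalar.\<close>

lemma ratio_conj:
  assumes "u \<in> W" "s \<in> S"
  shows "pairing (\<alpha> (conj u s)) y / pairing (\<alpha> (conj u s)) z =
         pairing (\<alpha> s) (matrix_inv u *v y) / pairing (\<alpha> s) (matrix_inv u *v z)"
  using pairing_ratio[OF ker_conj[OF assms]] by (simp add: pairing_matrix)

text \<open>An eigenvector of a reflection with eigenvalue other than 1 lies on the line of its
  chosen coroot. So the translate of \<open>\<alpha>v s\<close> is proportional to
  \<open>\<alpha>v (conj u s)\<close>, and their eigenvalues agree.\<close>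

lemma eigval_conj:
  assumes u: "u \<in> W" and s: "s \<in> S" shows "eigval (conj u s) = eigval s"
proof -
  let ?t = "conj u s" and ?v = "u *v \<alpha>v s"
  have t: "?t \<in> S" using assms by simp
  have tv: "?t *v ?v = eigval s *s ?v"
    unfolding conj_vec using eigval[OF s] u by (simp add: vector_scalar_commute)
  have v0: "?v \<noteq> 0"
    using \<alpha>v_nonzero[OF s] u by (metis matrix_vector_mul_assoc l_inv matrix_vector_mul_lid matrix_vector_mult_0_right)
  define r where "r = (eigval ?t - 1) / root_norm ?t * pairing (\<alpha> ?t) ?v"
  have eq: "(eigval s - 1) *s ?v = r *s \<alpha>v ?t"
    using tv unfolding refl_apply[OF t] r_def by (simp add: vec_eq_iff algebra_simps)
  have ls: "eigval s - 1 \<noteq> 0" using eigval[OF s] by simp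
  have "?t *v ((eigval s - 1) *s ?v) = eigval ?t *s ((eigval s - 1) *s ?v)"
    unfolding eq using eigval[OF t] by (simp add: vector_scalar_commute mult.commute)
  then have "(eigval s - 1) *s (?t *v ?v) = eigval ?t *s ((eigval s - 1) *s ?v)"
    by (simp only: vector_scalar_commute)
  then have "(eigval s - 1) *s (eigval s *s ?v) = (eigval s - 1) *s (eigval ?t *s ?v)"
    unfolding tv by (simp only: vector_smult_assoc mult.commute[of "eigval ?t"])
  then have "eigval s *s ?v = eigval ?t *s ?v" using ls by (metis vec.scale_left_imp_eq)
  then show ?thesis using v0 by (metis vec_scale_eq)
qed

lemma c_conj: "u \<in> W \<Longrightarrow> s \<in> S \<Longrightarrow> c (conj u s) = c s"
  using conj_invariant unfolding conj_invariant_def by blast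

text \<open>The customary constant 2 c / (1 - l), where l = 1 / \<open>eigval s\<close> is the
  eigenvalue of s on its root in \<open>h*\<close>.\<close>

definition dunkl_const :: "'n cmat \<Rightarrow> complex" where "dunkl_const s = 2 * c s / (1 - 1 / eigval s)"

lemma dunkl_const_conj: "u \<in> W \<Longrightarrow> s \<in> S \<Longrightarrow> dunkl_const (conj u s) = dunkl_const s"
  by (simp add: dunkl_const_def c_conj eigval_conj)

lemma kappa_coeff_dunkl_const: "s \<in> S \<Longrightarrow> kappa_coeff s = dunkl_const s * dual_coeff s"
proof -
  assume s: "s \<in> S"
  define d where "d = 1 - 1 / eigval s"
  have "d \<noteq> 0" using eigval[OF s] eigval_nonzero[OF s] by (simp add: d_def)
  moreover have "1 / eigval s - 1 = - d" by (simp add: d_def)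
  ultimately show ?thesis unfolding kappa_coeff_def dunkl_const_def dual_coeff_def root_norm_def d_def[symmetric] by simp
qed

lemma veval_vx: "u \<in> W \<Longrightarrow> veval (W_act u (0, vx)) \<pi> = pairing vx (matrix_inv u *v snd \<pi>)"
  by (simp add: veval_def W_act_apply pairing_matrix)

lemma G_free: "\<pi> \<in> G \<Longrightarrow> g \<in> W \<Longrightarrow> g \<noteq> mat 1 \<Longrightarrow> pairing vx (matrix_inv g *v snd \<pi>) - pairing vx (snd \<pi>) \<noteq> 0"
proof -
  assume "\<pi> \<in> G" "g \<in> W" "g \<noteq> mat 1"
  have "veval (W_act g (0, vx) - W_act (mat 1) (0, vx)) \<pi> \<noteq> 0"
    using \<open>\<pi> \<in> G\<close>[unfolded G_def mem_Collect_eq, rule_format, OF \<open>g \<in> W\<close> one_W \<open>g \<noteq> mat 1\<close>] by (rule conjunct2)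
  then show ?thesis using \<open>g \<in> W\<close> veval_vx[of g \<pi>] veval_vx[of "mat 1" \<pi>] by (simp add: veval_diff)
qed

text \<open>If \<open>\<alpha> s\<close> vanished at the point of \<open>h\<close>, then s would fix
  this point, against the freeness of the action on \<open>G\<close>.\<close>

lemma G_alpha: "\<pi> \<in> G \<Longrightarrow> s \<in> S \<Longrightarrow> pairing (\<alpha> s) (snd \<pi>) \<noteq> 0"
proof
  assume \<pi>: "\<pi> \<in> G" and s: "s \<in> S" and 0: "pairing (\<alpha> s) (snd \<pi>) = 0"
  have "s \<noteq> mat 1" using eigval[OF s] \<alpha>v_nonzero[OF s] vec_scale_eq[of "eigval s" "\<alpha>v s" 1] by auto
  then show False using G_free[OF \<pi> _, of s] s 0 by (simp add: refl_inv_apply)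
qed

lemma snd_point_act: "snd (point_act w \<pi>) = w *v snd \<pi>" by (simp add: point_act_def)

text \<open>The commutativity of the Dunkl operators reduces to this vanishing. For \<open>g \<noteq> 1\<close>, after
  multiplication with the scalar \<open>vx (g\<^sup>-\<^sup>1 \<xi>) - vx (\<xi>)\<close>, the terms for \<open>(s, s')\<close> and
  \<open>(s s' s\<^sup>-\<^sup>1, s)\<close> cancel.\<close>

definition dterm :: "complex ^ 'n \<Rightarrow> complex ^ 'n \<Rightarrow> complex ^ 'n \<Rightarrow> 'n cmat \<times> 'n cmat \<Rightarrow> complex" where
  "dterm y y' \<xi> = (\<lambda>(s, t). dunkl_const s * dunkl_const t *
     (pairing (\<alpha> s) y * pairing (\<alpha> t) y' - pairing (\<alpha> s) y' * pairing (\<alpha> t) y) /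
     (pairing (\<alpha> s) \<xi> * pairing (\<alpha> t) (matrix_inv s *v \<xi>)))"

lemma dunkl_sum_zero:
  assumes \<pi>: "\<pi> \<in> G" and g: "g \<in> W"
  shows "(\<Sum>p | p \<in> S \<times> S \<and> fst p ** snd p = g. dterm y y' (snd \<pi>) p) = 0"
proof -
  define \<xi> where "\<xi> = snd \<pi>"
  let ?P = "{p. p \<in> S \<times> S \<and> fst p ** snd p = g}"
  have a0: "pairing (\<alpha> s) \<xi> \<noteq> 0" if "s \<in> S" for s using G_alpha[OF \<pi> that] by (simp add: \<xi>_def)
  have a1: "pairing (\<alpha> t) (matrix_inv s *v \<xi>) \<noteq> 0" if "s \<in> S" "t \<in> S" for s t
    using G_alpha[OF G_point_act[OF \<pi>, of "matrix_inv s"] that(2)] that(1) by (simp add: snd_point_act \<xi>_def)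
  have fin: "finite ?P" by (rule finite_subset[of _ "S \<times> S"]) auto
  show ?thesis
  proof (cases "g = mat 1")
    case True
    \<comment> \<open>Here t is the inverse of s, so both have the same hyperplane, their roots are
      proportional and the antisymmetric numerator vanishes.\<close>
    have "dterm y y' \<xi> (s, t) = 0" if "s \<in> S" "t \<in> S" "s ** t = mat 1" for s t
    proof -
      have t: "t = matrix_inv s" using inv_unique that by simp
      have "t *v z = z \<longleftrightarrow> s *v z = z" for z
        using that by (metis t S_W l_inv r_inv matrix_vector_mul_assoc matrix_vector_mul_lid)
      then have "pairing (\<alpha> s) z = 0 \<longleftrightarrow> pairing (\<alpha> t) z = 0" for z
        using refl_ker that by simp
      from pairing_ratio[OF this, of _ \<xi>]
      have eqs: "pairing (\<alpha> s) y * pairing (\<alpha> t) \<xi> = pairing (\<alpha> t) y * pairing (\<alpha> s) \<xi>"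
        "pairing (\<alpha> s) y' * pairing (\<alpha> t) \<xi> = pairing (\<alpha> t) y' * pairing (\<alpha> s) \<xi>"
        using a0 that by (simp_all add: field_simps)
      have "(pairing (\<alpha> s) y * pairing (\<alpha> t) y' - pairing (\<alpha> s) y' * pairing (\<alpha> t) y) * pairing (\<alpha> t) \<xi> = 0"
      proof -
        have "(pairing (\<alpha> s) y * pairing (\<alpha> t) y' - pairing (\<alpha> s) y' * pairing (\<alpha> t) y) * pairing (\<alpha> t) \<xi> =
          (pairing (\<alpha> s) y * pairing (\<alpha> t) \<xi>) * pairing (\<alpha> t) y' - (pairing (\<alpha> s) y' * pairing (\<alpha> t) \<xi>) * pairing (\<alpha> t) y"
          by (simp add: algebra_simps)
        also have "\<dots> = (pairing (\<alpha> t) y * pairing (\<alpha> s) \<xi>) * pairing (\<alpha> t) y' - (pairing (\<alpha> t) y' * pairing (\<alpha> s) \<xi>) * pairing (\<alpha> t) y"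
          using eqs by (simp only:)
        finally show ?thesis by simp
      qed
      then show ?thesis using a0[OF that(2)] by (simp add: dterm_def)
    qed
    then show ?thesis unfolding \<xi>_def[symmetric] using True by (intro sum.neutral) auto
  next
    case False
    let ?d = "pairing vx (matrix_inv g *v \<xi>) - pairing vx \<xi>"
    let ?r = "\<lambda>s. dual_coeff s * pairing vx (\<alpha>v s)"
    let ?N = "\<lambda>s t. dunkl_const s * dunkl_const t * (pairing (\<alpha> s) y * pairing (\<alpha> t) y' - pairing (\<alpha> s) y' * pairing (\<alpha> t) y)"
    let ?A = "\<lambda>(s, t). ?N s t * ?r t / pairing (\<alpha> s) \<xi>"
    let ?B = "\<lambda>(s, t). ?N s t * ?r s / pairing (\<alpha> t) (matrix_inv s *v \<xi>)"
    have diff: "pairing vx (matrix_inv s *v z) - pairing vx z = ?r s * pairing (\<alpha> s) z" if "s \<in> S" for s z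
      by (simp add: refl_inv_apply[OF that] dual_coeff_def pairing_add_right pairing_scale_right)
    have split: "dterm y y' \<xi> p * ?d = ?A p + ?B p" if "p \<in> ?P" for p
    proof -
      obtain s t where p: "p = (s, t)" by (cases p)
      have star: "s \<in> S" "t \<in> S" "s ** t = g" using that p by auto
      have "matrix_inv g *v \<xi> = matrix_inv t *v (matrix_inv s *v \<xi>)"
        using star by (auto simp: inv_mult matrix_vector_mul_assoc)
      \<comment> \<open>The scalar telescopes over the intermediate point
        \<open>matrix_inv s *v \<xi>\<close>, and each of the two differences cancels one of the
        denominators.\<close>
      then have "?d = ?r t * pairing (\<alpha> t) (matrix_inv s *v \<xi>) + ?r s * pairing (\<alpha> s) \<xi>"
        using diff[OF star(2), of "matrix_inv s *v \<xi>"] diff[OF star(1), of \<xi>]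
        by (simp only: diff_add_eq_diff_diff_swap add_diff_eq) (simp add: algebra_simps)
      then show ?thesis using a0[OF star(1)] a1[OF star(1,2)]
        by (simp add: p dterm_def field_simps)
    qed
    have "(\<Sum>p\<in>?P. ?B p) = (\<Sum>p\<in>?P. - ?A p)"
    proof (rule sum.reindex_bij_witness[where i = "\<lambda>(t, s). (s, conj (matrix_inv s) t)"
          and j = "\<lambda>(s, t). (conj s t, s)"])
      fix p assume "p \<in> ?P"
      then obtain s t where p: "p = (s, t)" and star: "s \<in> S" "t \<in> S" "s ** t = g" by (cases p) auto
      show "(\<lambda>(t, s). (s, conj (matrix_inv s) t)) ((\<lambda>(s, t). (conj s t, s)) p) = p"
        using star(1,2) by (simp add: p matrix_mul_assoc[symmetric] l_inv)
      show "(\<lambda>(s, t). (conj s t, s)) p \<in> ?P"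
        using star conj_in_S[of s t] by (auto simp: p matrix_mul_assoc[symmetric] l_inv)
      show "(\<lambda>(s, t). (conj s t, s)) ((\<lambda>(t, s). (s, conj (matrix_inv s) t)) p) = p"
        using star(1,2) by (simp add: p matrix_mul_assoc[symmetric] r_inv)
      show "(\<lambda>(t, s). (s, conj (matrix_inv s) t)) p \<in> ?P"
        using star conj_in_S[of "matrix_inv t" s] by (auto simp: p matrix_mul_assoc[symmetric] r_inv)
      let ?a = "pairing (\<alpha> t)" and ?z = "matrix_inv s *v \<xi>"
      have ne: "?a ?z \<noteq> 0" "pairing (\<alpha> (conj s t)) \<xi> \<noteq> 0" using a0 a1 star by auto
      have rt: "pairing (\<alpha> (conj s t)) y / pairing (\<alpha> (conj s t)) \<xi> = ?a (matrix_inv s *v y) / ?a ?z" for y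
        using ratio_conj[of s t y \<xi>] star by simp
      have "?N (conj s t) s / pairing (\<alpha> (conj s t)) \<xi> =
          dunkl_const t * dunkl_const s * ((pairing (\<alpha> (conj s t)) y / pairing (\<alpha> (conj s t)) \<xi>) * pairing (\<alpha> s) y' -
             (pairing (\<alpha> (conj s t)) y' / pairing (\<alpha> (conj s t)) \<xi>) * pairing (\<alpha> s) y)"
        unfolding dunkl_const_conj[OF S_W[OF star(1)] star(2)] by (simp add: algebra_simps diff_divide_distrib)
      \<comment> \<open>The inverse of s changes y and y' by multiples of the coroot proportional to
        \<open>pairing (\<alpha> s) y\<close> and \<open>pairing (\<alpha> s) y'\<close>; these
        changes cancel by antisymmetry.\<close>
      also have "\<dots> = - (?N s t / ?a ?z)"
        unfolding rt refl_inv_apply[OF star(1), of y] refl_inv_apply[OF star(1), of y'] using ne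
        by (simp add: pairing_add_right pairing_scale_right field_simps)
      finally have "?N (conj s t) s / pairing (\<alpha> (conj s t)) \<xi> * ?r s = - (?N s t / ?a ?z) * ?r s" by simp
      then show "- ?A ((\<lambda>(s, t). (conj s t, s)) p) = ?B p"
        by (simp add: p)
    qed
    then have "(\<Sum>p\<in>?P. dterm y y' \<xi> p * ?d) = 0"
      using split by (simp add: sum.distrib sum_negf)
    then have "(\<Sum>p\<in>?P. dterm y y' \<xi> p) * ?d = 0" by (simp add: sum_distrib_right)
    moreover have "?d \<noteq> 0" using G_free[OF \<pi> g False] by (simp add: \<xi>_def)
    ultimately show ?thesis unfolding \<xi>_def[symmetric] by simp
  qed
qed

end

section \<open>Fields and the operators on them\<close>

lemma additive_sum:
  fixes h :: "'a::comm_monoid_add \<Rightarrow> 'b::comm_monoid_add"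
  assumes "\<And>x y. h (x + y) = h x + h y" "h 0 = 0"
  shows "h (\<Sum>i\<in>A. f i) = (\<Sum>i\<in>A. h (f i))"
  by (induction A rule: infinite_finite_induct) (simp_all add: assms)

text \<open>
  A field \<open>m\<close> stands for the element \<open>\<Sum>\<^sub>w m(w) w\<close> of the crossed product of functions with \<open>W\<close>. Fields that
  do not depend on \<open>w\<close> form the submodule of functions.
\<close>

type_synonym 'n fld = "'n cmat \<Rightarrow> 'n hhd \<Rightarrow> complex"

definition fld_scale :: "complex \<Rightarrow> 'n fld \<Rightarrow> ('n::finite) fld" where
  "fld_scale a m = (\<lambda>w \<pi>. a * m w \<pi>)"

text \<open>Left multiplication by \<open>u\<close> in the crossed product: moving \<open>u\<close>
  past a coefficient function transforms that function, and the group index is shifted.\<close>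

definition translate :: "('n::finite) cmat \<Rightarrow> 'n fld \<Rightarrow> 'n fld" where
  "translate u m = (\<lambda>w \<pi>. m (matrix_inv u ** w) (point_act (matrix_inv u) \<pi>))"

lemma fld_scale_add: "fld_scale a (m + m') = fld_scale a m + fld_scale a m'"
  and fld_scale_add_left: "fld_scale (a + b) m = fld_scale a m + fld_scale b m"
  and fld_scale_fld_scale: "fld_scale a (fld_scale b m) = fld_scale (a * b) m"
  and fld_scale_0 [simp]: "fld_scale a 0 = 0" "fld_scale 0 m = 0" and fld_scale_1 [simp]: "fld_scale 1 m = m"
  by (auto simp: fld_scale_def fun_eq_iff algebra_simps)

lemma fld_scale_sum: "fld_scale a (\<Sum>i\<in>A. f i) = (\<Sum>i\<in>A. fld_scale a (f i))"
  by (rule additive_sum[of "fld_scale a"]) (rule fld_scale_add fld_scale_0(1))+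

lemma translate_add: "translate u (m + m') = translate u m + translate u m'"
  and translate_fld_scale: "translate u (fld_scale a m) = fld_scale a (translate u m)"
  and translate_0 [simp]: "translate u 0 = 0"
  by (auto simp: translate_def fld_scale_def fun_eq_iff)

lemma translate_sum: "translate u (\<Sum>i\<in>A. f i) = (\<Sum>i\<in>A. translate u (f i))"
  by (rule additive_sum[of "translate u"]) (rule translate_add translate_0)+

context reflection_data begin

lemma translate_translate: "u \<in> W \<Longrightarrow> v \<in> W \<Longrightarrow> translate u (translate v m) = translate (u ** v) m"
  by (simp add: translate_def inv_mult matrix_mul_assoc point_act_mult fun_eq_iff)

lemma translate_one [simp]: "translate (mat 1) m = m" for m :: "'n fld"
  by (rule ext)+ (simp add: translate_def)

definition dunkl_coeff :: "'n cmat \<Rightarrow> 'n hhd \<Rightarrow> 'n hhd \<Rightarrow> complex" where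
  "dunkl_coeff s v \<pi> = dunkl_const s * (pairing (\<alpha> s) (fst v) / pairing (\<alpha> s) (snd \<pi>))"

text \<open>In \<open>veval v \<pi>\<close> the derivative along \<open>h\<close> is replaced by its
  symbol, and the part in \<open>h*\<close> acts by multiplication. The usual difference s - 1 is
  reduced to s; the operators so obtained satisfy the defining relations on \<open>G\<close>, by
  \<open>dunkl_commutator\<close>.\<close>

definition dunkl :: "'n hhd \<Rightarrow> 'n fld \<Rightarrow> 'n fld" where
  "dunkl v m = (\<lambda>w \<pi>. veval v \<pi> * m w \<pi> + (\<Sum>s\<in>S. dunkl_coeff s v \<pi> * translate s m w \<pi>))"

lemma dunkl_coeff_add: "dunkl_coeff s (u + v) \<pi> = dunkl_coeff s u \<pi> + dunkl_coeff s v \<pi>"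
  and dunkl_coeff_scaleV: "dunkl_coeff s (scaleV a v) \<pi> = a * dunkl_coeff s v \<pi>"
  by (auto simp: dunkl_coeff_def scaleV_def pairing_add_right pairing_scale_right add_divide_distrib algebra_simps)

lemma dunkl_add: "dunkl v (m + m') = dunkl v m + dunkl v m'"
  and dunkl_fld_scale: "dunkl v (fld_scale a m) = fld_scale a (dunkl v m)"
  and dunkl_add_vec: "dunkl (u + v) m = dunkl u m + dunkl v m"
  and dunkl_scaleV: "dunkl (scaleV a v) m = fld_scale a (dunkl v m)"
  and dunkl_zero [simp]: "dunkl v 0 = 0"
  by (auto simp: dunkl_def translate_add translate_fld_scale dunkl_coeff_add dunkl_coeff_scaleV veval_add veval_scaleV fun_eq_iff distrib_left distrib_right
      sum.distrib sum_distrib_left mult_ac, auto simp: fld_scale_def distrib_left sum_distrib_left mult_ac)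

lemma dunkl_zero_vec [simp]: "dunkl 0 m = 0"
  using dunkl_add_vec[of 0 0 m] by simp

lemma dunkl_sum_vec: "dunkl (\<Sum>i\<in>A. f i) m = (\<Sum>i\<in>A. dunkl (f i) m)"
  by (rule additive_sum[of "\<lambda>v. dunkl v m"]) (rule dunkl_add_vec dunkl_zero_vec)+

lemma dunkl_expand: "dunkl v m = (\<Sum>k\<in>UNIV. fld_scale (coord v k) (dunkl (basis k) m))"
  by (subst basis_expansion_hhd) (simp add: dunkl_sum_vec dunkl_scaleV)

lemma dunkl_coeff_conj:
  assumes "u \<in> W" "s \<in> S" shows "dunkl_coeff (conj u s) (W_act u v) \<pi> = dunkl_coeff s v (point_act (matrix_inv u) \<pi>)"
  unfolding dunkl_coeff_def dunkl_const_conj[OF assms] ratio_conj[OF assms] using assms by (simp add: W_act_apply snd_point_act)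

text \<open>Conjugation by \<open>u\<close> permutes the reflections, and \<open>dunkl_coeff\<close>
  follows it because its constant is invariant and its quotient of roots does not depend on their
  scaling.\<close>

lemma translate_dunkl:
  assumes u: "u \<in> W" shows "translate u (dunkl v m) = dunkl (W_act u v) (translate u m)"
proof (intro ext)
  fix w \<pi>
  have "(\<Sum>s\<in>S. dunkl_coeff s v (point_act (matrix_inv u) \<pi>) * translate s m (matrix_inv u ** w) (point_act (matrix_inv u) \<pi>)) =
      (\<Sum>s\<in>S. dunkl_coeff s (W_act u v) \<pi> * translate s (translate u m) w \<pi>)"
  proof (rule sum.reindex_bij_witness[where i = "\<lambda>s. conj (matrix_inv u) s" and j = "\<lambda>s. conj u s"])
    fix s assume s: "s \<in> S"
    show "conj (matrix_inv u) (conj u s) = s"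
      using u by (simp add: matrix_mul_assoc[symmetric] l_inv)
    show "conj u (conj (matrix_inv u) s) = s"
      using u by (simp add: matrix_mul_assoc[symmetric] r_inv)
    show "conj u s \<in> S" "conj (matrix_inv u) s \<in> S"
      using conj_in_S[OF u s] conj_in_S[OF inv_W[OF u] s] by simp_all
    have "translate (conj u s) (translate u m) = translate u (translate s m)"
      using u s by (simp add: translate_translate matrix_mul_assoc[symmetric] l_inv)
    then show "dunkl_coeff (conj u s) (W_act u v) \<pi> * translate (conj u s) (translate u m) w \<pi> =
        dunkl_coeff s v (point_act (matrix_inv u) \<pi>) * translate s m (matrix_inv u ** w) (point_act (matrix_inv u) \<pi>)"
      unfolding dunkl_coeff_conj[OF u s] by (simp add: translate_def[of u])
  qed
  then show "translate u (dunkl v m) w \<pi> = dunkl (W_act u v) (translate u m) w \<pi>"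
    using u by (simp add: translate_def[of u] dunkl_def veval_point_act)
qed

definition word_act :: "('n + 'n) list \<Rightarrow> 'n fld \<Rightarrow> 'n fld" where
  "word_act ks m = foldr (\<lambda>k. dunkl (basis k)) ks m"

lemma word_act_simps [simp]: "word_act [] m = m" "word_act (k # ks) m = dunkl (basis k) (word_act ks m)"
  "word_act (ks @ js) m = word_act ks (word_act js m)"
  by (auto simp: word_act_def)

lemma word_act_add: "word_act ks (m + m') = word_act ks m + word_act ks m'"
  and word_act_scf: "word_act ks (fld_scale a m) = fld_scale a (word_act ks m)"
  and word_act_0 [simp]: "word_act ks 0 = 0"
proof -
  show "word_act ks (m + m') = word_act ks m + word_act ks m'"
    by (induction ks) (simp_all only: word_act_simps dunkl_add)
  show "word_act ks (fld_scale a m) = fld_scale a (word_act ks m)"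
    by (induction ks) (simp_all only: word_act_simps dunkl_fld_scale)
  show "word_act ks 0 = 0"
    by (induction ks) (simp_all only: word_act_simps dunkl_zero)
qed

definition tens_act :: "'n tens \<Rightarrow> 'n fld \<Rightarrow> 'n fld" where
  "tens_act p m = (\<Sum>u\<in>Poly_Mapping.keys p. fld_scale (Poly_Mapping.lookup p u) (word_act (letters u) m))"

sublocale tens_act: linear_extension "\<lambda>a u. fld_scale a (word_act (letters u) m)" "\<lambda>p. tens_act p m" for m
  by unfold_locales (auto simp: tens_act_def fld_scale_add_left)

lemma tens_act_word: "tens_act (word ks a) m = fld_scale a (word_act ks m)"
  by (simp add: tens_act.ext_single)

lemma tens_act_1 [simp]: "tens_act 1 m = m" and tens_act_const: "tens_act (const a) m = fld_scale a m"
  using tens_act.ext_single[of 0 1 m] tens_act.ext_single[of 0 a m] by (simp_all add: const_def)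

lemma tens_act_add: "tens_act p (m + m') = tens_act p m + tens_act p m'"
  and tens_act_fld_scale: "tens_act p (fld_scale a m) = fld_scale a (tens_act p m)"
  and tens_act_0 [simp]: "tens_act p 0 = 0"
  by (auto simp: tens_act_def word_act_add word_act_scf fld_scale_add sum.distrib fld_scale_fld_scale fld_scale_sum mult.commute)

lemma tens_act_sum: "tens_act p (\<Sum>i\<in>A. f i) = (\<Sum>i\<in>A. tens_act p (f i))"
  by (rule additive_sum[of "tens_act p"]) (rule tens_act_add tens_act_0)+

lemma tens_act_mult: "tens_act (p * q) m = tens_act p (tens_act q m)"
proof (induction p rule: tens_induct)
  case (word ks a)
  show ?case
  proof (induction q rule: tens_induct)
    case zero then show ?case by (simp only: mult_zero_right tens_act.ext_0 tens_act_0)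
  next
    case (word js b)
    then show ?case by (simp only: word_mult tens_act_word word_act_scf fld_scale_fld_scale word_act_simps)
  next
    case (add p q) then show ?case by (simp only: distrib_left tens_act.ext_add tens_act_add)
  qed
next
  case zero then show ?case by (simp only: mult_zero_left tens_act.ext_0)
next
  case (add p q) then show ?case by (simp only: distrib_right tens_act.ext_add)
qed

lemma tens_act_tens_vec: "tens_act (tens_vec v) m = dunkl v m"
  by (subst dunkl_expand) (simp add: tens_vec_def tens_act.ext_sum tens_act_word)

lemma translate_tens_act: "u \<in> W \<Longrightarrow> translate u (tens_act p m) = tens_act (tens_map (W_act u) p) (translate u m)"
proof (induction p rule: tens_induct)
  case (word ks a)
  have "translate u (word_act ks m) = tens_act (prod_list (map (\<lambda>k. tens_vec (W_act u (basis k))) ks)) (translate u m)"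
    using word by (induction ks)
      (simp_all only: word_act_simps translate_dunkl tens_act_mult tens_act_tens_vec list.map prod_list.Nil prod_list.Cons tens_act_1)
  then show ?case
    by (simp add: tens_act_word translate_fld_scale tens_map_word tens_act_mult tens_act_const)
next
  case zero then show ?case by (simp only: tens_map.ext_0 tens_act.ext_0 translate_0)
next
  case (add p q) then show ?case by (simp only: tens_map.ext_add tens_act.ext_add translate_add)
qed

definition crossed_act :: "('n cmat \<Rightarrow> 'n tens) \<Rightarrow> 'n fld \<Rightarrow> 'n fld" where
  "crossed_act f m = (\<Sum>w\<in>W. tens_act (f w) (translate w m))"

lemma crossed_act_add_left: "crossed_act (f + g) m = crossed_act f m + crossed_act g m"
  and crossed_act_add: "crossed_act f (m + m') = crossed_act f m + crossed_act f m'"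
  and crossed_act_fld_scale: "crossed_act f (fld_scale a m) = fld_scale a (crossed_act f m)"
  and crossed_act_0 [simp]: "crossed_act f 0 = 0" "crossed_act 0 m = 0"
  by (auto simp: crossed_act_def tens_act.ext_add translate_add tens_act_add sum.distrib translate_fld_scale tens_act_fld_scale fld_scale_sum tens_act.ext_0)

lemma crossed_act_diff_left: "crossed_act (f - g) m = crossed_act f m - crossed_act g m"
  using crossed_act_add_left[of "f - g" g m] by (simp add: eq_diff_eq)

lemma crossed_act_diff: "crossed_act f (m - m') = crossed_act f m - crossed_act f m'"
  using crossed_act_add[of f "m - m'" m'] by (simp add: eq_diff_eq)

lemma crossed_act_sum_left: "crossed_act (\<Sum>i\<in>A. f i) m = (\<Sum>i\<in>A. crossed_act (f i) m)"
  by (rule additive_sum[of "\<lambda>f. crossed_act f m"]) (rule crossed_act_add_left crossed_act_0(2))+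

lemma crossed_act_mono: "u \<in> W \<Longrightarrow> crossed_act (TW.mono u p) m = tens_act p (translate u m)"
proof -
  assume u: "u \<in> W"
  have "crossed_act (TW.mono u p) m = (\<Sum>w\<in>W. if w = u then tens_act p (translate u m) else 0)"
    unfolding crossed_act_def TW.mono_def by (rule sum.cong) (auto simp: tens_act.ext_0)
  then show ?thesis using u by simp
qed

lemma crossed_act_mult:
  assumes "f \<in> carrier TW.R" "g \<in> carrier TW.R"
  shows "crossed_act (f \<otimes>\<^bsub>TW.R\<^esub> g) m = crossed_act f (crossed_act g m)"
proof -
  have "crossed_act f (crossed_act g m) = (\<Sum>u\<in>W. \<Sum>v\<in>W. tens_act (f u * tens_map (W_act u) (g v)) (translate (u ** v) m))"
    by (simp add: crossed_act_def translate_sum tens_act_sum translate_tens_act translate_translate tens_act_mult)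
  then show ?thesis unfolding TW.expand_mult_R[OF assms] by (simp add: crossed_act_sum_left crossed_act_mono)
qed

text \<open>Where a root vanishes, the coefficients take the value that division by zero gives, so
  relations are asserted on \<open>G\<close> only. Fields vanishing on \<open>G\<close> are
  preserved by all operators because \<open>G\<close> is stable under \<open>W\<close>.\<close>

definition zeroG :: "'n fld \<Rightarrow> bool" where
  "zeroG m \<longleftrightarrow> (\<forall>w. \<forall>\<pi>\<in>G. m w \<pi> = 0)"

lemma zeroG_add: "zeroG m \<Longrightarrow> zeroG m' \<Longrightarrow> zeroG (m + m')"
  and zeroG_uminus: "zeroG m \<Longrightarrow> zeroG (- m)"
  and zeroG_scf: "zeroG m \<Longrightarrow> zeroG (fld_scale a m)"
  and zeroG_0 [simp]: "zeroG 0"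
  by (auto simp: zeroG_def fld_scale_def)

lemma zeroG_sum: "(\<And>i. i \<in> A \<Longrightarrow> zeroG (f i)) \<Longrightarrow> zeroG (\<Sum>i\<in>A. f i)"
  by (induction A rule: infinite_finite_induct) (auto simp: zeroG_add)

lemma zeroG_translate: "u \<in> W \<Longrightarrow> zeroG m \<Longrightarrow> zeroG (translate u m)"
  by (simp add: zeroG_def translate_def G_point_act)

lemma zeroG_dunkl: "zeroG m \<Longrightarrow> zeroG (dunkl v m)"
  using zeroG_translate[of _ m] by (auto simp: zeroG_def dunkl_def)

lemma zeroG_tens_act: "zeroG m \<Longrightarrow> zeroG (tens_act p m)"
proof -
  assume m: "zeroG m"
  have "zeroG (word_act ks m)" for ks by (induction ks) (auto simp: m zeroG_dunkl)
  then show ?thesis unfolding tens_act_def by (intro zeroG_sum zeroG_scf)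
qed

lemma zeroG_crossed_act: "zeroG m \<Longrightarrow> zeroG (crossed_act f m)"
  unfolding crossed_act_def by (intro zeroG_sum zeroG_tens_act zeroG_translate)

section \<open>The Dunkl operators satisfy the relations\<close>

lemma veval_refl:
  assumes s: "s \<in> S"
  shows "veval v (point_act (matrix_inv s) \<pi>) - veval v \<pi> =
    (eigval s - 1) / root_norm s * pairing (\<alpha> s) (fst v) * pairing (fst \<pi>) (\<alpha>v s) +
    dual_coeff s * pairing (snd v) (\<alpha>v s) * pairing (\<alpha> s) (snd \<pi>)"
  unfolding veval_point_act[OF S_W[OF s]]
  by (simp add: veval_def W_act_apply refl_apply[OF s] refl_dual_apply[OF s] pairing_add_left pairing_add_right
      pairing_scale_left pairing_scale_right)

text \<open>The commutator is sorted by the number of reflections. Products of two linear functions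
  commute, terms with one reflection add up to the right-hand side, and terms with two reflections
  cancel among those with the same product, by \<open>dunkl_sum_zero\<close>.\<close>

lemma dunkl_commutator:
  assumes \<pi>: "\<pi> \<in> G"
  shows "dunkl u (dunkl v m) w \<pi> - dunkl v (dunkl u m) w \<pi> = (\<Sum>s\<in>S. kappa_coeff s * kappa s u v * translate s m w \<pi>)"
proof -
  let ?q = "\<lambda>s. point_act (matrix_inv s) \<pi>"
  have omD: "translate s (dunkl v m) w \<pi> = veval v (?q s) * translate s m w \<pi> + (\<Sum>t\<in>S. dunkl_coeff t v (?q s) * translate (s ** t) m w \<pi>)"
    if "s \<in> S" for s v
  proof -
    have "translate t m (matrix_inv s ** w) (?q s) = translate (s ** t) m w \<pi>" if "t \<in> S" for t
      using translate_translate[of s t m] \<open>s \<in> S\<close> that by (simp add: translate_def[of s] fun_eq_iff)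
    then show ?thesis by (simp add: translate_def[of s] dunkl_def)
  qed
  have DD: "dunkl u (dunkl v m) w \<pi> = veval u \<pi> * veval v \<pi> * m w \<pi> +
      (\<Sum>s\<in>S. (veval u \<pi> * dunkl_coeff s v \<pi> + dunkl_coeff s u \<pi> * veval v (?q s)) * translate s m w \<pi>) +
      (\<Sum>s\<in>S. \<Sum>t\<in>S. dunkl_coeff s u \<pi> * dunkl_coeff t v (?q s) * translate (s ** t) m w \<pi>)" for u v
    by (simp add: dunkl_def[of u] omD)
      (simp add: dunkl_def distrib_left distrib_right sum.distrib sum_distrib_left mult_ac)
  have one: "(veval u \<pi> * dunkl_coeff s v \<pi> + dunkl_coeff s u \<pi> * veval v (?q s)) - (veval v \<pi> * dunkl_coeff s u \<pi> + dunkl_coeff s v \<pi> * veval u (?q s)) =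
      kappa_coeff s * kappa s u v" if s: "s \<in> S" for s
  proof -
    have a: "pairing (\<alpha> s) (snd \<pi>) \<noteq> 0" by (rule G_alpha[OF \<pi> s])
    have "(veval u \<pi> * dunkl_coeff s v \<pi> + dunkl_coeff s u \<pi> * veval v (?q s)) - (veval v \<pi> * dunkl_coeff s u \<pi> + dunkl_coeff s v \<pi> * veval u (?q s)) =
      dunkl_coeff s u \<pi> * (veval v (?q s) - veval v \<pi>) - dunkl_coeff s v \<pi> * (veval u (?q s) - veval u \<pi>)"
      by (simp add: algebra_simps)
    \<comment> \<open>In \<open>veval_refl\<close> the summand with \<open>fst \<pi>\<close> leads
      to a term symmetric in u and v, which drops out; in the other summand the root cancels the
      denominator of \<open>dunkl_coeff\<close>.\<close>
    also have "\<dots> = kappa_coeff s * kappa s u v"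
      unfolding veval_refl[OF s] kappa_coeff_dunkl_const[OF s] kappa_def dunkl_coeff_def using a by (simp add: field_simps)
    finally show ?thesis .
  qed
  have two: "(\<Sum>s\<in>S. \<Sum>t\<in>S. dunkl_coeff s u \<pi> * dunkl_coeff t v (?q s) * translate (s ** t) m w \<pi>) -
      (\<Sum>s\<in>S. \<Sum>t\<in>S. dunkl_coeff s v \<pi> * dunkl_coeff t u (?q s) * translate (s ** t) m w \<pi>) = 0"
  proof -
    let ?f = "dterm (fst u) (fst v) (snd \<pi>)"
    have "(\<Sum>s\<in>S. \<Sum>t\<in>S. dunkl_coeff s u \<pi> * dunkl_coeff t v (?q s) * translate (s ** t) m w \<pi>) -
      (\<Sum>s\<in>S. \<Sum>t\<in>S. dunkl_coeff s v \<pi> * dunkl_coeff t u (?q s) * translate (s ** t) m w \<pi>) =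
      (\<Sum>s\<in>S. \<Sum>t\<in>S. ?f (s, t) * translate (s ** t) m w \<pi>)"
      unfolding sum_subtractf[symmetric]
      by (intro sum.cong refl)
        (simp add: dunkl_coeff_def dterm_def snd_point_act diff_divide_distrib left_diff_distrib right_diff_distrib mult_ac)
    also have "\<dots> = (\<Sum>p\<in>S \<times> S. ?f p * translate (fst p ** snd p) m w \<pi>)"
      by (simp add: sum.cartesian_product split_beta)
    also have "\<dots> = (\<Sum>g\<in>W. \<Sum>p | p \<in> S \<times> S \<and> fst p ** snd p = g. ?f p * translate (fst p ** snd p) m w \<pi>)"
      by (rule sum.group[symmetric]) auto
    also have "\<dots> = (\<Sum>g\<in>W. (\<Sum>p | p \<in> S \<times> S \<and> fst p ** snd p = g. ?f p) * translate g m w \<pi>)"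
      by (simp add: sum_distrib_right)
    also have "\<dots> = 0" by (simp add: dunkl_sum_zero[OF \<pi>])
    finally show ?thesis .
  qed
  have "dunkl u (dunkl v m) w \<pi> - dunkl v (dunkl u m) w \<pi> =
     (\<Sum>s\<in>S. ((veval u \<pi> * dunkl_coeff s v \<pi> + dunkl_coeff s u \<pi> * veval v (?q s)) - (veval v \<pi> * dunkl_coeff s u \<pi> + dunkl_coeff s v \<pi> * veval u (?q s))) * translate s m w \<pi>)"
    using two unfolding DD left_diff_distrib sum_subtractf by (simp add: algebra_simps)
  then show ?thesis by (simp add: one)
qed

lemma zeroG_Rel: "zeroG (crossed_act (Rel u v) m)"
  unfolding Rel_def zeroG_def
  by (simp add: crossed_act_diff_left crossed_act_sum_left crossed_act_mono tens_act.ext_diff tens_act_mult tens_act_tens_vec tens_act_const dunkl_commutator)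
    (simp add: fld_scale_def)

text \<open>Those elements whose action vanishes on \<open>G\<close> form a two-sided ideal, and it
  contains the relations.\<close>

lemma zeroG_I:
  assumes "f \<in> I" shows "zeroG (crossed_act f m)"
proof -
  let ?K = "{f \<in> carrier TW.R. \<forall>m. zeroG (crossed_act f m)}"
  have "ideal ?K TW.R"
  proof (rule idealI)
    show "Ring.ring TW.R" by (rule TW.ring_axioms)
    show "subgroup ?K (add_monoid TW.R)"
    proof (rule TW.add.subgroupI)
      show "?K \<noteq> {}" by (auto intro!: exI[of _ 0])
      show "\<ominus>\<^bsub>TW.R\<^esub> a \<in> ?K" if "a \<in> ?K" for a
        using that zeroG_uminus crossed_act_diff_left[of 0 a] by auto
    qed (auto simp: crossed_act_add_left zeroG_add)
  qed (auto simp: crossed_act_mult zeroG_crossed_act)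
  then have "I \<subseteq> ?K" by (rule I_minimal) (simp add: zeroG_Rel)
  then show ?thesis using assms by blast
qed

end

section \<open>Leading terms\<close>

context reflection_data begin

text \<open>Scaling by 2 alone detects the degree, as the powers of 2 are distinct.\<close>

definition homfun :: "int \<Rightarrow> ('n hhd \<Rightarrow> complex) \<Rightarrow> bool" where
  "homfun k \<phi> \<longleftrightarrow> (\<forall>\<pi>\<in>G. \<phi> (scaleV 2 \<pi>) = 2 powi k * \<phi> \<pi>)"

lemma homfun_add: "homfun k \<phi> \<Longrightarrow> homfun k \<psi> \<Longrightarrow> homfun k (\<lambda>\<pi>. \<phi> \<pi> + \<psi> \<pi>)"
  and homfun_diff: "homfun k \<phi> \<Longrightarrow> homfun k \<psi> \<Longrightarrow> homfun k (\<lambda>\<pi>. \<phi> \<pi> - \<psi> \<pi>)"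
  and homfun_scale: "homfun k \<phi> \<Longrightarrow> homfun k (\<lambda>\<pi>. a * \<phi> \<pi>)"
  and homfun_zero [simp]: "homfun k (\<lambda>\<pi>. 0)"
  by (auto simp: homfun_def algebra_simps)

lemma homfun_mult: "homfun j \<phi> \<Longrightarrow> homfun k \<psi> \<Longrightarrow> homfun (j + k) (\<lambda>\<pi>. \<phi> \<pi> * \<psi> \<pi>)"
  by (simp add: homfun_def power_int_add)

lemma homfun_sum: "(\<And>i. i \<in> A \<Longrightarrow> homfun k (f i)) \<Longrightarrow> homfun k (\<lambda>\<pi>. \<Sum>i\<in>A. f i \<pi>)"
  by (simp add: homfun_def sum_distrib_left)

lemma homfun_point_act: "u \<in> W \<Longrightarrow> homfun k \<phi> \<Longrightarrow> homfun k (\<lambda>\<pi>. \<phi> (point_act u \<pi>))"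
  by (simp add: homfun_def point_act_scaleV G_point_act)

lemma homfun_peval: "homog d p \<Longrightarrow> homfun (int d) (peval p)"
  by (simp add: homfun_def peval_scaleV_homog)

lemma homfun_const [simp]: "homfun 0 (\<lambda>\<pi>. a)"
  by (simp add: homfun_def)

lemma homfun_veval: "homfun 1 (veval v)"
  by (simp add: homfun_def veval_scaleV_right)

lemma homfun_dunkl_coeff: "homfun (- 1) (dunkl_coeff s v)"
  by (simp add: homfun_def dunkl_coeff_def scaleV_def pairing_scale_right power_int_minus)

text \<open>Homogeneous functions are eigenvectors of scaling by 2, so this is the independence of
  eigenvectors for distinct eigenvalues. The induction applies the scaling operator minus its
  eigenvalue \<open>2 powi j\<close>.\<close>

lemma homfun_independent:
  assumes "finite K" "\<And>k. homfun k (h k)" "\<And>\<pi>. \<pi> \<in> G \<Longrightarrow> (\<Sum>k\<in>K. h k \<pi>) = 0" "k \<in> K" "\<pi> \<in> G"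
  shows "h k \<pi> = 0"
  using assms
proof (induction K arbitrary: h k \<pi> rule: finite_induct)
  case (insert j K)
  define h' where "h' k \<pi> = (2 powi k - 2 powi j) * h k \<pi>" for k \<pi>
  have ne: "(2 powi k - 2 powi j :: complex) \<noteq> 0" if "k \<noteq> j" for k
  proof
    assume "2 powi k - 2 powi j = (0 :: complex)"
    then have "complex_of_real (2 powi k) = complex_of_real (2 powi j)" by simp
    then have "(2 :: real) powi k = 2 powi j" by (simp only: of_real_eq_iff)
    then show False using that power_int_strict_increasing[of k j "2 :: real"] power_int_strict_increasing[of j k "2 :: real"]
      by (cases "k < j") auto
  qed
  have IH: "h k \<pi> = 0" if k: "k \<in> K" and \<pi>: "\<pi> \<in> G" for k \<pi>
  proof -
    have "h' k \<pi> = 0"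
    proof (rule insert.IH[OF _ _ k \<pi>])
      show "homfun k (h' k)" for k unfolding h'_def by (rule homfun_scale) (rule insert.prems(1))
      show "(\<Sum>k\<in>K. h' k \<rho>) = 0" if \<rho>: "\<rho> \<in> G" for \<rho>
      proof -
        have "h k (scaleV 2 \<rho>) = 2 powi k * h k \<rho>" for k using insert.prems(1)[of k] \<rho> by (simp add: homfun_def)
        then have "(\<Sum>k\<in>insert j K. 2 powi k * h k \<rho>) = 0"
          using insert.prems(2)[OF G_scaleV[OF \<rho>, of 2]] by simp
        moreover have "2 powi j * (\<Sum>k\<in>insert j K. h k \<rho>) = 0" using insert.prems(2)[OF \<rho>] by simp
        ultimately have "(\<Sum>k\<in>insert j K. h' k \<rho>) = 0"
          by (simp only: h'_def left_diff_distrib sum_subtractf sum_distrib_left diff_self)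
        then show ?thesis using insert.hyps by (simp add: h'_def)
      qed
    qed
    then show ?thesis using ne[of k] k insert.hyps by (auto simp: h'_def)
  qed
  show ?case
  proof (cases "k = j")
    case True
    then show ?thesis using insert.prems(2)[OF insert.prems(4)] insert.hyps IH insert.prems(4) by simp
  qed (use IH insert.prems in auto)
qed simp

text \<open>On \<open>G\<close> the function is a finite sum of components of degrees from -M to d.
  The upper bound detects leading terms; the lower bound limits the poles and makes the descent in
  \<open>stable_in_image\<close> end.\<close>

definition graded :: "int \<Rightarrow> int \<Rightarrow> ('n hhd \<Rightarrow> complex) \<Rightarrow> bool" where
  "graded M d \<phi> \<longleftrightarrow> (\<exists>h. (\<forall>k. homfun k (h k)) \<and> (\<forall>\<pi>\<in>G. \<phi> \<pi> = (\<Sum>k\<in>{-M..d}. h k \<pi>)))"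

lemma graded_cong: "(\<And>\<pi>. \<pi> \<in> G \<Longrightarrow> \<phi> \<pi> = \<psi> \<pi>) \<Longrightarrow> graded M d \<phi> \<longleftrightarrow> graded M d \<psi>"
  by (simp add: graded_def)

lemma graded_zero [simp]: "graded M d (\<lambda>\<pi>. 0)"
  unfolding graded_def by (rule exI[of _ "\<lambda>k \<pi>. 0"]) simp

lemma graded_add: "graded M d \<phi> \<Longrightarrow> graded M d \<psi> \<Longrightarrow> graded M d (\<lambda>\<pi>. \<phi> \<pi> + \<psi> \<pi>)"
proof -
  assume "graded M d \<phi>" "graded M d \<psi>"
  then obtain h h' where "\<forall>k. homfun k (h k)" "\<forall>\<pi>\<in>G. \<phi> \<pi> = (\<Sum>k\<in>{-M..d}. h k \<pi>)"
    "\<forall>k. homfun k (h' k)" "\<forall>\<pi>\<in>G. \<psi> \<pi> = (\<Sum>k\<in>{-M..d}. h' k \<pi>)" unfolding graded_def by blast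
  then show ?thesis unfolding graded_def
    by (intro exI[of _ "\<lambda>k \<pi>. h k \<pi> + h' k \<pi>"]) (simp add: homfun_add sum.distrib)
qed

lemma graded_scale: "graded M d \<phi> \<Longrightarrow> graded M d (\<lambda>\<pi>. a * \<phi> \<pi>)"
proof -
  assume "graded M d \<phi>"
  then obtain h where "\<forall>k. homfun k (h k)" "\<forall>\<pi>\<in>G. \<phi> \<pi> = (\<Sum>k\<in>{-M..d}. h k \<pi>)" unfolding graded_def by blast
  then show ?thesis unfolding graded_def
    by (intro exI[of _ "\<lambda>k \<pi>. a * h k \<pi>"]) (simp add: homfun_scale sum_distrib_left)
qed

lemma graded_diff: "graded M d \<phi> \<Longrightarrow> graded M d \<psi> \<Longrightarrow> graded M d (\<lambda>\<pi>. \<phi> \<pi> - \<psi> \<pi>)"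
  using graded_add[of M d \<phi> "\<lambda>\<pi>. - 1 * \<psi> \<pi>"] graded_scale[of M d \<psi> "- 1"] by simp

lemma graded_sum: "(\<And>i. i \<in> A \<Longrightarrow> graded M d (f i)) \<Longrightarrow> graded M d (\<lambda>\<pi>. \<Sum>i\<in>A. f i \<pi>)"
  by (induction A rule: infinite_finite_induct) (simp_all add: graded_add)

lemma graded_hom: "homfun k \<phi> \<Longrightarrow> - M \<le> k \<Longrightarrow> k \<le> d \<Longrightarrow> graded M d \<phi>"
  unfolding graded_def by (rule exI[of _ "\<lambda>j \<pi>. if j = k then \<phi> \<pi> else 0"]) (auto simp: homfun_def)

lemma graded_mono:
  assumes "graded M d \<phi>" "M \<le> M'" "d \<le> d'" shows "graded M' d' \<phi>"
proof -
  from assms(1) obtain h where h: "\<And>k. homfun k (h k)" "\<And>\<pi>. \<pi> \<in> G \<Longrightarrow> \<phi> \<pi> = (\<Sum>k\<in>{-M..d}. h k \<pi>)"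
    unfolding graded_def by blast
  have "graded M' d' (\<lambda>\<pi>. \<Sum>k\<in>{-M..d}. h k \<pi>)"
    by (rule graded_sum, rule graded_hom[OF h(1)]) (use assms in auto)
  then show ?thesis by (subst graded_cong[OF h(2)])
qed

lemma graded_mult:
  assumes "graded M d \<phi>" "graded M' d' \<psi>" shows "graded (M + M') (d + d') (\<lambda>\<pi>. \<phi> \<pi> * \<psi> \<pi>)"
proof -
  from assms(1) obtain h where h: "\<And>k. homfun k (h k)" "\<And>\<pi>. \<pi> \<in> G \<Longrightarrow> \<phi> \<pi> = (\<Sum>k\<in>{-M..d}. h k \<pi>)"
    unfolding graded_def by blast
  from assms(2) obtain h' where h': "\<And>k. homfun k (h' k)" "\<And>\<pi>. \<pi> \<in> G \<Longrightarrow> \<psi> \<pi> = (\<Sum>k\<in>{-M'..d'}. h' k \<pi>)"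
    unfolding graded_def by blast
  have "graded (M + M') (d + d') (\<lambda>\<pi>. \<Sum>j\<in>{-M..d}. \<Sum>k\<in>{-M'..d'}. h j \<pi> * h' k \<pi>)"
    by (intro graded_sum, rule graded_hom[OF homfun_mult[OF h(1) h'(1)]]) auto
  moreover have "(\<Sum>j\<in>{-M..d}. \<Sum>k\<in>{-M'..d'}. h j \<pi> * h' k \<pi>) = \<phi> \<pi> * \<psi> \<pi>" if "\<pi> \<in> G" for \<pi>
    using h(2)[OF that] h'(2)[OF that] by (simp add: sum_product)
  ultimately show ?thesis by (rule iffD1[OF graded_cong, rotated])
qed

lemma graded_hom_mult: "homfun j \<phi> \<Longrightarrow> graded M d \<psi> \<Longrightarrow> graded (M - j) (d + j) (\<lambda>\<pi>. \<phi> \<pi> * \<psi> \<pi>)"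
  using graded_mult[OF graded_hom[of j \<phi> "-j" j], of M d \<psi>] by (simp add: add.commute)

lemma graded_point_act: "u \<in> W \<Longrightarrow> graded M d \<phi> \<Longrightarrow> graded M d (\<lambda>\<pi>. \<phi> (point_act u \<pi>))"
proof -
  assume u: "u \<in> W" and "graded M d \<phi>"
  then obtain h where "\<forall>k. homfun k (h k)" "\<forall>\<pi>\<in>G. \<phi> \<pi> = (\<Sum>k\<in>{-M..d}. h k \<pi>)" unfolding graded_def by blast
  then show ?thesis unfolding graded_def using u
    by (intro exI[of _ "\<lambda>k \<pi>. h k (point_act u \<pi>)"]) (simp add: homfun_point_act G_point_act)
qed

lemma graded_empty: "graded M d \<phi> \<Longrightarrow> d < - M \<Longrightarrow> \<pi> \<in> G \<Longrightarrow> \<phi> \<pi> = 0"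
  by (auto simp: graded_def)

text \<open>A homogeneous function can be a sum of components of other degrees only if it is zero,
  since components of distinct degrees are independent.\<close>

lemma graded_hom_zero:
  assumes "homfun k \<phi>" "graded M d \<phi>" "d < k" "\<pi> \<in> G" shows "\<phi> \<pi> = 0"
proof -
  from assms(2) obtain h where h: "\<And>k. homfun k (h k)" "\<And>\<pi>. \<pi> \<in> G \<Longrightarrow> \<phi> \<pi> = (\<Sum>k\<in>{-M..d}. h k \<pi>)"
    unfolding graded_def by blast
  define h' where "h' j = (if j = k then (\<lambda>\<pi>. - 1 * \<phi> \<pi>) else h j)" for j
  have "h' k \<pi> = 0"
  proof (rule homfun_independent[of "insert k {-M..d}"])
    show "homfun j (h' j)" for j using h(1) homfun_scale[OF assms(1), of "- 1"] by (auto simp: h'_def)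
    show "(\<Sum>j\<in>insert k {-M..d}. h' j \<rho>) = 0" if "\<rho> \<in> G" for \<rho>
    proof -
      have "(\<Sum>j\<in>{-M..d}. h' j \<rho>) = (\<Sum>j\<in>{-M..d}. h j \<rho>)" by (rule sum.cong) (use assms(3) in \<open>auto simp: h'_def\<close>)
      then show ?thesis using h(2)[OF that] assms(3) by (simp add: h'_def)
    qed
  qed (use assms in auto)
  then show ?thesis by (simp add: h'_def)
qed

lemma graded_top:
  assumes "graded M d \<phi>" obtains \<psi> where "homfun d \<psi>" "graded M (d - 1) (\<lambda>\<pi>. \<phi> \<pi> - \<psi> \<pi>)"
proof -
  from assms obtain h where h: "\<And>k. homfun k (h k)" "\<And>\<pi>. \<pi> \<in> G \<Longrightarrow> \<phi> \<pi> = (\<Sum>k\<in>{-M..d}. h k \<pi>)"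
    unfolding graded_def by blast
  show thesis
  proof (cases "-M \<le> d")
    case True
    then have "{-M..d} = insert d {-M..d - 1}" by auto
    then have "\<phi> \<pi> - h d \<pi> = (\<Sum>k\<in>{-M..d - 1}. h k \<pi>)" if "\<pi> \<in> G" for \<pi> using h(2)[OF that] by simp
    then have "graded M (d - 1) (\<lambda>\<pi>. \<phi> \<pi> - h d \<pi>)" unfolding graded_def using h(1) by blast
    then show thesis using that h(1) by blast
  next
    case False
    then have "\<phi> \<pi> = 0" if "\<pi> \<in> G" for \<pi> using graded_empty[OF assms _ that] by simp
    then have "graded M (d - 1) (\<lambda>\<pi>. \<phi> \<pi> - 0)" using graded_cong[of \<phi> "\<lambda>\<pi>. 0"] by (simp add: graded_cong[of \<phi> "\<lambda>\<pi>. 0"])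
    then show thesis using that[of "\<lambda>\<pi>. 0"] by simp
  qed
qed

text \<open>A letter acts by its linear function, of degree 1, plus terms that lower the degree by
  1. So a word acts to leading order by its monomial, and it lowers degrees by at most its length,
  whence the bound \<open>int (length ks) - e\<close>.\<close>

lemma word_act_symbol:
  assumes m: "\<And>w. homfun e (m w)"
  shows "graded (int (length ks) - e) (e + int (length ks) - 1)
           (\<lambda>\<pi>. word_act ks m w \<pi> - peval (Poly_Mapping.single (mon ks) 1) \<pi> * m w \<pi>)"
proof (induction ks arbitrary: w)
  case Nil
  have "peval (Poly_Mapping.single (mon []) 1) \<pi> = 1" for \<pi> :: "'n hhd" by (simp add: single_one)
  then show ?case by simp
next
  case (Cons k ks)
  let ?n = "int (length ks)" and ?X = "word_act ks m"
  let ?p = "Poly_Mapping.single (mon ks) (1 :: complex)"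
  have hp: "homog (length ks) ?p" by (auto simp: homog_iff mon_deg_mon)
  have X: "graded (?n - e) (e + ?n) (\<lambda>\<pi>. ?X w \<pi>)" for w
  proof -
    have "graded (?n - e) (e + ?n) (\<lambda>\<pi>. (?X w \<pi> - peval ?p \<pi> * m w \<pi>) + peval ?p \<pi> * m w \<pi>)"
      by (rule graded_add) (auto intro: graded_mono[OF Cons.IH] graded_hom[OF homfun_mult[OF homfun_peval[OF hp] m]])
    then show ?thesis by simp
  qed
  have 1: "graded (?n + 1 - e) (e + ?n) (\<lambda>\<pi>. veval (basis k) \<pi> * (?X w \<pi> - peval ?p \<pi> * m w \<pi>))"
    using graded_hom_mult[OF homfun_veval Cons.IH] by (rule graded_mono) auto
  have 2: "graded (?n + 1 - e) (e + ?n) (\<lambda>\<pi>. \<Sum>s\<in>S. dunkl_coeff s (basis k) \<pi> * translate s ?X w \<pi>)"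
  proof (rule graded_sum)
    fix s assume "s \<in> S"
    then have "graded (?n - e) (e + ?n) (\<lambda>\<pi>. translate s ?X w \<pi>)" unfolding translate_def by (intro graded_point_act X) simp
    from graded_hom_mult[OF homfun_dunkl_coeff this] show "graded (?n + 1 - e) (e + ?n) (\<lambda>\<pi>. dunkl_coeff s (basis k) \<pi> * translate s ?X w \<pi>)"
      by (rule graded_mono) auto
  qed
  have "peval (Poly_Mapping.single (mon (k # ks)) 1) \<pi> = veval (basis k) \<pi> * peval ?p \<pi>" for \<pi>
    unfolding peval_sym_vec[symmetric] sym_vec_basis peval_mult[symmetric] mult_single by simp
  then have eq: "word_act (k # ks) m w \<pi> - peval (Poly_Mapping.single (mon (k # ks)) 1) \<pi> * m w \<pi> =
     veval (basis k) \<pi> * (?X w \<pi> - peval ?p \<pi> * m w \<pi>) + (\<Sum>s\<in>S. dunkl_coeff s (basis k) \<pi> * translate s ?X w \<pi>)" for \<pi>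
    by (simp add: dunkl_def algebra_simps)
  show ?case unfolding eq using graded_add[OF 1 2] by (rule graded_mono) auto
qed

lemma tens_act_symbol:
  assumes m: "\<And>w. homfun e (m w)" and a: "\<And>u. u \<in> Poly_Mapping.keys a \<Longrightarrow> word_deg u \<le> n"
  shows "graded (int n - e) (e + int n - 1) (\<lambda>\<pi>. tens_act a m w \<pi> - peval (hom_part n (symmetrize a)) \<pi> * m w \<pi>)"
proof -
  let ?s = "\<lambda>u. Poly_Mapping.single (mon (letters u)) (Poly_Mapping.lookup a u)"
  have sym: "hom_part n (symmetrize a) = (\<Sum>u\<in>Poly_Mapping.keys a. hom_part n (?s u))"
    by (simp add: symmetrize_def hom_part_sum mon_def)
  have "tens_act a m w \<pi> - peval (hom_part n (symmetrize a)) \<pi> * m w \<pi> = (\<Sum>u\<in>Poly_Mapping.keys a.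
      Poly_Mapping.lookup a u * word_act (letters u) m w \<pi> - peval (hom_part n (?s u)) \<pi> * m w \<pi>)" for \<pi>
    by (simp add: tens_act_def sym peval.ext_sum sum_distrib_right sum_subtractf fld_scale_def)
  moreover have "graded (int n - e) (e + int n - 1) (\<lambda>\<pi>. \<Sum>u\<in>Poly_Mapping.keys a.
      Poly_Mapping.lookup a u * word_act (letters u) m w \<pi> - peval (hom_part n (?s u)) \<pi> * m w \<pi>)"
  proof (rule graded_sum)
    fix u assume u: "u \<in> Poly_Mapping.keys a"
    obtain ks where ks: "letters u = ks" by simp
    let ?l = "Poly_Mapping.lookup a u" and ?p = "Poly_Mapping.single (mon ks) (1 :: complex)"
    have len: "length ks \<le> n" using a[OF u] ks by (simp add: word_deg_def)
    have s: "?s u = const ?l * ?p" by (simp add: ks const_single)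
    have hp: "homog (length ks) ?p" by (auto simp: homog_iff mon_deg_mon)
    have W: "graded (int (length ks) - e) (e + int (length ks) - 1) (\<lambda>\<pi>. ?l * (word_act ks m w \<pi> - peval ?p \<pi> * m w \<pi>))"
      by (intro graded_scale word_act_symbol m)
    show "graded (int n - e) (e + int n - 1) (\<lambda>\<pi>. ?l * word_act (letters u) m w \<pi> - peval (hom_part n (?s u)) \<pi> * m w \<pi>)"
    proof (cases "length ks = n")
      case True
      then have "hom_part n (?s u) = const ?l * ?p" using hp by (simp add: s hom_part_const homog_def)
      then show ?thesis using W True by (simp add: ks peval_mult peval_const algebra_simps)
    next
      case False
      then have "hom_part n (?s u) = 0" using homog_hom_part_other[OF hp, of n] by (simp add: s hom_part_const)
      moreover have "graded (int n - e) (e + int n - 1)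
         (\<lambda>\<pi>. ?l * (word_act ks m w \<pi> - peval ?p \<pi> * m w \<pi>) + ?l * (peval ?p \<pi> * m w \<pi>))"
        using False len by (intro graded_add graded_mono[OF W] graded_scale graded_hom[OF homfun_mult[OF homfun_peval[OF hp] m]]) auto
      ultimately show ?thesis by (simp add: ks peval.ext_0 algebra_simps)
    qed
  qed
  ultimately show ?thesis by simp
qed

section \<open>Leading symbols and faithfulness of the representation\<close>

definition unitA :: "'n fld" where "unitA = (\<lambda>w \<pi>. if w = mat 1 then 1 else 0)"
text \<open>The constant function 1 in the submodule of functions. Restricted to indices in
  \<open>W\<close> it is the sum of all group elements, a multiple of e, whereas
  \<open>unitA\<close> is the unit of the crossed product.\<close>

definition all1 :: "'n fld" where "all1 = (\<lambda>w \<pi>. 1)"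

lemma translate_unitA: "u \<in> W \<Longrightarrow> translate u unitA = (\<lambda>w \<pi>. if w = u then 1 else 0)"
proof (intro ext)
  fix w \<pi> assume "u \<in> W"
  moreover from this have "matrix_inv u ** w = mat 1 \<longleftrightarrow> w = u"
    by (metis l_inv mul_inv_cancel(1) matrix_mul_rid)
  ultimately show "translate u unitA w \<pi> = (if w = u then 1 else 0)" by (simp add: translate_def unitA_def)
qed

lemma translate_all1 [simp]: "translate u all1 = all1"
  by (simp add: translate_def all1_def)

text \<open>A group element u sends the unit to u, so the leading term at the index \<open>w\<close>
  can come only from \<open>f w\<close>; the other coefficients of \<open>f\<close> contribute terms
  of lower order there.\<close>

lemma crossed_act_symbol:
  assumes f: "deg_lt (Suc n) f" and w: "w \<in> W"
  shows "graded (int n) (int n - 1) (\<lambda>\<pi>. crossed_act f unitA w \<pi> - peval (hom_part n (symmetrize (f w))) \<pi>)"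
proof -
  have "crossed_act f unitA w \<pi> - peval (hom_part n (symmetrize (f w))) \<pi> =
    (\<Sum>u\<in>W. tens_act (f u) (translate u unitA) w \<pi> - peval (hom_part n (symmetrize (f u))) \<pi> * translate u unitA w \<pi>)" for \<pi>
  proof -
    have "(\<Sum>u\<in>W. peval (hom_part n (symmetrize (f u))) \<pi> * translate u unitA w \<pi>) =
      (\<Sum>u\<in>W. if u = w then peval (hom_part n (symmetrize (f u))) \<pi> else 0)"
      by (rule sum.cong) (auto simp: translate_unitA)
    then show ?thesis using w by (simp add: crossed_act_def sum_subtractf)
  qed
  moreover have "graded (int n) (int n - 1) (\<lambda>\<pi>. \<Sum>u\<in>W. tens_act (f u) (translate u unitA) w \<pi> - peval (hom_part n (symmetrize (f u))) \<pi> * translate u unitA w \<pi>)"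
  proof (rule graded_sum)
    fix u assume u: "u \<in> W"
    have "homfun 0 (translate u unitA w)" for w unfolding translate_unitA[OF u] by (rule homfun_const)
    from tens_act_symbol[of 0 "translate u unitA" "f u" n w, OF this]
    show "graded (int n) (int n - 1) (\<lambda>\<pi>. tens_act (f u) (translate u unitA) w \<pi> - peval (hom_part n (symmetrize (f u))) \<pi> * translate u unitA w \<pi>)"
      using f by (force simp: deg_lt_def)
  qed
  ultimately show ?thesis by simp
qed

lemma symbol_zero:
  assumes f: "deg_lt (Suc n) f" and w: "w \<in> W" and L: "graded M (int n - 1) (\<lambda>\<pi>. crossed_act f unitA w \<pi>)"
  shows "hom_part n (symmetrize (f w)) = 0"
proof (rule peval_zero_on_G)
  let ?p = "hom_part n (symmetrize (f w))"
  fix \<pi> assume \<pi>: "\<pi> \<in> G"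
  have "graded (max M (int n)) (int n - 1) (\<lambda>\<pi>. crossed_act f unitA w \<pi> - (crossed_act f unitA w \<pi> - peval ?p \<pi>))"
    by (intro graded_diff graded_mono[OF L] graded_mono[OF crossed_act_symbol[OF f w]]) auto
  then have "graded (max M (int n)) (int n - 1) (peval ?p)" by simp
  then show "peval ?p \<pi> = 0" using graded_hom_zero[OF homfun_peval[OF homog_hom_part] _ _ \<pi>] by simp
qed

lemma deg_lt_sig: "(\<And>w m. m \<in> Poly_Mapping.keys (p w) \<Longrightarrow> mon_deg m < n) \<Longrightarrow> deg_lt n (sig p)"
  unfolding deg_lt_def
proof (intro allI ballI)
  fix w u assume a: "\<And>w m. m \<in> Poly_Mapping.keys (p w) \<Longrightarrow> mon_deg m < n" and u: "u \<in> Poly_Mapping.keys (sigma (p w))"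
  obtain ks where "u = FM ks" by (cases u)
  then show "word_deg u < n" using u a[of "mon ks" w] by (auto simp: in_keys_iff lookup_sigma word_deg_def mon_deg_mon)
qed

lemma keys_lt_dec:
  assumes "\<And>m. m \<in> Poly_Mapping.keys p \<Longrightarrow> mon_deg m < Suc n" "hom_part n p = 0" "m \<in> Poly_Mapping.keys p"
  shows "mon_deg m < n"
proof -
  have "Poly_Mapping.lookup (hom_part n p) m = 0" using assms(2) by simp
  then have "mon_deg m \<noteq> n" using assms(3) by (auto simp: lookup_hom_part in_keys_iff)
  then show ?thesis using assms(1)[OF assms(3)] by simp
qed

text \<open>Leading terms of a normal form cannot cancel. While the degree bound is above d, the top
  component is the leading term of an operator of smaller order, so it vanishes and the bound can be
  lowered.\<close>

lemma sig_degree: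
  assumes p: "p \<in> carrier PW.R"
    and n: "\<And>w m. m \<in> Poly_Mapping.keys (p w) \<Longrightarrow> mon_deg m < n"
    and L: "\<And>w. w \<in> W \<Longrightarrow> graded M (int d - 1) (\<lambda>\<pi>. crossed_act (sig p) unitA w \<pi>)"
    and m: "m \<in> Poly_Mapping.keys (p w)"
  shows "mon_deg m < d"
proof -
  have "\<forall>w. \<forall>m\<in>Poly_Mapping.keys (p w). mon_deg m < d"
    using n
  proof (induction n)
    case (Suc n)
    show ?case
    proof (cases "d \<le> n")
      case True
      have hp: "hom_part n (p w) = 0" for w
      proof (cases "w \<in> W")
        case True
        have "hom_part n (symmetrize (sig p w)) = 0"
          by (rule symbol_zero[OF deg_lt_sig True graded_mono[OF L[OF True]]]) (use Suc.prems \<open>d \<le> n\<close> in auto)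
        then show ?thesis by simp
      qed (use p in \<open>simp add: PW.carrier_R\<close>)
      have "mon_deg m < n" if "m \<in> Poly_Mapping.keys (p w)" for m w
        by (rule keys_lt_dec[OF Suc.prems(1) hp that])
      then show ?thesis by (rule Suc.IH)
    next
      case False
      then have "Suc n \<le> d" by simp
      show ?thesis
      proof (intro allI ballI)
        fix w m assume "m \<in> Poly_Mapping.keys (p w)"
        from Suc.prems[OF this] show "mon_deg m < d" using \<open>Suc n \<le> d\<close> by (rule less_le_trans)
      qed
    qed
  next
    case 0 then show ?case by blast
  qed
  then show ?thesis using m by blast
qed

lemma ex_deg_lt:
  assumes f: "f \<in> carrier TW.R" shows "\<exists>n. deg_lt n f"
proof -
  have "finite (\<Union>w\<in>W. word_deg ` Poly_Mapping.keys (f w))" by simp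
  then obtain n where "\<forall>k\<in>(\<Union>w\<in>W. word_deg ` Poly_Mapping.keys (f w)). k < n"
    using finite_nat_set_iff_bounded by blast
  moreover have "f w = 0" if "w \<notin> W" for w using f that by (simp add: TW.carrier_R)
  ultimately have "deg_lt n f" unfolding deg_lt_def by (metis UN_I empty_iff imageI keys_zero)
  then show ?thesis ..
qed

text \<open>The independence half of the PBW theorem: a normal form that acts by zero is left
  without monomials by \<open>sig_degree\<close> with \<open>d = 0\<close>.\<close>

lemma faithful:
  assumes f: "f \<in> carrier TW.R" and 0: "\<And>w \<pi>. w \<in> W \<Longrightarrow> \<pi> \<in> G \<Longrightarrow> crossed_act f unitA w \<pi> = 0"
  shows "f \<in> I"
proof -
  obtain n where n: "deg_lt n f" using ex_deg_lt[OF f] ..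
  from normal_form[OF f n] obtain p where p: "p \<in> carrier PW.R" "\<And>w m. m \<in> Poly_Mapping.keys (p w) \<Longrightarrow> mon_deg m < n"
    "f - sig p \<in> I" by blast
  have z: "crossed_act (sig p) unitA w \<pi> = 0" if "w \<in> W" "\<pi> \<in> G" for w \<pi>
    using zeroG_I[OF p(3), of unitA] 0[OF that] that unfolding zeroG_def crossed_act_diff_left by simp
  have L: "graded 0 (int 0 - 1) (\<lambda>\<pi>. crossed_act (sig p) unitA w \<pi>)" if "w \<in> W" for w
    using graded_cong[of "\<lambda>\<pi>. crossed_act (sig p) unitA w \<pi>" "\<lambda>\<pi>. 0"] z[OF that] by simp
  have "m \<notin> Poly_Mapping.keys (p w)" for m w
  proof
    assume m: "m \<in> Poly_Mapping.keys (p w)"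
    have "mon_deg m < 0"
    proof (rule sig_degree[of p n 0 0 m w])
      show "\<And>w m. m \<in> Poly_Mapping.keys (p w) \<Longrightarrow> mon_deg m < n" by (rule p(2))
    qed (use p(1) L m in auto)
    then show False by simp
  qed
  then have "Poly_Mapping.keys (p w) = {}" for w by blast
  then have "p w = 0" for w by simp
  then have "sig p = 0" by (simp add: fun_eq_iff sigma.ext_0)
  then show ?thesis using p(3) by simp
qed

text \<open>Elements of the ideal act by zero, so they have no leading term. Consequently the symbol
  of an element depends only on its class in H.\<close>

lemma symbol_I:
  assumes "f \<in> I" "deg_lt (Suc n) f" shows "hom_part n (symmetrize (f w)) = 0"
proof (cases "w \<in> W")
  case True
  have "graded 0 (int n - 1) (\<lambda>\<pi>. crossed_act f unitA w \<pi>)"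
    using graded_cong[of "\<lambda>\<pi>. crossed_act f unitA w \<pi>" "\<lambda>\<pi>. 0"] zeroG_I[OF assms(1), of unitA] by (simp add: zeroG_def)
  then show ?thesis by (rule symbol_zero[OF assms(2) True])
next
  case False
  then have "f w = 0" using I_carrier[OF assms(1)] by (simp add: TW.carrier_R)
  then show ?thesis by (simp add: symmetrize.ext_0)
qed

definition graded_below :: "int \<Rightarrow> ('n hhd \<Rightarrow> complex) \<Rightarrow> bool" where
  "graded_below d \<phi> \<longleftrightarrow> (\<exists>M. graded M d \<phi>)"

lemma graded_below_diff: "graded_below d \<phi> \<Longrightarrow> graded_below d \<psi> \<Longrightarrow> graded_below d (\<lambda>\<pi>. \<phi> \<pi> - \<psi> \<pi>)"
  unfolding graded_below_def by (metis graded_diff graded_mono max.cobounded1 max.cobounded2 order_refl)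
lemma graded_below_add: "graded_below d \<phi> \<Longrightarrow> graded_below d \<psi> \<Longrightarrow> graded_below d (\<lambda>\<pi>. \<phi> \<pi> + \<psi> \<pi>)"
  unfolding graded_below_def by (metis graded_add graded_mono max.cobounded1 max.cobounded2 order_refl)
lemma graded_below_sum: "(\<And>i. i \<in> A \<Longrightarrow> graded_below d (f i)) \<Longrightarrow> graded_below d (\<lambda>\<pi>. \<Sum>i\<in>A. f i \<pi>)"
  by (induction A rule: infinite_finite_induct) (auto intro: graded_below_add simp: graded_below_def[of _ "\<lambda>\<pi>. 0"])
lemma graded_below_mono: "graded_below d \<phi> \<Longrightarrow> d \<le> d' \<Longrightarrow> graded_below d' \<phi>"
  unfolding graded_below_def by (metis graded_mono order_refl)
lemma graded_below_hom: "homfun k \<phi> \<Longrightarrow> k \<le> d \<Longrightarrow> graded_below d \<phi>"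
  unfolding graded_below_def using graded_hom[of k \<phi> "-k" d] by auto
lemma graded_below_mult: "graded_below d \<phi> \<Longrightarrow> graded_below d' \<psi> \<Longrightarrow> graded_below (d + d') (\<lambda>\<pi>. \<phi> \<pi> * \<psi> \<pi>)"
  unfolding graded_below_def using graded_mult by blast
lemma graded_below_point_act: "u \<in> W \<Longrightarrow> graded_below d \<phi> \<Longrightarrow> graded_below d (\<lambda>\<pi>. \<phi> (point_act u \<pi>))"
  unfolding graded_below_def using graded_point_act by blast
lemma graded_below_hom_zero: "homfun k \<phi> \<Longrightarrow> graded_below d \<phi> \<Longrightarrow> d < k \<Longrightarrow> \<pi> \<in> G \<Longrightarrow> \<phi> \<pi> = 0"
  unfolding graded_below_def using graded_hom_zero by blast
lemma graded_below_cong: "(\<And>\<pi>. \<pi> \<in> G \<Longrightarrow> \<phi> \<pi> = \<psi> \<pi>) \<Longrightarrow> graded_below d \<phi> \<longleftrightarrow> graded_below d \<psi>"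
  unfolding graded_below_def using graded_cong by blast

lemma sigma_symbol:
  assumes "\<And>m. m \<in> Poly_Mapping.keys r \<Longrightarrow> mon_deg m \<le> n"
  shows "graded_below (int n - 1) (\<lambda>\<pi>. tens_act (sigma r) all1 w \<pi> - peval (hom_part n r) \<pi>)"
proof -
  have "deg_lt (Suc n) (sig (\<lambda>w. r))" by (rule deg_lt_sig) (use assms in \<open>force simp: less_Suc_eq_le\<close>)
  then have "word_deg u \<le> n" if "u \<in> Poly_Mapping.keys (sigma r)" for u
    using that by (simp add: deg_lt_def less_Suc_eq_le)
  from tens_act_symbol[of 0 all1 "sigma r" n w, OF _ this]
  show ?thesis by (auto simp: graded_below_def all1_def)
qed

text \<open>The leading term of the function \<sigma>(r) 1 is the top component of r. As the degree
  bound on r is lowered, components above degree k must vanish, and a component in degree k must be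
  \<psi>; if only smaller degrees are left, then \<psi> is 0.\<close>

lemma sigma_top:
  assumes "homfun k \<psi>" "graded_below (k - 1) (\<lambda>\<pi>. tens_act (sigma r) all1 w \<pi> - \<psi> \<pi>)" "\<pi> \<in> G"
  shows "\<psi> \<pi> = peval (if k < 0 then 0 else hom_part (nat k) r) \<pi>"
proof -
  have "\<psi> \<pi> = peval (if k < 0 then 0 else hom_part (nat k) r) \<pi>"
    if "\<forall>m\<in>Poly_Mapping.keys r. mon_deg m < N" for N
    using that
  proof (induction N)
    case 0
    then have "Poly_Mapping.keys r = {}" by auto
    then have "r = 0" by simp
    have "graded_below (k - 1) (\<lambda>\<pi>. - \<psi> \<pi>)" using assms(2) by (simp add: \<open>r = 0\<close> sigma.ext_0 tens_act.ext_0)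
    moreover have "homfun k (\<lambda>\<pi>. - \<psi> \<pi>)" using homfun_scale[OF assms(1), of "-1"] by simp
    ultimately have "- \<psi> \<pi> = 0" using graded_below_hom_zero[of k "\<lambda>\<pi>. - \<psi> \<pi>" "k - 1" \<pi>] assms(3) by simp
    then show ?case by (simp add: \<open>r = 0\<close> peval.ext_0)
  next
    case (Suc N)
    let ?X = "tens_act (sigma r) all1 w"
    have X: "graded_below (int N - 1) (\<lambda>\<pi>. ?X \<pi> - peval (hom_part N r) \<pi>)"
      by (rule sigma_symbol) (use Suc.prems in \<open>auto simp: less_Suc_eq_le\<close>)
    consider "int N > k" | "int N = k" | "int N < k" by linarith
    then show ?case
    proof cases
      case 1
      have "graded_below (int N - 1) (\<lambda>\<pi>. (?X \<pi> - \<psi> \<pi>) + \<psi> \<pi> - (?X \<pi> - peval (hom_part N r) \<pi>))"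
        using 1 by (intro graded_below_diff graded_below_add X graded_below_mono[OF assms(2)] graded_below_hom[OF assms(1)]) auto
      then have "graded_below (int N - 1) (peval (hom_part N r))" by simp
      then have "hom_part N r = 0"
        by (intro peval_zero_on_G graded_below_hom_zero[OF homfun_peval[OF homog_hom_part]]) auto
      then have "\<forall>m\<in>Poly_Mapping.keys r. mon_deg m < N"
        using keys_lt_dec[where p = r and n = N] Suc.prems by blast
      then show ?thesis by (rule Suc.IH)
    next
      case 2
      have "graded_below (k - 1) (\<lambda>\<pi>. (?X \<pi> - peval (hom_part N r) \<pi>) - (?X \<pi> - \<psi> \<pi>))"
        by (rule graded_below_diff) (use 2 X assms(2) in auto)
      then have "graded_below (k - 1) (\<lambda>\<pi>. \<psi> \<pi> - peval (hom_part N r) \<pi>)" by simp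
      moreover have "homfun k (\<lambda>\<pi>. \<psi> \<pi> - peval (hom_part N r) \<pi>)"
        using 2 by (intro homfun_diff[OF assms(1)]) (metis homfun_peval[OF homog_hom_part])
      ultimately have "\<psi> \<pi> - peval (hom_part N r) \<pi> = 0"
        using graded_below_hom_zero[of k "\<lambda>\<pi>. \<psi> \<pi> - peval (hom_part N r) \<pi>" "k - 1" \<pi>] assms(3) by simp
      then show ?thesis using 2 by auto
    next
      case 3
      have "graded_below (k - 1) (\<lambda>\<pi>. (?X \<pi> - peval (hom_part N r) \<pi>) + peval (hom_part N r) \<pi> - (?X \<pi> - \<psi> \<pi>))"
        by (rule graded_below_diff[OF graded_below_add[OF graded_below_mono[OF X] graded_below_hom[OF homfun_peval[OF homog_hom_part]]] assms(2)]) (use 3 in auto)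
      then have "graded_below (k - 1) \<psi>" by simp
      then have "\<psi> \<pi> = 0" using graded_below_hom_zero[OF assms(1)] assms(3) by simp
      moreover have "hom_part (nat k) r = 0"
        by (rule poly_mapping_eqI) (use Suc.prems 3 in \<open>force simp: lookup_hom_part in_keys_iff\<close>)
      ultimately show ?thesis by (simp add: peval.ext_0)
    qed
  qed
  then show ?thesis using ex_deg_bound[of r] by blast
qed

text \<open>The product in the crossed product of functions with \<open>W\<close>. The algebra acts
  by left multiplication, so its action commutes with right multiplication by a field and is
  determined by the values on the unit, see \<open>crossed_act_st\<close>.\<close>

definition star :: "'n fld \<Rightarrow> 'n fld \<Rightarrow> 'n fld" where
  "star b m = (\<lambda>w \<pi>. \<Sum>u\<in>W. b u \<pi> * translate u m w \<pi>)"

lemma star_add: "star (b + b') m = star b m + star b' m"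
  and star_diff: "star (b - b') m = star b m - star b' m"
  and star_fld_scale: "star (fld_scale a b) m = fld_scale a (star b m)"
  and star_0: "star 0 m = 0"
  by (auto simp: star_def fld_scale_def fun_eq_iff distrib_right left_diff_distrib sum.distrib sum_subtractf sum_distrib_left mult.assoc)

lemma star_translate: "s \<in> W \<Longrightarrow> translate s (star b m) = star (translate s b) m"
proof (intro ext)
  fix w \<pi> assume s: "s \<in> W"
  have "translate s (star b m) w \<pi> = (\<Sum>u\<in>W. b u (point_act (matrix_inv s) \<pi>) * translate (s ** u) m w \<pi>)"
  proof -
    have "translate u m (matrix_inv s ** w) (point_act (matrix_inv s) \<pi>) = translate (s ** u) m w \<pi>" if "u \<in> W" for u
      using translate_translate[OF s that, of m] by (simp add: translate_def[of s] fun_eq_iff)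
    then show ?thesis by (simp add: translate_def[of s] star_def)
  qed
  also have "\<dots> = (\<Sum>u\<in>W. translate s b u \<pi> * translate u m w \<pi>)"
    by (subst (2) sum_left_translate[OF s]) (use s in \<open>simp add: translate_def[of s b]\<close>)
  finally show "translate s (star b m) w \<pi> = star (translate s b) m w \<pi>" by (simp add: star_def)
qed

lemma star_dunkl: "dunkl v (star b m) = star (dunkl v b) m"
proof (intro ext)
  fix w \<pi>
  have "(\<Sum>s\<in>S. dunkl_coeff s v \<pi> * translate s (star b m) w \<pi>) = (\<Sum>s\<in>S. \<Sum>u\<in>W. dunkl_coeff s v \<pi> * translate s b u \<pi> * translate u m w \<pi>)"
    by (intro sum.cong refl) (simp only: star_translate[OF S_W], simp only: star_def sum_distrib_left mult.assoc)
  also have "\<dots> = (\<Sum>u\<in>W. (\<Sum>s\<in>S. dunkl_coeff s v \<pi> * translate s b u \<pi>) * translate u m w \<pi>)"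
    by (subst sum.swap) (simp add: sum_distrib_right)
  finally show "dunkl v (star b m) w \<pi> = star (dunkl v b) m w \<pi>"
    by (simp add: dunkl_def star_def distrib_right sum.distrib sum_distrib_left mult.assoc)
qed

lemma star_tens_act: "tens_act p (star b m) = star (tens_act p b) m"
proof -
  have "word_act ks (star b m) = star (word_act ks b) m" for ks
    by (induction ks) (simp_all only: word_act_simps star_dunkl)
  moreover have "star (\<Sum>i\<in>A. f i) m = (\<Sum>i\<in>A. star (f i) m)" for A :: "('n + 'n) free_monoid set" and f
    by (rule additive_sum[of "\<lambda>b. star b m"]) (rule star_add star_0)+
  ultimately show ?thesis by (simp only: tens_act_def star_fld_scale)
qed

lemma star_crossed_act: "crossed_act f (star b m) = star (crossed_act f b) m"
proof -
  have "star (\<Sum>i\<in>W. g i) m = (\<Sum>i\<in>W. star (g i) m)" for g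
    by (rule additive_sum[of "\<lambda>b. star b m"]) (rule star_add star_0)+
  then show ?thesis unfolding crossed_act_def by (auto simp: star_translate star_tens_act intro!: sum.cong)
qed

lemma star_unitA: "star unitA m = m"
proof (intro ext)
  fix w \<pi>
  have "star unitA m w \<pi> = (\<Sum>u\<in>W. if u = mat 1 then m w \<pi> else 0)"
    unfolding star_def by (rule sum.cong) (auto simp: unitA_def)
  then show "star unitA m w \<pi> = m w \<pi>" by simp
qed

lemma crossed_act_st: "crossed_act f m = star (crossed_act f unitA) m"
  using star_crossed_act[of f unitA m] by (simp add: star_unitA)

end

section \<open>The Satake isomorphism\<close>

context reflection_data begin

lemma word_act_indep: "(\<And>w w'. m w = m w') \<Longrightarrow> word_act ks m w = word_act ks m w'"
proof (induction ks arbitrary: w w')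
  case (Cons k ks)
  define A where "A = word_act ks m w"
  have "word_act ks m v = A" for v unfolding A_def by (rule Cons.IH[OF Cons.prems])
  then show ?case by (simp add: dunkl_def translate_def)
qed simp

lemma tens_act_all1_indep: "tens_act p all1 w \<pi> = tens_act p all1 (mat 1) \<pi>"
  using word_act_indep[of all1 _ w "mat 1"] by (simp add: tens_act_def fld_scale_def all1_def)

lemma sum_image_all1:
  assumes f: "f \<in> carrier TW.R"
  shows "\<exists>r. zeroG (crossed_act f all1 - tens_act (sigma r) all1)"
proof -
  obtain n where "deg_lt n f" using ex_deg_lt[OF f] ..
  from normal_form[OF f this] obtain p where p: "f - sig p \<in> I" by blast
  have "crossed_act (sig p) all1 = tens_act (sigma (\<Sum>w\<in>W. p w)) all1"
    by (simp add: crossed_act_def sigma.ext_sum tens_act.ext_sum)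
  then show ?thesis using zeroG_I[OF p, of all1] by (auto simp: crossed_act_diff_left)
qed

lemma G_D:
  assumes "\<pi> \<in> G" "u \<in> W" "w \<in> W" "u \<noteq> w"
  shows "veval (W_act u (vy, 0) - W_act w (vy, 0)) \<pi> \<noteq> 0" "veval (W_act u (0, vx) - W_act w (0, vx)) \<pi> \<noteq> 0"
  using assms unfolding G_def by simp_all

text \<open>Replacing q by q v multiplies the summand of w by w v, while u v is the same for all w
  and comes out of the sum. The difference inserts the factor w v - u v into every summand and keeps
  the sum polynomial.\<close>

lemma lagrange:
  assumes A: "\<And>q. \<exists>r. \<forall>\<pi>\<in>G. (\<Sum>w\<in>W. \<psi> w \<pi> * peval (sym_map (W_act w) q) \<pi>) = peval r \<pi>"
    and "finite U"
  shows "\<exists>r. \<forall>\<pi>\<in>G. (\<Sum>w\<in>W. \<psi> w \<pi> * peval (sym_map (W_act w) q) \<pi> *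
           (\<Prod>u\<in>U. veval (W_act w v - W_act u v) \<pi>)) = peval r \<pi>"
  using assms(2)
proof (induction U arbitrary: q rule: finite_induct)
  case empty
  then show ?case using A by simp
next
  case (insert u U)
  let ?P = "\<lambda>w \<pi>. \<Prod>u\<in>U. veval (W_act w v - W_act u v) \<pi>"
  obtain r1 where r1: "\<forall>\<pi>\<in>G. (\<Sum>w\<in>W. \<psi> w \<pi> * peval (sym_map (W_act w) (q * sym_vec v)) \<pi> * ?P w \<pi>) = peval r1 \<pi>"
    using insert.IH by blast
  obtain r2 where r2: "\<forall>\<pi>\<in>G. (\<Sum>w\<in>W. \<psi> w \<pi> * peval (sym_map (W_act w) q) \<pi> * ?P w \<pi>) = peval r2 \<pi>"
    using insert.IH by blast
  have "(\<Sum>w\<in>W. \<psi> w \<pi> * peval (sym_map (W_act w) q) \<pi> * (\<Prod>u\<in>insert u U. veval (W_act w v - W_act u v) \<pi>)) =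
     peval (r1 - r2 * sym_vec (W_act u v)) \<pi>" if \<pi>: "\<pi> \<in> G" for \<pi>
  proof -
    have "\<psi> w \<pi> * peval (sym_map (W_act w) q) \<pi> * (\<Prod>u\<in>insert u U. veval (W_act w v - W_act u v) \<pi>) =
      \<psi> w \<pi> * peval (sym_map (W_act w) (q * sym_vec v)) \<pi> * ?P w \<pi> -
      \<psi> w \<pi> * peval (sym_map (W_act w) q) \<pi> * ?P w \<pi> * veval (W_act u v) \<pi>" for w
      using insert.hyps
      by (simp add: sym_map_mult sym_map_vec peval_mult peval_sym_vec veval_diff algebra_simps)
    then show ?thesis using r1 r2 \<pi>
      by (simp add: sum_subtractf sum_distrib_right[symmetric] peval.ext_diff peval_mult peval_sym_vec)
  qed
  then show ?case by blast
qed

text \<open>With the factors of all nodes other than \<open>x\<close> inserted, every summand except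
  that of \<open>x\<close> contains a zero factor.\<close>

lemma lagrange_isolate:
  assumes A: "\<And>q. \<exists>r. \<forall>\<pi>\<in>G. (\<Sum>w\<in>W. \<psi> w \<pi> * peval (sym_map (W_act w) q) \<pi>) = peval r \<pi>"
    and x: "x \<in> W"
  shows "\<exists>r. \<forall>\<pi>\<in>G. \<psi> x \<pi> * (\<Prod>u\<in>W - {x}. veval (W_act x v - W_act u v) \<pi>) = peval r \<pi>"
proof -
  obtain r where r: "\<forall>\<pi>\<in>G. (\<Sum>w\<in>W. \<psi> w \<pi> * peval (sym_map (W_act w) 1) \<pi> *
           (\<Prod>u\<in>W - {x}. veval (W_act w v - W_act u v) \<pi>)) = peval r \<pi>"
    using lagrange[OF A, of "W - {x}" 1 v] by auto
  have "(\<Prod>u\<in>W - {x}. veval (W_act w v - W_act u v) \<pi>) = 0" if "w \<in> W" "w \<noteq> x" for w \<pi>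
    using that by (intro prod_zero) (auto intro!: bexI[of _ w])
  then have "(\<Sum>w\<in>W. \<psi> w \<pi> * peval (sym_map (W_act w) 1) \<pi> * (\<Prod>u\<in>W - {x}. veval (W_act w v - W_act u v) \<pi>)) =
      (\<Sum>w\<in>W. if w = x then \<psi> x \<pi> * (\<Prod>u\<in>W - {x}. veval (W_act x v - W_act u v) \<pi>) else 0)" for \<pi>
    by (intro sum.cong) (auto simp: sym_map_1)
  then show ?thesis using r x by (intro exI[of _ r]) simp
qed

text \<open>The two interpolations with nodes in \<open>\<hh>\<close> and in \<open>\<hh>*\<close> have coprime denominators.\<close>

lemma polynomial_coefficient:
  assumes A: "\<And>q. \<exists>r. \<forall>\<pi>\<in>G. (\<Sum>w\<in>W. \<psi> w \<pi> * peval (sym_map (W_act w) q) \<pi>) = peval r \<pi>"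
    and x: "x \<in> W"
  shows "\<exists>Q. \<forall>\<pi>\<in>G. \<psi> x \<pi> = peval Q \<pi>"
proof -
  let ?y = "\<lambda>u. x *v vy - u *v vy" and ?x = "\<lambda>u. vx v* matrix_inv x - vx v* matrix_inv u"
  have y: "W_act x (vy, 0) - W_act u (vy, 0) = (?y u, 0)" and x': "W_act x (0, vx) - W_act u (0, vx) = (0, ?x u)" for u
    by (simp_all add: W_act_apply)
  define P1 where "P1 = (\<Prod>u\<in>W - {x}. sym_vec (?y u, 0 :: complex ^ 'n))"
  define P2 where "P2 = (\<Prod>u\<in>W - {x}. sym_vec (0 :: complex ^ 'n, ?x u))"
  obtain r1 where r1: "\<forall>\<pi>\<in>G. \<psi> x \<pi> * peval P1 \<pi> = peval r1 \<pi>"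
    using lagrange_isolate[OF A x, of "(vy, 0)"] unfolding y P1_def peval_prod peval_sym_vec by blast
  obtain r2 where r2: "\<forall>\<pi>\<in>G. \<psi> x \<pi> * peval P2 \<pi> = peval r2 \<pi>"
    using lagrange_isolate[OF A x, of "(0, vx)"] unfolding x' P2_def peval_prod peval_sym_vec by blast
  \<comment> \<open>Both sides are \<open>\<psi> x\<close> multiplied by the two
    denominators.\<close>
  have "P2 * r1 = P1 * r2"
  proof (rule peval_eq_on_G)
    fix \<pi> assume "\<pi> \<in> G"
    then show "peval (P2 * r1) \<pi> = peval (P1 * r2) \<pi>"
      using r1[rule_format, of \<pi>, symmetric] r2[rule_format, of \<pi>, symmetric] by (simp add: peval_mult)
  qed
  moreover have "?y u \<noteq> 0" "?x u \<noteq> 0" if "u \<in> W - {x}" for u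
    using W_act_vy_vx[of x u] that x by (auto simp: W_act_apply)
  ultimately obtain Q where Q: "r1 = P1 * Q"
    unfolding P1_def P2_def using coprime_prod_prod[of "W - {x}" "W - {x}" ?y ?x r1 r2] by auto
  have "\<psi> x \<pi> = peval Q \<pi>" if \<pi>: "\<pi> \<in> G" for \<pi>
  proof -
    have "veval (?y u, 0) \<pi> \<noteq> 0" if "u \<in> W - {x}" for u
      using G_D(1)[OF \<pi> x, of u] that unfolding y[symmetric] by blast
    then have "peval P1 \<pi> \<noteq> 0" by (simp add: P1_def peval_prod peval_sym_vec)
    moreover have "\<psi> x \<pi> * peval P1 \<pi> = peval Q \<pi> * peval P1 \<pi>" using r1 \<pi> by (simp add: Q peval_mult)
    ultimately show ?thesis by simp
  qed
  then show ?thesis by blast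
qed

text \<open>The components of Q, with \<psi> subtracted in degree k, are homogeneous functions with
  sum zero on \<open>G\<close>, so each of them vanishes.\<close>

lemma homogeneous_polynomial:
  assumes \<psi>: "homfun k \<psi>" and Q: "\<And>\<pi>. \<pi> \<in> G \<Longrightarrow> \<psi> \<pi> = peval Q \<pi>" and \<pi>: "\<pi> \<in> G"
  shows "\<psi> \<pi> = peval (if k < 0 then 0 else hom_part (nat k) Q) \<pi>"
proof -
  obtain N0 where N0: "\<forall>m\<in>Poly_Mapping.keys Q. mon_deg m < N0" using ex_deg_bound by blast
  \<comment> \<open>The bound exceeds k too, so that a nonnegative k lies in the index
    range.\<close>
  define N where "N = max N0 (Suc (nat k))"
  have N: "Q = (\<Sum>d<N. hom_part d Q)" by (rule sum_hom_part) (use N0 in \<open>auto simp: N_def\<close>)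
  define h where "h j \<pi> = (if 0 \<le> j then peval (hom_part (nat j) Q) \<pi> else 0) - (if j = k then \<psi> \<pi> else 0)" for j \<pi>
  have "h k \<pi> = 0"
  proof (rule homfun_independent[of "insert k (int ` {..<N})" h])
    show "homfun j (h j)" for j
    proof -
      have "homfun j (\<lambda>\<pi>. if 0 \<le> j then peval (hom_part (nat j) Q) \<pi> else 0)"
        using homfun_peval[OF homog_hom_part, of "nat j" Q] by (cases "0 \<le> j") auto
      moreover have "homfun j (\<lambda>\<pi>. if j = k then \<psi> \<pi> else 0)" using \<psi> by (cases "j = k") auto
      ultimately show ?thesis unfolding h_def by (rule homfun_diff)
    qed
    show "(\<Sum>j\<in>insert k (int ` {..<N}). h j \<rho>) = 0" if \<rho>: "\<rho> \<in> G" for \<rho>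
    proof -
      let ?K = "insert k (int ` {..<N})"
      have "(\<Sum>j\<in>?K. if 0 \<le> j then peval (hom_part (nat j) Q) \<rho> else 0) =
          (\<Sum>j\<in>int ` {..<N}. if 0 \<le> j then peval (hom_part (nat j) Q) \<rho> else 0)"
      proof (cases "0 \<le> k")
        case True
        then have "k = int (nat k)" "nat k < N" by (auto simp: N_def)
        then have "k \<in> int ` {..<N}" by blast
        then show ?thesis by (simp add: insert_absorb)
      next
        case False
        then have "k \<notin> int ` {..<N}" by auto
        then show ?thesis using False by simp
      qed
      also have "\<dots> = peval Q \<rho>"
        by (subst (2) N) (simp add: sum.reindex peval.ext_sum)
      finally show ?thesis using Q[OF \<rho>] by (simp add: h_def sum_subtractf)
    qed
  qed (use \<pi> in auto)
  then show ?thesis by (auto simp: h_def peval.ext_0)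
qed

text \<open>Left multiplication by \<open>b\<close> maps the module generated by the constant function 1 to itself.\<close>

definition stable :: "'n fld \<Rightarrow> bool" where
  "stable b \<longleftrightarrow> (\<forall>q. \<exists>r. \<forall>\<pi>\<in>G. star b (tens_act (sigma q) all1) (mat 1) \<pi> = tens_act (sigma r) all1 (mat 1) \<pi>)"

text \<open>For q homogeneous of degree e, the field b applied to \<sigma>(q) 1 has the displayed
  sum as its leading term, in degree D + e. By stability the result again has the form \<sigma>(r)
  1, and leading terms of such functions are polynomials by \<open>sigma_top\<close>.\<close>

lemma stable_symbol:
  assumes b: "stable b" and \<psi>: "\<And>w. w \<in> W \<Longrightarrow> homfun D (\<psi> w)"
    and top: "\<And>w. w \<in> W \<Longrightarrow> graded M (D - 1) (\<lambda>\<pi>. b w \<pi> - \<psi> w \<pi>)"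
  shows "\<exists>r. \<forall>\<pi>\<in>G. (\<Sum>w\<in>W. \<psi> w \<pi> * peval (sym_map (W_act w) q) \<pi>) = peval r \<pi>"
proof -
  have homfun: "\<exists>r. \<forall>\<pi>\<in>G. (\<Sum>w\<in>W. \<psi> w \<pi> * peval (sym_map (W_act w) q) \<pi>) = peval r \<pi>" if q: "homog e q" for e q
  proof -
    let ?X = "tens_act (sigma q) all1 (mat 1)"
    let ?T = "\<lambda>\<pi>. \<Sum>w\<in>W. \<psi> w \<pi> * peval q (point_act (matrix_inv w) \<pi>)"
    have X: "graded_below (int e - 1) (\<lambda>\<pi>. ?X \<pi> - peval q \<pi>)"
      using sigma_symbol[of q e "mat 1"] q[unfolded homog_iff] q[unfolded homog_def] by simp
    have X': "graded_below (int e) ?X"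
    proof -
      have "graded_below (int e) (\<lambda>\<pi>. (?X \<pi> - peval q \<pi>) + peval q \<pi>)"
        by (rule graded_below_add[OF graded_below_mono[OF X] graded_below_hom[OF homfun_peval[OF q]]]) auto
      then show ?thesis by simp
    qed
    obtain r where r: "\<forall>\<pi>\<in>G. star b (tens_act (sigma q) all1) (mat 1) \<pi> = tens_act (sigma r) all1 (mat 1) \<pi>"
      using b by (auto simp: stable_def)
    have hT: "homfun (D + int e) ?T"
      by (intro homfun_sum homfun_mult \<psi> homfun_point_act homfun_peval q) auto
    \<comment> \<open>The error has two sources, the lower terms of b and the lower terms of
      \<sigma>(q) 1.\<close>
    have L: "graded_below (D + int e - 1) (\<lambda>\<pi>. \<Sum>w\<in>W. (b w \<pi> - \<psi> w \<pi>) * ?X (point_act (matrix_inv w) \<pi>) +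
        \<psi> w \<pi> * (?X (point_act (matrix_inv w) \<pi>) - peval q (point_act (matrix_inv w) \<pi>)))"
    proof (rule graded_below_sum)
      fix w assume w: "w \<in> W"
      have "graded_below (D - 1 + int e) (\<lambda>\<pi>. (b w \<pi> - \<psi> w \<pi>) * ?X (point_act (matrix_inv w) \<pi>))"
        by (rule graded_below_mult[OF _ graded_below_point_act[OF _ X']]) (use w top[OF w] in \<open>auto simp: graded_below_def\<close>)
      moreover have "graded_below (D + (int e - 1)) (\<lambda>\<pi>. \<psi> w \<pi> * (?X (point_act (matrix_inv w) \<pi>) - peval q (point_act (matrix_inv w) \<pi>)))"
        by (rule graded_below_mult[OF graded_below_hom[OF \<psi>[OF w]] graded_below_point_act[OF _ X]]) (use w in auto)
      ultimately show "graded_below (D + int e - 1) (\<lambda>\<pi>. (b w \<pi> - \<psi> w \<pi>) * ?X (point_act (matrix_inv w) \<pi>) +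
        \<psi> w \<pi> * (?X (point_act (matrix_inv w) \<pi>) - peval q (point_act (matrix_inv w) \<pi>)))"
        by (intro graded_below_add) (simp_all add: algebra_simps)
    qed
    have eq: "(\<Sum>w\<in>W. (b w \<pi> - \<psi> w \<pi>) * ?X (point_act (matrix_inv w) \<pi>) +
        \<psi> w \<pi> * (?X (point_act (matrix_inv w) \<pi>) - peval q (point_act (matrix_inv w) \<pi>))) =
        tens_act (sigma r) all1 (mat 1) \<pi> - ?T \<pi>" if "\<pi> \<in> G" for \<pi>
    proof -
      have "star b (tens_act (sigma q) all1) (mat 1) \<pi> = (\<Sum>w\<in>W. b w \<pi> * ?X (point_act (matrix_inv w) \<pi>))"
        unfolding star_def translate_def
      proof (rule sum.cong[OF refl])
        fix w
        show "b w \<pi> * tens_act (sigma q) all1 (matrix_inv w ** mat 1) (point_act (matrix_inv w) \<pi>) = b w \<pi> * ?X (point_act (matrix_inv w) \<pi>)"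
          using tens_act_all1_indep[of "sigma q" "matrix_inv w ** mat 1" "point_act (matrix_inv w) \<pi>"] by (simp only:)
      qed
      then show ?thesis using r that by (simp add: sum_subtractf[symmetric] algebra_simps)
    qed
    have "graded_below (D + int e - 1) (\<lambda>\<pi>. tens_act (sigma r) all1 (mat 1) \<pi> - ?T \<pi>)"
      by (rule iffD1[OF graded_below_cong[OF eq] L])
    from sigma_top[OF hT this] have "\<exists>r. \<forall>\<pi>\<in>G. ?T \<pi> = peval r \<pi>" by blast
    moreover have "(\<Sum>w\<in>W. \<psi> w \<pi> * peval (sym_map (W_act w) q) \<pi>) = ?T \<pi>" for \<pi>
      by (rule sum.cong) (simp_all add: peval_W_act)
    ultimately show ?thesis by simp
  qed
  obtain N where "\<forall>m\<in>Poly_Mapping.keys q. mon_deg m < N" using ex_deg_bound by blast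
  then have N: "q = (\<Sum>d<N. hom_part d q)" by (intro sum_hom_part) auto
  have "\<forall>d. \<exists>r. \<forall>\<pi>\<in>G. (\<Sum>w\<in>W. \<psi> w \<pi> * peval (sym_map (W_act w) (hom_part d q)) \<pi>) = peval r \<pi>"
    using homfun[OF homog_hom_part] by blast
  from choice[OF this] obtain r
    where r: "\<forall>d. \<forall>\<pi>\<in>G. (\<Sum>w\<in>W. \<psi> w \<pi> * peval (sym_map (W_act w) (hom_part d q)) \<pi>) = peval (r d) \<pi>" ..
  have "(\<Sum>w\<in>W. \<psi> w \<pi> * peval (sym_map (W_act w) q) \<pi>) = peval (\<Sum>d<N. r d) \<pi>" if \<pi>: "\<pi> \<in> G" for \<pi>
  proof -
    have "(\<Sum>w\<in>W. \<psi> w \<pi> * peval (sym_map (W_act w) q) \<pi>) =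
        (\<Sum>w\<in>W. \<Sum>d<N. \<psi> w \<pi> * peval (sym_map (W_act w) (hom_part d q)) \<pi>)"
      by (subst N) (simp add: sym_map.ext_sum peval.ext_sum sum_distrib_left)
    also have "\<dots> = (\<Sum>d<N. \<Sum>w\<in>W. \<psi> w \<pi> * peval (sym_map (W_act w) (hom_part d q)) \<pi>)" by (rule sum.swap)
    also have "\<dots> = peval (\<Sum>d<N. r d) \<pi>" using r \<pi> by (simp add: peval.ext_sum)
    finally show ?thesis .
  qed
  then show ?thesis by blast
qed

text \<open>Here \<open>n\<close> counts the degrees from -M to n - M - 1 that may still occur. A
  top coefficient is a polynomial, hence 0 in negative degree, and otherwise the symbol of an
  element of H that is subtracted. The bound of the top degree by M keeps the poles of that element
  within order M.\<close>

lemma stable_in_image: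
  assumes "\<And>w. w \<in> W \<Longrightarrow> graded (int M) (int n - int M - 1) (b w)" "int n - int M - 1 \<le> int M" "stable b"
  shows "\<exists>f\<in>carrier PW.R. \<forall>w\<in>W. \<forall>\<pi>\<in>G. b w \<pi> = crossed_act (sig f) unitA w \<pi>"
  using assms
proof (induction n arbitrary: b)
  case 0
  have "b w \<pi> = 0" if "w \<in> W" "\<pi> \<in> G" for w \<pi>
    by (rule graded_empty[OF 0(1)[OF that(1)] _ that(2)]) simp
  moreover have "sig 0 = 0" by (rule ext) (simp only: zero_fun_apply sigma.ext_0)
  ultimately show ?case by (intro bexI[of _ 0]) auto
next
  case (Suc n)
  define D where "D = int n - int M"
  have L: "graded (int M) D (b w)" if "w \<in> W" for w using Suc.prems(1)[OF that] by (simp add: D_def)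
  have "\<exists>\<psi>. homfun D \<psi> \<and> graded (int M) (D - 1) (\<lambda>\<pi>. b w \<pi> - \<psi> \<pi>)" if "w \<in> W" for w
    using graded_top[OF L[OF that]] by blast
  then obtain \<psi> where \<psi>: "\<And>w. w \<in> W \<Longrightarrow> homfun D (\<psi> w)"
      "\<And>w. w \<in> W \<Longrightarrow> graded (int M) (D - 1) (\<lambda>\<pi>. b w \<pi> - \<psi> w \<pi>)"
    by metis
  have "\<exists>Q. \<forall>\<pi>\<in>G. \<psi> w \<pi> = peval Q \<pi>" if "w \<in> W" for w
    by (rule polynomial_coefficient[OF stable_symbol[OF Suc.prems(3) \<psi>] that])
  then obtain Q where Q: "\<And>w \<pi>. w \<in> W \<Longrightarrow> \<pi> \<in> G \<Longrightarrow> \<psi> w \<pi> = peval (Q w) \<pi>" by metis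
  define f0 where "f0 w = (if w \<in> W \<and> 0 \<le> D then hom_part (nat D) (Q w) else 0)" for w
  have f0: "f0 \<in> carrier PW.R" by (simp add: PW.carrier_R f0_def)
  have \<psi>f0: "\<psi> w \<pi> = peval (f0 w) \<pi>" if "w \<in> W" "\<pi> \<in> G" for w \<pi>
    using homogeneous_polynomial[OF \<psi>(1)[OF that(1)] Q[OF that(1)] that(2)] that by (simp add: f0_def)
  define b' where "b' = b - crossed_act (sig f0) unitA"
  have b'L: "graded (int M) (int n - int M - 1) (b' w)" if w: "w \<in> W" for w
  proof -
    have "graded (int M) (D - 1) (\<lambda>\<pi>. crossed_act (sig f0) unitA w \<pi> - peval (f0 w) \<pi>)"
    proof (cases "0 \<le> D")
      case True
      have h: "homog (nat D) (f0 w)" for w by (simp add: f0_def)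
      have "deg_lt (Suc (nat D)) (sig f0)" by (rule deg_lt_sig) (use h[unfolded homog_iff] in auto)
      moreover have "hom_part (nat D) (symmetrize (sigma (f0 w))) = f0 w" using h[unfolded homog_def] by simp
      ultimately have "graded D (D - 1) (\<lambda>\<pi>. crossed_act (sig f0) unitA w \<pi> - peval (f0 w) \<pi>)"
        using crossed_act_symbol[of "nat D" "sig f0" w] w True by simp
      then show ?thesis by (rule graded_mono) (use Suc.prems(2) in \<open>auto simp: D_def\<close>)
    next
      case False
      then have "f0 w = 0" for w by (simp add: f0_def)
      then have "sig f0 = 0" by (intro ext) (simp only: zero_fun_apply sigma.ext_0)
      then show ?thesis using \<open>f0 w = 0\<close> by (simp add: peval.ext_0)
    qed
    then have L': "graded (int M) (D - 1) (\<lambda>\<pi>. (b w \<pi> - \<psi> w \<pi>) - (crossed_act (sig f0) unitA w \<pi> - peval (f0 w) \<pi>))"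
      by (rule graded_diff[OF \<psi>(2)[OF w]])
    have eq: "(b w \<pi> - \<psi> w \<pi>) - (crossed_act (sig f0) unitA w \<pi> - peval (f0 w) \<pi>) = b' w \<pi>" if "\<pi> \<in> G" for \<pi>
      using \<psi>f0[OF w that] by (simp add: b'_def)
    show ?thesis using iffD1[OF graded_cong[OF eq] L'] by (simp add: D_def)
  qed
  \<comment> \<open>Elements of H preserve the module generated by 1, so stability survives the
    subtraction.\<close>
  have stb': "stable b'" unfolding stable_def
  proof
    fix q
    obtain r where r: "\<forall>\<pi>\<in>G. star b (tens_act (sigma q) all1) (mat 1) \<pi> = tens_act (sigma r) all1 (mat 1) \<pi>"
      using Suc.prems(3) by (auto simp: stable_def)
    have "sig f0 \<otimes>\<^bsub>TW.R\<^esub> TW.mono (mat 1) (sigma q) \<in> carrier TW.R" using f0 by simp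
    then obtain r0 where r0: "zeroG (crossed_act (sig f0 \<otimes>\<^bsub>TW.R\<^esub> TW.mono (mat 1) (sigma q)) all1 - tens_act (sigma r0) all1)"
      using sum_image_all1 by blast
    have "crossed_act (sig f0 \<otimes>\<^bsub>TW.R\<^esub> TW.mono (mat 1) (sigma q)) all1 = star (crossed_act (sig f0) unitA) (tens_act (sigma q) all1)"
      using f0 by (simp add: crossed_act_mult crossed_act_mono crossed_act_st[symmetric])
    then have "star b' (tens_act (sigma q) all1) (mat 1) \<pi> = tens_act (sigma (r - r0)) all1 (mat 1) \<pi>" if "\<pi> \<in> G" for \<pi>
      using r r0 that by (simp add: b'_def star_diff zeroG_def sigma.ext_diff tens_act.ext_diff)
    then show "\<exists>r. \<forall>\<pi>\<in>G. star b' (tens_act (sigma q) all1) (mat 1) \<pi> = tens_act (sigma r) all1 (mat 1) \<pi>" by blast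
  qed
  have "\<exists>f\<in>carrier PW.R. \<forall>w\<in>W. \<forall>\<pi>\<in>G. b' w \<pi> = crossed_act (sig f) unitA w \<pi>"
    by (rule Suc.IH[of b']) (use b'L stb' Suc.prems(2) in auto)
  then obtain f1 where f1: "f1 \<in> carrier PW.R" "\<forall>w\<in>W. \<forall>\<pi>\<in>G. b' w \<pi> = crossed_act (sig f1) unitA w \<pi>"
    by blast
  have "sig (f0 + f1) = sig f0 + sig f1" by (rule ext) (simp only: plus_fun_apply sigma.ext_add)
  then have "\<forall>w\<in>W. \<forall>\<pi>\<in>G. b w \<pi> = crossed_act (sig (f0 + f1)) unitA w \<pi>"
    using f1(2) by (simp only: crossed_act_add_left) (simp add: b'_def algebra_simps)
  then show ?case using f0 f1(1) by (intro bexI[of _ "f0 + f1"]) auto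
qed

section \<open>Multiplication by invariant functions and lifts of invariant polynomials\<close>

definition mulf :: "('n hhd \<Rightarrow> complex) \<Rightarrow> 'n fld \<Rightarrow> 'n fld" where
  "mulf \<phi> m = (\<lambda>w \<pi>. \<phi> \<pi> * m w \<pi>)"

lemma mulf_add: "mulf \<phi> (m + m') = mulf \<phi> m + mulf \<phi> m'"
  and mulf_scf: "mulf \<phi> (fld_scale a m) = fld_scale a (mulf \<phi> m)"
  and mulf_0: "mulf \<phi> 0 = 0"
  by (auto simp: mulf_def fld_scale_def fun_eq_iff algebra_simps)

lemma mulf_sum: "mulf \<phi> (\<Sum>i\<in>A. f i) = (\<Sum>i\<in>A. mulf \<phi> (f i))"
  by (rule additive_sum[of "mulf \<phi>"]) (rule mulf_add mulf_0)+

context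
  fixes \<phi> :: "'n hhd \<Rightarrow> complex"
  assumes invariant: "\<And>u \<pi>. u \<in> W \<Longrightarrow> \<phi> (point_act u \<pi>) = \<phi> \<pi>"
begin

lemma mulf_translate: "u \<in> W \<Longrightarrow> translate u (mulf \<phi> m) = mulf \<phi> (translate u m)"
  by (simp add: translate_def mulf_def invariant)

text \<open>The operators involve only multiplications and reflections, and both commute with
  multiplication by an invariant function.\<close>

lemma mulf_dunkl: "dunkl v (mulf \<phi> m) = mulf \<phi> (dunkl v m)"
proof (intro ext)
  fix w \<pi>
  have "(\<Sum>s\<in>S. dunkl_coeff s v \<pi> * translate s (mulf \<phi> m) w \<pi>) = (\<Sum>s\<in>S. \<phi> \<pi> * (dunkl_coeff s v \<pi> * translate s m w \<pi>))"
    by (intro sum.cong refl) (simp add: mulf_translate, simp add: mulf_def)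
  then show "dunkl v (mulf \<phi> m) w \<pi> = mulf \<phi> (dunkl v m) w \<pi>"
    unfolding dunkl_def by (simp add: mulf_def sum_distrib_left distrib_left)
qed

lemma mulf_tens_act: "tens_act p (mulf \<phi> m) = mulf \<phi> (tens_act p m)"
proof -
  have "word_act ks (mulf \<phi> m) = mulf \<phi> (word_act ks m)" for ks
    by (induction ks) (simp_all only: word_act_simps mulf_dunkl)
  then show ?thesis by (simp only: tens_act_def mulf_sum mulf_scf)
qed

lemma mulf_crossed_act: "crossed_act f (mulf \<phi> m) = mulf \<phi> (crossed_act f m)"
  unfolding crossed_act_def mulf_sum by (intro sum.cong refl) (simp only: mulf_translate mulf_tens_act)

end

text \<open>Fields are indexed by all matrices; this confines the action on the unit to indices in
  \<open>W\<close>.\<close>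

lemma crossed_act_support: "w \<notin> W \<Longrightarrow> crossed_act f unitA w \<pi> = 0"
proof -
  define sup where "sup m \<longleftrightarrow> (\<forall>w \<pi>. w \<notin> W \<longrightarrow> m w \<pi> = 0)" for m :: "'n fld"
  have translate: "sup (translate u m)" if "sup m" "u \<in> W" for u m
    using that by (simp add: sup_def translate_def inv_mult_in_W)
  have D: "sup (dunkl v m)" if "sup m" for v m
    using translate[OF that] that by (simp add: sup_def dunkl_def)
  have "sup (word_act ks m)" if "sup m" for ks m
    using that by (induction ks) (simp_all only: word_act_simps D)
  then have t: "sup (tens_act p m)" if "sup m" for p m using that by (simp add: sup_def tens_act_def fld_scale_def)
  have "sup unitA" by (auto simp: sup_def unitA_def)
  then have "sup (crossed_act f unitA)" using t[OF translate] by (simp add: crossed_act_def sup_def)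
  then show "w \<notin> W \<Longrightarrow> crossed_act f unitA w \<pi> = 0" by (simp add: sup_def)
qed

definition central :: "('n cmat \<Rightarrow> 'n tens) \<Rightarrow> bool" where
  "central z \<longleftrightarrow> z \<in> carrier TW.R \<and> (\<forall>a\<in>carrier TW.R. z \<otimes>\<^bsub>TW.R\<^esub> a - a \<otimes>\<^bsub>TW.R\<^esub> z \<in> I)"

text \<open>Central elements correspond to elements of e H e, and this constructs the one over
  \<sigma>(p) e. Multiplication by \<phi> takes \<sigma>(q) 1 to \<sigma>(q) \<phi> = \<sigma>(q)
  \<sigma>(p) 1, which makes it stable; that the element obtained is central is checked in the
  faithful representation.\<close>

lemma satake:
  assumes p: "homog d p" and inv: "\<And>w. w \<in> W \<Longrightarrow> sym_map (W_act w) p = p"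
  shows "\<exists>f\<in>carrier PW.R. (\<forall>w. \<forall>m\<in>Poly_Mapping.keys (f w). mon_deg m < Suc d) \<and>
     (\<forall>w. hom_part d (f w) = (if w = mat 1 then p else 0)) \<and> central (sig f) \<and>
     (\<forall>\<pi>\<in>G. crossed_act (sig f) all1 (mat 1) \<pi> = tens_act (sigma p) all1 (mat 1) \<pi>)"
proof -
  define \<phi> where "\<phi> = tens_act (sigma p) all1 (mat 1)"
  have \<phi>: "\<phi> (point_act u \<pi>) = \<phi> \<pi>" if u: "u \<in> W" for u \<pi>
  proof -
    have "translate (matrix_inv u) (tens_act (sigma p) all1) = tens_act (sigma p) all1"
      using u by (simp add: translate_tens_act tens_map_sigma inv)
    then have "translate (matrix_inv u) (tens_act (sigma p) all1) (mat 1) \<pi> = \<phi> \<pi>" by (simp add: \<phi>_def)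
    then show ?thesis using u tens_act_all1_indep[of "sigma p" u] by (simp add: translate_def \<phi>_def)
  qed
  have all1\<phi>: "mulf \<phi> all1 = tens_act (sigma p) all1"
  proof (intro ext)
    fix w \<pi>
    show "mulf \<phi> all1 w \<pi> = tens_act (sigma p) all1 w \<pi>"
      unfolding \<phi>_def tens_act_all1_indep[of "sigma p" w \<pi>] by (simp add: mulf_def all1_def)
  qed
  define b :: "'n fld" where "b = mulf \<phi> unitA"
  have "deg_lt (Suc d) (sig (\<lambda>w. p))" by (rule deg_lt_sig) (use p in \<open>simp add: homog_iff\<close>)
  then have deg: "word_deg u \<le> d" if "u \<in> Poly_Mapping.keys (sigma p)" for u
    using that by (simp add: deg_lt_def less_Suc_eq_le)
  have sym: "graded (int d) (int d - 1) (\<lambda>\<pi>. \<phi> \<pi> - peval p \<pi>)"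
    using tens_act_symbol[of 0 all1 "sigma p" d "mat 1", OF _ deg] p by (simp add: all1_def \<phi>_def homog_def)
  have graded\<phi>: "graded (int d) (int d) \<phi>"
  proof -
    have "graded (int d) (int d) (\<lambda>\<pi>. (\<phi> \<pi> - peval p \<pi>) + peval p \<pi>)"
      by (rule graded_add[OF graded_mono[OF sym] graded_hom[OF homfun_peval[OF p]]]) auto
    then show ?thesis by simp
  qed
  have bw: "b w = (if w = mat 1 then \<phi> else (\<lambda>\<pi>. 0))" for w by (auto simp: b_def mulf_def unitA_def)
  have bL: "graded (int d) (int d) (b w)" for w using graded\<phi> by (simp add: bw)
  have stb: "star b m = mulf \<phi> m" for m
  proof -
    have "star b m w \<pi> = (\<Sum>u\<in>W. if u = mat 1 then \<phi> \<pi> * m w \<pi> else 0)" for w \<pi>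
      unfolding star_def by (rule sum.cong) (auto simp: bw)
    then show ?thesis by (simp add: mulf_def fun_eq_iff)
  qed
  have "stable b" unfolding stable_def
  proof
    fix q
    have "TW.mono (mat 1) (sigma q * sigma p) \<in> carrier TW.R" by simp
    then obtain r where "zeroG (crossed_act (TW.mono (mat 1) (sigma q * sigma p)) all1 - tens_act (sigma r) all1)"
      using sum_image_all1 by blast
    moreover have "crossed_act (TW.mono (mat 1) (sigma q * sigma p)) all1 = star b (tens_act (sigma q) all1)"
      by (simp add: crossed_act_mono tens_act_mult stb mulf_tens_act[OF \<phi>, symmetric] all1\<phi>)
    ultimately show "\<exists>r. \<forall>\<pi>\<in>G. star b (tens_act (sigma q) all1) (mat 1) \<pi> = tens_act (sigma r) all1 (mat 1) \<pi>"
      by (auto simp: zeroG_def)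
  qed
  \<comment> \<open>There are \<open>2 * d + 1\<close> degrees from -d to d.\<close>
  then obtain f where f: "f \<in> carrier PW.R" "\<forall>w\<in>W. \<forall>\<pi>\<in>G. b w \<pi> = crossed_act (sig f) unitA w \<pi>"
    using stable_in_image[of d "2 * d + 1" b] bL by auto
  have z: "sig f \<in> carrier TW.R" using f by simp
  have fL: "graded (int d) (int d) (\<lambda>\<pi>. crossed_act (sig f) unitA w \<pi>)" if "w \<in> W" for w
    using bL[of w] graded_cong[of "b w" "\<lambda>\<pi>. crossed_act (sig f) unitA w \<pi>"] f(2) that by blast
  obtain N where "deg_lt N (sig f)" using ex_deg_lt[OF z] ..
  then have N: "mon_deg m < N" if "m \<in> Poly_Mapping.keys (f w)" for m w
  proof -
    obtain ks where "m = mon ks" using mon_surj[of m] by metis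
    moreover have "FM ks \<in> Poly_Mapping.keys (sigma (f w))"
      using that card_words_of[of m] by (simp add: in_keys_iff lookup_sigma \<open>m = mon ks\<close>)
    then have "word_deg (FM ks) < N" using \<open>deg_lt N (sig f)\<close> unfolding deg_lt_def by blast
    ultimately show ?thesis by (simp add: word_deg_def mon_deg_mon)
  qed
  have deg': "mon_deg m < Suc d" if "m \<in> Poly_Mapping.keys (f w)" for m w
    by (rule sig_degree[OF f(1), of N "int d" "Suc d" m w]) (use N fL that in auto)
  have dl: "deg_lt (Suc d) (sig f)" by (rule deg_lt_sig) (use deg' in auto)
  have top: "hom_part d (f w) = (if w = mat 1 then p else 0)" for w
  proof (cases "w \<in> W")
    case True
    let ?q = "if w = mat 1 then p else 0"
    have q: "homog d ?q" using p by simp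
    have "graded (int d) (int d - 1) (\<lambda>\<pi>. b w \<pi> - peval ?q \<pi>)" using sym by (simp add: bw peval.ext_0)
    from graded_diff[OF this crossed_act_symbol[OF dl True]]
    have "graded (int d) (int d - 1) (\<lambda>\<pi>. (b w \<pi> - peval ?q \<pi>) - (crossed_act (sig f) unitA w \<pi> - peval (hom_part d (f w)) \<pi>))" by simp
    then have L: "graded (int d) (int d - 1) (\<lambda>\<pi>. peval (hom_part d (f w) - ?q) \<pi>)"
      using graded_cong[of "\<lambda>\<pi>. (b w \<pi> - peval ?q \<pi>) - (crossed_act (sig f) unitA w \<pi> - peval (hom_part d (f w)) \<pi>)"
          "\<lambda>\<pi>. peval (hom_part d (f w) - ?q) \<pi>"] f(2) True by (auto simp: peval.ext_diff)
    have "hom_part d (f w) - ?q = 0"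
      by (rule peval_zero_on_G, rule graded_hom_zero[OF homfun_peval[OF homog_diff[OF homog_hom_part q]] L]) auto
    then show ?thesis by simp
  next
    case False
    then have "w \<noteq> mat 1" by auto
    then show ?thesis using f(1) False by (simp add: PW.carrier_R)
  qed
  have zb: "zeroG (crossed_act (sig f) unitA - mulf \<phi> unitA)"
    unfolding zeroG_def
  proof (intro allI ballI)
    fix w \<pi> assume "\<pi> \<in> G"
    then show "(crossed_act (sig f) unitA - mulf \<phi> unitA) w \<pi> = 0"
      using f(2) crossed_act_support[of w "sig f" \<pi>] bw[of w] one_W by (cases "w \<in> W") (auto simp: b_def)
  qed
  have zm: "crossed_act (sig f) m w \<pi> = \<phi> \<pi> * m w \<pi>" if "\<pi> \<in> G" for m w \<pi>
  proof -
    have "crossed_act (sig f) m w \<pi> = star b m w \<pi>"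
      unfolding crossed_act_st[of "sig f" m] star_def using f(2) that by simp
    then show ?thesis by (simp add: stb mulf_def)
  qed
  have "central (sig f)" unfolding central_def
  proof (intro conjI ballI)
    fix a assume a: "a \<in> carrier TW.R"
    show "sig f \<otimes>\<^bsub>TW.R\<^esub> a - a \<otimes>\<^bsub>TW.R\<^esub> sig f \<in> I"
    proof (rule faithful)
      fix w \<pi> assume w: "w \<in> W" and \<pi>: "\<pi> \<in> G"
      have "zeroG (crossed_act a (crossed_act (sig f) unitA) - crossed_act a (mulf \<phi> unitA))"
        unfolding crossed_act_diff[symmetric] by (rule zeroG_crossed_act[OF zb])
      then have "crossed_act a (crossed_act (sig f) unitA) w \<pi> = mulf \<phi> (crossed_act a unitA) w \<pi>"
        using \<pi> by (simp add: zeroG_def mulf_crossed_act[OF \<phi>])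
      then show "crossed_act (sig f \<otimes>\<^bsub>TW.R\<^esub> a - a \<otimes>\<^bsub>TW.R\<^esub> sig f) unitA w \<pi> = 0"
        using zm[OF \<pi>] by (simp add: crossed_act_diff_left crossed_act_mult z a mulf_def)
    qed (use z a in simp)
  qed (rule z)
  moreover have "crossed_act (sig f) all1 (mat 1) \<pi> = tens_act (sigma p) all1 (mat 1) \<pi>" if "\<pi> \<in> G" for \<pi>
    using zm[OF that] by (simp add: all1_def \<phi>_def)
  ultimately show ?thesis using f(1) deg' top by blast
qed

lemma crossed_act_all1: "crossed_act a all1 w \<pi> = (\<Sum>u\<in>W. crossed_act a unitA u \<pi>)"
  unfolding crossed_act_st[of a all1] star_def translate_all1 by (simp add: all1_def)

text \<open>The map \<open>z \<mapsto> z e\<close> is injective on the centre.\<close>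

lemma central_unique:
  assumes a: "central a" and 0: "\<And>\<pi>. \<pi> \<in> G \<Longrightarrow> crossed_act a all1 (mat 1) \<pi> = 0"
  shows "a \<in> I"
proof (rule faithful)
  show ac: "a \<in> carrier TW.R" using a by (simp add: central_def)
  \<comment> \<open>Since \<open>vx\<close> acts by multiplication, commuting with it forces the
    coefficient at w, times the difference of \<open>vx\<close> and its translate by w, to be 0. On
    \<open>G\<close> that difference does not vanish.\<close>
  have ne: "crossed_act a unitA w \<pi> = 0" if w: "w \<in> W" "w \<noteq> mat 1" and \<pi>: "\<pi> \<in> G" for w \<pi>
  proof -
    let ?x = "TW.mono (mat 1) (tens_vec (0, vx))"
    have x: "?x \<in> carrier TW.R" by simp
    have D: "dunkl (0, vx) m w \<pi> = veval (0, vx) \<pi> * m w \<pi>" for m w \<pi>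
      by (simp add: dunkl_def dunkl_coeff_def)
    have "a \<otimes>\<^bsub>TW.R\<^esub> ?x - ?x \<otimes>\<^bsub>TW.R\<^esub> a \<in> I" using a x unfolding central_def by blast
    from zeroG_I[OF this, of unitA]
    have "crossed_act a (dunkl (0, vx) unitA) w \<pi> = dunkl (0, vx) (crossed_act a unitA) w \<pi>"
      using \<pi> x ac by (simp add: zeroG_def crossed_act_diff_left crossed_act_mult crossed_act_mono tens_act_tens_vec)
    moreover have "crossed_act a (dunkl (0, vx) unitA) w \<pi> = crossed_act a unitA w \<pi> * veval (W_act w (0, vx)) \<pi>"
    proof -
      have "translate u (dunkl (0, vx) unitA) w \<pi> = (if u = w then veval (W_act w (0, vx)) \<pi> else 0)" if "u \<in> W" for u
        using that translate_dunkl[of u "(0, vx)" unitA] translate_unitA[OF that] W_act_apply[of u "(0, vx)"]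
        by (auto simp: dunkl_def dunkl_coeff_def)
      then have "crossed_act a (dunkl (0, vx) unitA) w \<pi> =
          (\<Sum>u\<in>W. if u = w then crossed_act a unitA w \<pi> * veval (W_act w (0, vx)) \<pi> else 0)"
        unfolding crossed_act_st[of a "dunkl (0, vx) unitA"] star_def by (intro sum.cong) auto
      then show ?thesis using w by simp
    qed
    ultimately have "crossed_act a unitA w \<pi> * veval (W_act w (0, vx) - W_act (mat 1) (0, vx)) \<pi> = 0"
      by (simp add: D veval_diff W_act_one algebra_simps)
    moreover have "veval (W_act w (0, vx) - W_act (mat 1) (0, vx)) \<pi> \<noteq> 0"
      by (rule G_D(2)[OF \<pi> w(1) one_W w(2)])
    ultimately show ?thesis by simp
  qed
  fix w \<pi> assume w: "w \<in> W" and \<pi>: "\<pi> \<in> G"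
  have "(\<Sum>u\<in>W. crossed_act a unitA u \<pi>) = (\<Sum>u\<in>W. if u = mat 1 then crossed_act a unitA (mat 1) \<pi> else 0)"
    by (rule sum.cong) (use ne[OF _ _ \<pi>] in auto)
  then have "crossed_act a unitA (mat 1) \<pi> = 0" using 0[OF \<pi>] by (simp add: crossed_act_all1)
  then show "crossed_act a unitA w \<pi> = 0" using ne[OF w _ \<pi>] by (cases "w = mat 1") auto
qed

end

section \<open>Centres of the invariant subalgebras\<close>

lemma hom_part_mult:
  assumes x: "\<And>m. m \<in> Poly_Mapping.keys x \<Longrightarrow> mon_deg m < Suc d" and y: "homog e y"
  shows "hom_part (d + e) (x * y) = hom_part d x * y"
proof -
  have "hom_part (d + e) (hom_part i x * y) = (if i = d then hom_part d x * y else 0)" for i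
    using homog_mult[OF homog_hom_part y, of i x] homog_hom_part_other[of "i + e" "hom_part i x * y" "d + e"]
    by (auto simp: homog_def)
  then have "hom_part (d + e) ((\<Sum>i<Suc d. hom_part i x) * y) = hom_part d x * y"
    by (simp add: sum_distrib_right hom_part_sum del: sum.lessThan_Suc)
  then show ?thesis using sum_hom_part[of x "Suc d"] x by simp
qed

lemma keys_symmetrize:
  assumes "m \<in> Poly_Mapping.keys (symmetrize a)" shows "\<exists>u\<in>Poly_Mapping.keys a. word_deg u = mon_deg m"
proof -
  have "(\<Sum>ks\<in>words_of m. Poly_Mapping.lookup a (FM ks)) \<noteq> 0"
    using assms by (simp add: in_keys_iff lookup_symmetrize)
  then obtain ks where "ks \<in> words_of m" "Poly_Mapping.lookup a (FM ks) \<noteq> 0" by (meson sum.neutral)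
  then show ?thesis by (intro bexI[of _ "FM ks"]) (auto simp: in_keys_iff words_of_def word_deg_def mon_deg_mon)
qed

context reflection_data begin

section \<open>Cosets, symbols and the associated graded ring\<close>

abbreviation Q where "Q \<equiv> cherednik W \<alpha> \<alpha>v 0 c"
abbreviation F where "F \<equiv> cherednik_filtration W \<alpha> \<alpha>v 0 c"

definition coset :: "('n cmat \<Rightarrow> 'n tens) \<Rightarrow> ('n cmat \<Rightarrow> 'n tens) set" where
  "coset f = {i + f |i. i \<in> I}"

lemma coset_coset: "I +>\<^bsub>TW W\<^esub> f = coset f"
  unfolding TW_def coset_def a_r_coset_def' by auto

lemma coset_eq: "coset a = coset b \<longleftrightarrow> a - b \<in> I"
proof
  assume "coset a = coset b"
  then have "0 + a \<in> coset b" unfolding coset_def using I_zero by blast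
  then obtain i where "a = i + b" "i \<in> I" by (auto simp: coset_def)
  then show "a - b \<in> I" by simp
next
  assume ab: "a - b \<in> I"
  have "i + a \<in> coset b" if "i \<in> I" for i
  proof -
    have "i + a = (i + (a - b)) + b" by simp
    then show ?thesis unfolding coset_def using I_add[OF that ab] by blast
  qed
  moreover have "i + b \<in> coset a" if "i \<in> I" for i
  proof -
    have "i + b = (i - (a - b)) + a" by simp
    then show ?thesis unfolding coset_def using I_diff[OF that ab] by blast
  qed
  ultimately show "coset a = coset b" by (auto simp: coset_def)
qed

lemma Q_def: "Q = TW.R Quot I"
  by (simp add: cherednik_def TW_def)

lemma carrier_Q: "carrier Q = coset ` carrier TW.R"
  unfolding Q_def FactRing_def A_RCOSETS_defs using coset_coset by (auto simp: TW_def a_r_coset_defs)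

lemma mult_Q: "a \<in> carrier TW.R \<Longrightarrow> b \<in> carrier TW.R \<Longrightarrow> coset a \<otimes>\<^bsub>Q\<^esub> coset b = coset (a \<otimes>\<^bsub>TW.R\<^esub> b)"
  unfolding Q_def FactRing_def using ideal.rcoset_mult_add[OF I_ideal] by (simp add: coset_coset[unfolded TW_def, symmetric])

lemma add_Q: "a \<in> carrier TW.R \<Longrightarrow> b \<in> carrier TW.R \<Longrightarrow> coset a \<oplus>\<^bsub>Q\<^esub> coset b = coset (a + b)"
proof -
  assume "a \<in> carrier TW.R" "b \<in> carrier TW.R"
  then show ?thesis
    unfolding Q_def FactRing_def
    using abelian_subgroup.a_rcos_sum[OF abelian_subgroupI3[OF ideal.axioms(1)[OF I_ideal] TW.is_abelian_group]]
    by (simp add: coset_coset[unfolded TW_def, symmetric])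
qed

lemma zero_Q: "\<zero>\<^bsub>Q\<^esub> = coset 0"
  unfolding Q_def FactRing_def by (simp add: coset_def)

lemma F_eq: "F d = coset ` {f \<in> carrier TW.R. deg_lt (Suc d) f}"
  unfolding cherednik_filtration_def coset_coset by (simp add: TW_def deg_lt_def less_Suc_eq_le)

lemma below_eq: "below Q F d = coset ` {f \<in> carrier TW.R. deg_lt d f}"
proof (cases d)
  case 0
  have "f = 0" if "deg_lt 0 f" for f using that by (simp add: deg_lt_def fun_eq_iff)
  then have "{f \<in> carrier TW.R. deg_lt 0 f} = {0}" by auto
  then show ?thesis using 0 by (simp add: below_def zero_Q)
next
  case (Suc e)
  then show ?thesis by (simp add: below_def F_eq)
qed

text \<open>The class of \<open>a\<close> in degree d of the graded ring, as a set of cosets of the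
  ideal.\<close>

definition symbol_coset :: "nat \<Rightarrow> ('n cmat \<Rightarrow> 'n tens) \<Rightarrow> ('n cmat \<Rightarrow> 'n tens) set set" where
  "symbol_coset d a = {coset (b + a) |b. b \<in> carrier TW.R \<and> deg_lt d b}"

lemma symbol_coset_coset: "a \<in> carrier TW.R \<Longrightarrow> below Q F d +>\<^bsub>Q\<^esub> coset a = symbol_coset d a"
  unfolding a_r_coset_def' below_eq symbol_coset_def by (auto simp: add_Q)

lemma below_bc: "below Q F d = symbol_coset d 0"
  unfolding below_eq symbol_coset_def by auto

lemma symbol_coset_subset: "a \<in> carrier TW.R \<Longrightarrow> a' \<in> carrier TW.R \<Longrightarrow> a - a' \<in> J d \<Longrightarrow> symbol_coset d a \<subseteq> symbol_coset d a'"
proof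
  fix X assume a: "a \<in> carrier TW.R" "a' \<in> carrier TW.R" "a - a' \<in> J d" and "X \<in> symbol_coset d a"
  then obtain b where b: "X = coset (b + a)" "b \<in> carrier TW.R" "deg_lt d b" by (auto simp: symbol_coset_def)
  from a(3) obtain g where g: "g \<in> carrier TW.R" "deg_lt d g" "a - a' - g \<in> I" by (auto simp: J_def)
  have "(b + a) - ((b + g) + a') = a - a' - g" by (simp add: algebra_simps)
  then have "coset (b + a) = coset ((b + g) + a')" unfolding coset_eq using g(3) by (simp only:)
  then show "X \<in> symbol_coset d a'" unfolding symbol_coset_def using b g deg_lt_add TW.add_carrier by blast
qed

lemma symbol_coset_eq: "a \<in> carrier TW.R \<Longrightarrow> a' \<in> carrier TW.R \<Longrightarrow> symbol_coset d a = symbol_coset d a' \<longleftrightarrow> a - a' \<in> J d"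
proof
  assume a: "a \<in> carrier TW.R" "a' \<in> carrier TW.R" "symbol_coset d a = symbol_coset d a'"
  have "coset (0 + a) \<in> symbol_coset d a" unfolding symbol_coset_def using TW.zero_carrier deg_lt_zero by blast
  then have "coset (0 + a) \<in> symbol_coset d a'" unfolding a(3) .
  then obtain b where b: "coset (0 + a) = coset (b + a')" "b \<in> carrier TW.R" "deg_lt d b" unfolding symbol_coset_def by blast
  from b(1) have "a - a' - b \<in> I" unfolding coset_eq by (simp add: algebra_simps)
  then show "a - a' \<in> J d" unfolding J_def using a b by blast
next
  assume "a \<in> carrier TW.R" "a' \<in> carrier TW.R" "a - a' \<in> J d"
  then show "symbol_coset d a = symbol_coset d a'" using symbol_coset_subset[of a a' d] symbol_coset_subset[of a' a d] J_sym[of a a' d] by blast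
qed

text \<open>The normal form has the same component in degree d as \<open>a\<close>, and the rest of
  it has degree below d.\<close>

lemma top_J:
  assumes "a \<in> carrier TW.R" "deg_lt (Suc d) a"
  shows "a - sig (\<lambda>w. hom_part d (symmetrize (a w))) \<in> J d"
proof -
  let ?t = "\<lambda>w. hom_part d (symmetrize (a w))"
  from normal_form[OF assms] obtain p where p: "p \<in> carrier PW.R"
    "\<And>w m. m \<in> Poly_Mapping.keys (p w) \<Longrightarrow> mon_deg m < Suc d" "\<And>w. hom_part d (p w) = ?t w" "a - sig p \<in> I"
    by auto
  have t: "?t \<in> carrier PW.R" using assms(1) by (simp add: TW.carrier_R PW.carrier_R symmetrize.ext_0)
  have "mon_deg m < d" if "m \<in> Poly_Mapping.keys (p w - ?t w)" for m w
  proof (rule keys_lt_dec[of "p w - ?t w"])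
    show "mon_deg m < Suc d" if "m \<in> Poly_Mapping.keys (p w - ?t w)" for m
      using that p(2)[of m w] by (auto simp: in_keys_iff lookup_minus lookup_hom_part split: if_splits)
    show "hom_part d (p w - ?t w) = 0" by (simp add: hom_part_diff p(3) hom_part_hom_part)
  qed (rule that)
  then have d: "deg_lt d (sig (\<lambda>w. p w - ?t w))" by (intro deg_lt_sig)
  have e: "sig (\<lambda>w. p w - ?t w) = sig p - sig ?t" by (rule ext) (simp only: minus_apply sigma.ext_diff)
  have "(a - sig ?t) - (sig p - sig ?t) = a - sig p" by simp
  then have "(a - sig ?t) - (sig p - sig ?t) \<in> I" using p(4) by (simp only:)
  moreover have "sig p - sig ?t \<in> carrier TW.R" "a - sig ?t \<in> carrier TW.R"
    using p(1) t assms(1) by (auto intro!: TW.diff_carrier sig_carrier)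
  ultimately show ?thesis unfolding J_def using d e by auto
qed

text \<open>Symbols are well defined on the graded ring: elements of the ideal have none by
  \<open>symbol_I\<close>, and elements of degree below d have no component in degree d.\<close>

lemma symbol_J:
  assumes "a \<in> J d" "deg_lt (Suc d) a" shows "hom_part d (symmetrize (a w)) = 0"
proof -
  from assms(1) obtain g where g: "deg_lt d g" "a - g \<in> I" by (auto simp: J_def)
  have "deg_lt (Suc d) g" using g(1) by (auto simp: deg_lt_def less_Suc_eq)
  then have "hom_part d (symmetrize ((a - g) w)) = 0" by (intro symbol_I[OF g(2)] deg_lt_diff assms(2))
  moreover have "hom_part d (symmetrize (g w)) = 0"
  proof (rule poly_mapping_eqI)
    fix m
    have "mon_deg m \<noteq> d" if "m \<in> Poly_Mapping.keys (symmetrize (g w))"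
      using keys_symmetrize[OF that] g(1) unfolding deg_lt_def by (metis less_irrefl)
    then show "Poly_Mapping.lookup (hom_part d (symmetrize (g w))) m = Poly_Mapping.lookup 0 m"
      by (auto simp: lookup_hom_part in_keys_iff)
  qed
  ultimately show ?thesis by (simp add: symmetrize.ext_diff hom_part_diff)
qed

text \<open>All lifts of the component are congruent modulo \<open>J d\<close> to its
  symmetrization, so the union in \<open>pbw\<close> is over a single class; the symmetrization
  itself shows that a lift exists.\<close>

lemma pbw_bc:
  assumes f: "f \<in> carrier PW.R"
  shows "pbw W \<alpha> \<alpha>v 0 c f d = symbol_coset d (sig (\<lambda>w. hom_part d (f w)))"
proof -
  let ?t = "\<lambda>w. hom_part d (f w)"
  have t: "sig ?t \<in> carrier TW.R" using f by (intro sig_carrier) (simp add: PW.carrier_R)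
  have lift: "\<forall>w. \<forall>u\<in>Poly_Mapping.keys (sig ?t w). word_deg u = d"
    using keys_sigma_homog[OF homog_hom_part] by blast
  have eq: "below Q F d +>\<^bsub>Q\<^esub> coset q = symbol_coset d (sig ?t)"
    if "q \<in> carrier TW.R" "\<forall>w. \<forall>u\<in>Poly_Mapping.keys (q w). word_deg u = d" "\<forall>w. symmetrize (q w) = ?t w" for q
  proof -
    have "q - (\<lambda>w. sigma (symmetrize (q w))) \<in> J d" by (rule J_symmetrize) (use that in auto)
    then show ?thesis unfolding symbol_coset_coset[OF that(1)] symbol_coset_eq[OF that(1) t] using that(3) by simp
  qed
  show ?thesis unfolding pbw_def coset_coset
    using eq t lift by (auto simp: TW_def) (metis symmetrize_sigma)
qed

lemma deg_lt_mult:
  assumes "deg_lt (Suc d) a" "deg_lt (Suc e) b" shows "deg_lt (Suc (d + e)) (a \<otimes>\<^bsub>TW.R\<^esub> b)"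
  unfolding deg_lt_def
proof (intro allI ballI)
  fix w u assume "u \<in> Poly_Mapping.keys ((a \<otimes>\<^bsub>TW.R\<^esub> b) w)"
  then have "u \<in> (\<Union>v\<in>W. Poly_Mapping.keys (a v * tens_map (W_act v) (b (matrix_inv v ** w))))"
    unfolding TW.mult_R by (rule subsetD[OF keys_sum])
  then obtain v where "u \<in> Poly_Mapping.keys (a v * tens_map (W_act v) (b (matrix_inv v ** w)))"
    by blast
  then obtain x y where xy: "x \<in> Poly_Mapping.keys (a v)" "y \<in> Poly_Mapping.keys (tens_map (W_act v) (b (matrix_inv v ** w)))"
    "word_deg u = word_deg x + word_deg y" by (rule keys_mult_word_deg)
  from keys_tens_map[OF xy(2)] obtain y' where "y' \<in> Poly_Mapping.keys (b (matrix_inv v ** w))" "word_deg y' = word_deg y" by blast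
  then have "word_deg x < Suc d" "word_deg y < Suc e" using assms xy(1) unfolding deg_lt_def by metis+
  then show "word_deg u < Suc (d + e)" using xy(3) by simp
qed

lemma symmetrize_mult_R: "symmetrize ((a \<otimes>\<^bsub>TW.R\<^esub> b) w) = ((\<lambda>w. symmetrize (a w)) \<otimes>\<^bsub>PW.R\<^esub> (\<lambda>w. symmetrize (b w))) w"
  unfolding TW.mult_R PW.mult_R by (simp add: symmetrize.ext_sum symmetrize_mult symmetrize_tens_map)

end

text \<open>What is used of \<Gamma>. By \<open>commutes\<close> and \<open>kappa_invariant\<close>
  it acts on the crossed product and preserves the relations. The condition
  \<open>separation\<close> carries the invariant theory: an element of \<open>W\<close> that fixes
  every \<Gamma>-invariant polynomial is central in \<open>W\<close> and acts as an element of
  \<Gamma>.\<close>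

locale gamma_data = reflection_data W \<alpha> \<alpha>v c for W :: "('n::finite) cmat set" and \<alpha> \<alpha>v c +
  fixes \<Gamma> :: "('n hhd \<Rightarrow> 'n hhd) set"
  assumes lin: "g \<in> \<Gamma> \<Longrightarrow> linV g"
    and inverse: "g \<in> \<Gamma> \<Longrightarrow> \<exists>g'\<in>\<Gamma>. (\<forall>v. g (g' v) = v) \<and> (\<forall>v. g' (g v) = v)"
    and commutes: "g \<in> \<Gamma> \<Longrightarrow> w \<in> W \<Longrightarrow> g (W_act w v) = W_act w (g v)"
    and kappa_invariant: "g \<in> \<Gamma> \<Longrightarrow> s \<in> S \<Longrightarrow> kappa s (g u) (g v) = kappa s u v"
    and separation: "w \<in> W \<Longrightarrow> (\<And>p. (\<And>g. g \<in> \<Gamma> \<Longrightarrow> sym_map g p = p) \<Longrightarrow> sym_map (W_act w) p = p) \<Longrightarrow>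
        W_act w \<in> \<Gamma> \<and> (\<forall>u\<in>W. w ** u = u ** w)"
begin

definition induced :: "('n hhd \<Rightarrow> 'n hhd) \<Rightarrow> ('n cmat \<Rightarrow> 'n tens) \<Rightarrow> 'n cmat \<Rightarrow> 'n tens" where
  "induced g f = (\<lambda>w. tens_map g (f w))"

lemma induced_add: "induced g (a + b) = induced g a + induced g b"
  and induced_diff: "induced g (a - b) = induced g a - induced g b"
  and induced_0: "induced g 0 = 0"
  by (auto simp: induced_def fun_eq_iff tens_map.ext_add tens_map.ext_diff tens_map.ext_0)

lemma induced_sum: "induced g (\<Sum>i\<in>A. f i) = (\<Sum>i\<in>A. induced g (f i))"
  by (rule additive_sum[of "induced g"]) (rule induced_add induced_0)+

lemma induced_carrier: "a \<in> carrier TW.R \<Longrightarrow> induced g a \<in> carrier TW.R"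
  by (simp add: TW.carrier_R induced_def tens_map.ext_0)

lemma induced_mono: "induced g (TW.mono w p) = TW.mono w (tens_map g p)"
  by (auto simp: induced_def TW.mono_def fun_eq_iff tens_map.ext_0)

lemma tens_map_commutes: "g \<in> \<Gamma> \<Longrightarrow> w \<in> W \<Longrightarrow> tens_map g (tens_map (W_act w) p) = tens_map (W_act w) (tens_map g p)"
  using commutes[of g w] by (simp add: tens_map_comp lin comp_def)

lemma induced_mult: "g \<in> \<Gamma> \<Longrightarrow> induced g (a \<otimes>\<^bsub>TW.R\<^esub> b) = induced g a \<otimes>\<^bsub>TW.R\<^esub> induced g b"
  by (rule ext) (simp add: induced_def TW.mult_R tens_map.ext_sum tens_map_mult tens_map_commutes)

lemma induced_Rel: "g \<in> \<Gamma> \<Longrightarrow> induced g (Rel u v) = Rel (g u) (g v)"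
  unfolding Rel_def
  by (simp add: induced_diff induced_sum induced_mono tens_map.ext_diff tens_map_mult tens_map_vec lin tens_map_const kappa_invariant)

lemma induced_I: "g \<in> \<Gamma> \<Longrightarrow> f \<in> I \<Longrightarrow> induced g f \<in> I"
proof -
  assume g: "g \<in> \<Gamma>" and f: "f \<in> I"
  let ?K = "{f \<in> carrier TW.R. induced g f \<in> I}"
  have "ideal ?K TW.R"
  proof (rule idealI)
    show "Ring.ring TW.R" by (rule TW.ring_axioms)
    show "subgroup ?K (add_monoid TW.R)"
    proof (rule TW.add.subgroupI)
      show "?K \<noteq> {}" by (auto intro!: exI[of _ 0] simp: induced_0)
      show "\<ominus>\<^bsub>TW.R\<^esub> a \<in> ?K" if "a \<in> ?K" for a
        using that I_uminus induced_diff[of g 0 a] by (auto simp: induced_0)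
    qed (auto simp: induced_add I_add)
  qed (auto simp: induced_mult g I_left I_right induced_carrier)
  then have "I \<subseteq> ?K" by (rule I_minimal) (simp add: induced_Rel g Rel_I)
  then show ?thesis using f by blast
qed

lemma induced_inverse: "g \<in> \<Gamma> \<Longrightarrow> g' \<in> \<Gamma> \<Longrightarrow> (\<And>v. g (g' v) = v) \<Longrightarrow> induced g (induced g' f) = f"
  by (rule ext) (simp add: induced_def tens_map_comp lin comp_def tens_map_id)

text \<open>One inclusion holds because the ideal is preserved; the other uses the inverse
  transformation.\<close>

lemma induced_cl:
  assumes g: "g \<in> \<Gamma>" shows "induced g ` coset a = coset (induced g a)"
proof
  show "induced g ` coset a \<subseteq> coset (induced g a)" using induced_I[OF g] by (auto simp: coset_def induced_add)
  obtain g' where g': "g' \<in> \<Gamma>" "\<And>v. g (g' v) = v" using inverse[OF g] by blast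
  show "coset (induced g a) \<subseteq> induced g ` coset a"
  proof
    fix x assume "x \<in> coset (induced g a)"
    then obtain i where i: "x = i + induced g a" "i \<in> I" by (auto simp: coset_def)
    then have "x = induced g (induced g' i + a)" by (simp add: induced_add induced_inverse[OF g g'])
    then show "x \<in> induced g ` coset a" using induced_I[OF g'(1) i(2)] by (auto simp: coset_def)
  qed
qed

definition invariant :: "('n cmat \<Rightarrow> 'n tens) \<Rightarrow> bool" where
  "invariant a \<longleftrightarrow> a \<in> carrier TW.R \<and> (\<forall>g\<in>\<Gamma>. induced g a - a \<in> I)"

abbreviation Inv where "Inv \<equiv> cherednik_invariants W \<alpha> \<alpha>v 0 c \<Gamma>"

lemma coset_invariants: "a \<in> carrier TW.R \<Longrightarrow> coset a \<in> Inv \<longleftrightarrow> invariant a"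
proof -
  assume a: "a \<in> carrier TW.R"
  have "coset a \<in> Inv \<longleftrightarrow> (\<forall>g\<in>\<Gamma>. induced g ` coset a = coset a)"
    unfolding cherednik_invariants_def induced_def carrier_Q using a by auto
  also have "\<dots> \<longleftrightarrow> (\<forall>g\<in>\<Gamma>. induced g a - a \<in> I)" by (simp add: induced_cl coset_eq)
  finally show ?thesis using a by (simp add: invariant_def)
qed

lemma Inv_cl: "X \<in> Inv \<Longrightarrow> \<exists>a. invariant a \<and> X = coset a"
proof -
  assume X: "X \<in> Inv"
  then have "X \<in> carrier Q" unfolding cherednik_invariants_def by blast
  then show ?thesis using X coset_invariants unfolding carrier_Q by blast
qed

lemma centre_Inv:
  assumes a: "a \<in> carrier TW.R"
  shows "coset a \<in> centre (Q\<lparr>carrier := Inv\<rparr>) \<longleftrightarrow>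
     invariant a \<and> (\<forall>b. invariant b \<longrightarrow> a \<otimes>\<^bsub>TW.R\<^esub> b - b \<otimes>\<^bsub>TW.R\<^esub> a \<in> I)"
proof -
  have "coset a \<in> centre (Q\<lparr>carrier := Inv\<rparr>) \<longleftrightarrow> coset a \<in> Inv \<and> (\<forall>X\<in>Inv. coset a \<otimes>\<^bsub>Q\<^esub> X = X \<otimes>\<^bsub>Q\<^esub> coset a)"
    by (simp add: centre_def)
  also have "\<dots> \<longleftrightarrow> invariant a \<and> (\<forall>b. invariant b \<longrightarrow> coset a \<otimes>\<^bsub>Q\<^esub> coset b = coset b \<otimes>\<^bsub>Q\<^esub> coset a)"
    using Inv_cl coset_invariants a unfolding invariant_def by metis
  also have "\<dots> \<longleftrightarrow> invariant a \<and> (\<forall>b. invariant b \<longrightarrow> a \<otimes>\<^bsub>TW.R\<^esub> b - b \<otimes>\<^bsub>TW.R\<^esub> a \<in> I)"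
    using a by (auto simp: invariant_def mult_Q coset_eq)
  finally show ?thesis .
qed

lemma central_Tg:
  assumes g: "g \<in> \<Gamma>" and z: "central z" shows "central (induced g z)"
  unfolding central_def
proof (intro conjI ballI)
  obtain g' where g': "g' \<in> \<Gamma>" "\<And>v. g (g' v) = v" using inverse[OF g] by blast
  show "induced g z \<in> carrier TW.R" using z by (simp add: central_def induced_carrier)
  fix a assume a: "a \<in> carrier TW.R"
  have "z \<otimes>\<^bsub>TW.R\<^esub> induced g' a - induced g' a \<otimes>\<^bsub>TW.R\<^esub> z \<in> I" using z a by (simp add: central_def induced_carrier)
  from induced_I[OF g this] show "induced g z \<otimes>\<^bsub>TW.R\<^esub> a - a \<otimes>\<^bsub>TW.R\<^esub> induced g z \<in> I"
    by (simp add: induced_diff induced_mult g induced_inverse[OF g g'])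
qed

lemma central_diff:
  assumes "central z" "central z'" shows "central (z - z')"
  unfolding central_def
proof (intro conjI ballI)
  show "z - z' \<in> carrier TW.R" using assms by (simp add: central_def)
  fix a assume a: "a \<in> carrier TW.R"
  have "(z - z') \<otimes>\<^bsub>TW.R\<^esub> a - a \<otimes>\<^bsub>TW.R\<^esub> (z - z') =
     (z \<otimes>\<^bsub>TW.R\<^esub> a - a \<otimes>\<^bsub>TW.R\<^esub> z) - (z' \<otimes>\<^bsub>TW.R\<^esub> a - a \<otimes>\<^bsub>TW.R\<^esub> z')"
    using assms by (simp add: central_def TW.mult_R_diff_left TW.mult_R_diff_right algebra_simps)
  also have "\<dots> \<in> I" by (rule I_diff) (use assms a in \<open>auto simp: central_def\<close>)
  finally show "(z - z') \<otimes>\<^bsub>TW.R\<^esub> a - a \<otimes>\<^bsub>TW.R\<^esub> (z - z') \<in> I" .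
qed

text \<open>The hypothesis says that z e = \<sigma>(p) e, which faithfulness turns into an identity
  in H. As \<Gamma> fixes e and \<sigma>(p), the transform of z has the same product with e, and
  \<open>central_unique\<close> applies to the difference.\<close>

lemma central_lift_invariant:
  assumes z: "central z" and p: "\<And>g. g \<in> \<Gamma> \<Longrightarrow> sym_map g p = p"
    and lift: "\<And>\<pi>. \<pi> \<in> G \<Longrightarrow> crossed_act z all1 (mat 1) \<pi> = tens_act (sigma p) all1 (mat 1) \<pi>"
  shows "invariant z"
  unfolding invariant_def
proof (intro conjI ballI)
  show zc: "z \<in> carrier TW.R" using z by (simp add: central_def)
  fix g assume g: "g \<in> \<Gamma>"
  \<comment> \<open>The sum \<open>?e\<close> of all group elements is \<open>card W\<close> times
    the idempotent e.\<close>
  let ?e = "\<Sum>w\<in>W. TW.mono w 1" and ?h = "z - TW.mono (mat 1) (sigma p)"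
  have ec: "?e \<in> carrier TW.R" by auto
  have hc: "?h \<in> carrier TW.R" using zc by simp
  have we: "crossed_act ?e m = (\<Sum>w\<in>W. translate w m)" for m
    by (simp add: crossed_act_sum_left crossed_act_mono)
  have oneW: "translate u (crossed_act ?e unitA) w \<pi> = 1" if "u \<in> W" "w \<in> W" for u w \<pi>
  proof -
    have "translate u (crossed_act ?e unitA) w \<pi> = (\<Sum>v\<in>W. if u ** v = w then 1 else 0)"
      unfolding we translate_sum sum_fun_apply
    proof (rule sum.cong[OF refl])
      fix v assume v: "v \<in> W"
      show "translate u (translate v unitA) w \<pi> = (if u ** v = w then 1 else 0)"
        unfolding translate_translate[OF that(1) v] translate_unitA[OF mult_W[OF that(1) v]] by auto
    qed
    also have "\<dots> = (\<Sum>v\<in>W. if v = matrix_inv u ** w then 1 else 0)"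
      by (rule sum.cong) (use that mul_inv_cancel[OF that(1)] in auto)
    finally show ?thesis using that by simp
  qed
  have "?h \<otimes>\<^bsub>TW.R\<^esub> ?e \<in> I"
  proof (rule faithful)
    fix w \<pi> assume w: "w \<in> W" and \<pi>: "\<pi> \<in> G"
    have "crossed_act (?h \<otimes>\<^bsub>TW.R\<^esub> ?e) unitA w \<pi> = (\<Sum>u\<in>W. crossed_act ?h unitA u \<pi> * translate u (crossed_act ?e unitA) w \<pi>)"
      unfolding crossed_act_mult[OF hc ec] by (subst crossed_act_st) (simp only: star_def)
    also have "\<dots> = crossed_act ?h all1 (mat 1) \<pi>" unfolding crossed_act_all1 using oneW w by (intro sum.cong) auto
    also have "\<dots> = 0" using lift[OF \<pi>] by (simp add: crossed_act_diff_left crossed_act_mono)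
    finally show "crossed_act (?h \<otimes>\<^bsub>TW.R\<^esub> ?e) unitA w \<pi> = 0" .
  qed (use hc ec in auto)
  from induced_I[OF g this] have "induced g ?h \<otimes>\<^bsub>TW.R\<^esub> ?e \<in> I"
    by (simp only: induced_mult[OF g] induced_sum induced_mono tens_map_1)
  then have zG: "zeroG (crossed_act (induced g ?h) (crossed_act ?e all1))"
    using zeroG_I[of "induced g ?h \<otimes>\<^bsub>TW.R\<^esub> ?e" all1] by (simp only: crossed_act_mult[OF induced_carrier[OF hc] ec])
  \<comment> \<open>On the constant function \<open>?e\<close> acts by the nonzero scalar
    \<open>card W\<close>, so it can be removed.\<close>
  have "crossed_act ?e all1 = fld_scale (of_nat (card W)) all1"
    unfolding we by (auto simp: all1_def fld_scale_def translate_def fun_eq_iff)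
  then have "of_nat (card W) * crossed_act (induced g ?h) all1 (mat 1) \<pi> = 0" if "\<pi> \<in> G" for \<pi>
    using zG that by (simp only: crossed_act_fld_scale) (auto simp: zeroG_def fld_scale_def)
  moreover have "card W \<noteq> 0" using one_W by (metis card_0_eq empty_iff finite_W)
  ultimately have 0: "crossed_act (induced g ?h) all1 (mat 1) \<pi> = 0" if "\<pi> \<in> G" for \<pi> using that by simp
  have "induced g ?h = induced g z - TW.mono (mat 1) (sigma p)"
    by (simp only: induced_diff induced_mono tens_map_sigma[OF lin[OF g]] p[OF g])
  then have "crossed_act (induced g z - z) all1 (mat 1) \<pi> = 0" if "\<pi> \<in> G" for \<pi>
    using 0[OF that] lift[OF that] by (simp add: crossed_act_diff_left crossed_act_mono)
  then show "induced g z - z \<in> I" using central_unique[OF central_diff[OF central_Tg[OF g z] z]] by blast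
qed

section \<open>Comparison of the two centres\<close>

abbreviation PI where "PI \<equiv> PW_invariant_coeffs W \<Gamma>"

lemma PI_iff: "f \<in> PI \<longleftrightarrow> f \<in> carrier PW.R \<and> (\<forall>w. \<forall>g\<in>\<Gamma>. sym_map g (f w) = f w)"
  by (simp add: PW_invariant_coeffs_def PW_def)

lemma centre_PI: "f \<in> centre (PW W\<lparr>carrier := PI\<rparr>) \<longleftrightarrow> f \<in> PI \<and> (\<forall>h\<in>PI. f \<otimes>\<^bsub>PW.R\<^esub> h = h \<otimes>\<^bsub>PW.R\<^esub> f)"
  by (simp add: centre_def PW_def)

text \<open>Commuting with an invariant polynomial p gives f w (w p - p) = 0, so w fixes p because
  polynomials form a domain. Commuting with u relates f at the conjugate of w by u to the transform
  of \<open>f w\<close>, and w is central.\<close>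

lemma centre_PI_structure:
  assumes f: "f \<in> centre (PW W\<lparr>carrier := PI\<rparr>)" and nz: "f w \<noteq> 0"
  shows "w \<in> W" "W_act w \<in> \<Gamma>" "u \<in> W \<Longrightarrow> w ** u = u ** w" "u \<in> W \<Longrightarrow> sym_map (W_act u) (f w) = f w"
proof -
  have fc: "f \<in> carrier PW.R" using f by (simp add: centre_PI PI_iff)
  show w: "w \<in> W" using fc nz by (auto simp: PW.carrier_R)
  have "sym_map (W_act w) p = p" if p: "\<And>g. g \<in> \<Gamma> \<Longrightarrow> sym_map g p = p" for p
  proof -
    have "PW.mono (mat 1) p \<in> PI" using p by (simp add: PI_iff) (simp add: PW.mono_def sym_map.ext_0)
    then have "f \<otimes>\<^bsub>PW.R\<^esub> PW.mono (mat 1) p = PW.mono (mat 1) p \<otimes>\<^bsub>PW.R\<^esub> f" using f by (simp add: centre_PI)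
    then have "f w * sym_map (W_act w) p = p * f w"
      using PW.mono_mult_right[OF fc one_W, of p w] by (simp add: PW.mono_mult_left W_act_one sym_map_id)
    then have "f w * sym_map (W_act w) p = f w * p" by (simp add: mult.commute)
    then show ?thesis by (rule sym_mult_cancel[OF nz])
  qed
  from separation[OF w this] have sep: "W_act w \<in> \<Gamma>" "\<forall>u\<in>W. w ** u = u ** w" by auto
  show "W_act w \<in> \<Gamma>" by (rule sep)
  show "w ** u = u ** w" if "u \<in> W" using sep that by blast
  show "sym_map (W_act u) (f w) = f w" if u: "u \<in> W"
  proof -
    have "PW.mono u 1 \<in> PI" using u by (simp add: PI_iff) (simp add: PW.mono_def sym_map.ext_0 sym_map_1)
    then have "f \<otimes>\<^bsub>PW.R\<^esub> PW.mono u 1 = PW.mono u 1 \<otimes>\<^bsub>PW.R\<^esub> f" using f by (simp add: centre_PI)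
    then have "f (u ** w ** matrix_inv u) = sym_map (W_act u) (f w)"
      using PW.mono_mult_right[OF fc u, of 1 "u ** w"] u by (simp add: PW.mono_mult_left sym_map_1)
    moreover have "u ** w ** matrix_inv u = w"
      using sep(2) u by (metis matrix_mul_assoc matrix_mul_rid r_inv)
    ultimately show ?thesis by simp
  qed
qed

text \<open>For w central in \<open>W\<close>, conjugation by w leaves the group index alone and
  only transforms coefficients, which is the map induced by \<open>W_act w\<close>. If this map
  belongs to \<Gamma>, then w commutes with the \<Gamma>-invariants of H.\<close>

lemma mono_commute_invariant:
  assumes w: "w \<in> W" "\<And>u. u \<in> W \<Longrightarrow> w ** u = u ** w" and b: "b \<in> carrier TW.R"
  shows "TW.mono w 1 \<otimes>\<^bsub>TW.R\<^esub> b = induced (W_act w) b \<otimes>\<^bsub>TW.R\<^esub> TW.mono w 1"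
proof
  fix v
  have "b (matrix_inv w ** v) = b (v ** matrix_inv w)"
  proof (cases "v \<in> W")
    case True
    have "w ** (matrix_inv w ** v) = w ** (v ** matrix_inv w)"
      using w(2)[OF mult_W[OF True inv_W[OF w(1)]]] w(1) by (simp add: matrix_mul_assoc[symmetric] l_inv)
    then have "matrix_inv w ** (w ** (matrix_inv w ** v)) = matrix_inv w ** (w ** (v ** matrix_inv w))" by simp
    then show ?thesis using w(1) by (simp only: mul_inv_cancel)
  next
    case False
    have "v ** matrix_inv w \<notin> W"
    proof
      assume "v ** matrix_inv w \<in> W"
      then have "v ** matrix_inv w ** w \<in> W" using w(1) by simp
      then show False using False w(1) by (simp add: matrix_mul_assoc[symmetric] l_inv)
    qed
    then show ?thesis using b False w(1) inv_mult_in_W by (simp add: TW.carrier_R)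
  qed
  then show "(TW.mono w 1 \<otimes>\<^bsub>TW.R\<^esub> b) v = (induced (W_act w) b \<otimes>\<^bsub>TW.R\<^esub> TW.mono w 1) v"
    using TW.mono_mult_right[OF induced_carrier[OF b] w(1), of "W_act w" 1 v] w(1)
    by (simp add: TW.mono_mult_left induced_def tens_map_1)
qed

text \<open>The degree d component of each coefficient of f is lifted by \<open>satake\<close> and
  multiplied by its group element. Lifting a single degree suffices because \<open>gr_sub\<close>
  asks for a central representative in each degree separately.\<close>

lemma lift_centre:
  assumes f: "f \<in> centre (PW W\<lparr>carrier := PI\<rparr>)"
  shows "\<exists>a\<in>carrier TW.R. deg_lt (Suc d) a \<and> coset a \<in> centre (Q\<lparr>carrier := Inv\<rparr>) \<and>
     (\<forall>w. hom_part d (symmetrize (a w)) = hom_part d (f w))"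
proof -
  define K where "K = {w. f w \<noteq> 0}"
  note str = centre_PI_structure[OF f]
  have K: "w \<in> W" "W_act w \<in> \<Gamma>" "\<And>u. u \<in> W \<Longrightarrow> w ** u = u ** w" if "w \<in> K" for w
    using str that unfolding K_def by auto
  have finK: "finite K" by (rule finite_subset[of _ W]) (use K in auto)
  have "\<exists>z. central z \<and> invariant z \<and> deg_lt (Suc d) z \<and>
      (\<forall>v. hom_part d (symmetrize (z v)) = (if v = mat 1 then hom_part d (f w) else 0))" if w: "w \<in> K" for w
  proof -
    let ?p = "hom_part d (f w)"
    have inv: "sym_map (W_act u) ?p = ?p" if "u \<in> W" for u
      using str(4)[of w u] w that by (simp add: K_def hom_part_sym_map[symmetric])
    from satake[OF homog_hom_part inv] obtain F where F: "F \<in> carrier PW.R"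
      "\<And>v m. m \<in> Poly_Mapping.keys (F v) \<Longrightarrow> mon_deg m < Suc d"
      "\<And>v. hom_part d (F v) = (if v = mat 1 then ?p else 0)" "central (sig F)"
      "\<And>\<pi>. \<pi> \<in> G \<Longrightarrow> crossed_act (sig F) all1 (mat 1) \<pi> = tens_act (sigma ?p) all1 (mat 1) \<pi>" by blast
    have "sym_map g ?p = ?p" if "g \<in> \<Gamma>" for g
      using f that by (simp add: centre_PI PI_iff hom_part_sym_map[symmetric])
    then have "invariant (sig F)" using central_lift_invariant[OF F(4) _ F(5)] by blast
    moreover have "deg_lt (Suc d) (sig F)" by (rule deg_lt_sig) (use F(2) in auto)
    ultimately show ?thesis using F(3,4) by (intro exI[of _ "sig F"]) auto
  qed
  then obtain z where z: "\<And>w. w \<in> K \<Longrightarrow> central (z w)" "\<And>w. w \<in> K \<Longrightarrow> invariant (z w)"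
    "\<And>w. w \<in> K \<Longrightarrow> deg_lt (Suc d) (z w)"
    "\<And>w v. w \<in> K \<Longrightarrow> hom_part d (symmetrize (z w v)) = (if v = mat 1 then hom_part d (f w) else 0)"
    by metis
  have zc: "z w \<in> carrier TW.R" if "w \<in> K" for w using z(1)[OF that] by (simp add: central_def)
  define a where "a = (\<Sum>w\<in>K. z w \<otimes>\<^bsub>TW.R\<^esub> TW.mono w 1)"
  have ac: "a \<in> carrier TW.R" unfolding a_def using zc K by (intro TW.sum_carrier TW.mult_closed_R) auto
  have zw: "(z w \<otimes>\<^bsub>TW.R\<^esub> TW.mono w 1) v = z w (v ** matrix_inv w)" if "w \<in> K" for w v
    using TW.mono_mult_right[OF zc[OF that] K(1)[OF that], of 1 v] by (simp add: tens_map_1)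
  have "deg_lt (Suc d) (z w \<otimes>\<^bsub>TW.R\<^esub> TW.mono w 1)" if "w \<in> K" for w
    using z(3)[OF that] unfolding deg_lt_def zw[OF that] by blast
  then have ad: "deg_lt (Suc d) a" unfolding a_def by (intro deg_lt_sum)
  have "hom_part d (symmetrize (a v)) = hom_part d (f v)" for v
  proof -
    have iff: "v ** matrix_inv w = mat 1 \<longleftrightarrow> w = v" if "w \<in> K" for w
    proof
      assume "v ** matrix_inv w = mat 1"
      then have "v ** matrix_inv w ** w = w" by simp
      then show "w = v" using K(1)[OF that] by (simp add: matrix_mul_assoc[symmetric] l_inv)
    qed (use K(1)[OF that] r_inv in auto)
    have "hom_part d (symmetrize (a v)) = (\<Sum>w\<in>K. if w = v then hom_part d (f v) else 0)"
      unfolding a_def sum_fun_apply symmetrize.ext_sum hom_part_sum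
      by (intro sum.cong refl) (simp add: zw z(4) iff)
    also have "\<dots> = hom_part d (f v)" using finK by (auto simp: K_def)
    finally show ?thesis .
  qed
  moreover have "invariant a" unfolding invariant_def
  proof (intro conjI ballI ac)
    fix g assume g: "g \<in> \<Gamma>"
    have "induced g a - a = (\<Sum>w\<in>K. (induced g (z w) - z w) \<otimes>\<^bsub>TW.R\<^esub> TW.mono w 1)"
      unfolding a_def induced_sum sum_subtractf[symmetric]
      by (rule sum.cong) (simp_all add: induced_mult g induced_mono tens_map_1 TW.mult_R_diff_left induced_carrier zc)
    also have "\<dots> \<in> I"
      by (intro I_sum I_right) (use z(2) g K in \<open>auto simp: invariant_def\<close>)
    finally show "induced g a - a \<in> I" .
  qed
  moreover have "a \<otimes>\<^bsub>TW.R\<^esub> b - b \<otimes>\<^bsub>TW.R\<^esub> a \<in> I" if b: "invariant b" for b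
  proof -
    have symbol_coset: "b \<in> carrier TW.R" using b by (simp add: invariant_def)
    have "(z w \<otimes>\<^bsub>TW.R\<^esub> TW.mono w 1) \<otimes>\<^bsub>TW.R\<^esub> b - b \<otimes>\<^bsub>TW.R\<^esub> (z w \<otimes>\<^bsub>TW.R\<^esub> TW.mono w 1) \<in> I" if w: "w \<in> K" for w
    proof -
      let ?w = "TW.mono w 1" and ?b = "induced (W_act w) b"
      \<comment> \<open>Moving w past b replaces b by its transform. The first term measures how far
        b is from being fixed, the second how far \<open>z w\<close> is from commuting with b, and
        both lie in the ideal.\<close>
      have e: "(z w \<otimes>\<^bsub>TW.R\<^esub> ?w) \<otimes>\<^bsub>TW.R\<^esub> b - b \<otimes>\<^bsub>TW.R\<^esub> (z w \<otimes>\<^bsub>TW.R\<^esub> ?w) =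
        z w \<otimes>\<^bsub>TW.R\<^esub> (?b - b) \<otimes>\<^bsub>TW.R\<^esub> ?w + (z w \<otimes>\<^bsub>TW.R\<^esub> b - b \<otimes>\<^bsub>TW.R\<^esub> z w) \<otimes>\<^bsub>TW.R\<^esub> ?w"
        using zc[OF w] symbol_coset K(1)[OF w] mono_commute_invariant[OF K(1)[OF w] K(3)[OF w] symbol_coset]
        by (simp add: TW.mult_R_assoc TW.mult_R_diff_left TW.mult_R_diff_right induced_carrier)
      have "?b - b \<in> I" using b K(2)[OF w] by (simp add: invariant_def)
      moreover have "z w \<otimes>\<^bsub>TW.R\<^esub> b - b \<otimes>\<^bsub>TW.R\<^esub> z w \<in> I" using z(1)[OF w] symbol_coset by (simp add: central_def)
      ultimately show ?thesis unfolding e using zc[OF w] K(1)[OF w]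
        by (intro I_add I_right I_left) auto
    qed
    then have "(\<Sum>w\<in>K. (z w \<otimes>\<^bsub>TW.R\<^esub> TW.mono w 1) \<otimes>\<^bsub>TW.R\<^esub> b - b \<otimes>\<^bsub>TW.R\<^esub> (z w \<otimes>\<^bsub>TW.R\<^esub> TW.mono w 1)) \<in> I"
      by (intro I_sum)
    then show ?thesis by (simp add: a_def TW.mult_R_sum_left TW.mult_R_sum_right sum_subtractf)
  qed
  ultimately show ?thesis using ac ad centre_Inv[OF ac] by blast
qed

text \<open>The lifts \<open>A d\<close> for different d are unrelated, so invariance and
  commutation are checked on one homogeneous component at a time.\<close>

lemma symbol_centre:
  assumes f: "f \<in> carrier PW.R" and a: "\<And>d. A d \<in> carrier TW.R" "\<And>d. deg_lt (Suc d) (A d)"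
    "\<And>d. coset (A d) \<in> centre (Q\<lparr>carrier := Inv\<rparr>)"
    and hp: "\<And>d w. hom_part d (f w) = hom_part d (symmetrize (A d w))"
  shows "f \<in> centre (PW W\<lparr>carrier := PI\<rparr>)"
proof -
  have A: "invariant (A d)" "\<And>b. invariant b \<Longrightarrow> A d \<otimes>\<^bsub>TW.R\<^esub> b - b \<otimes>\<^bsub>TW.R\<^esub> A d \<in> I" for d
    using a(3)[of d] centre_Inv[OF a(1)] by auto
  have degT: "deg_lt n (induced g b)" if "deg_lt n b" for n g b
    using that keys_tens_map unfolding deg_lt_def induced_def by metis
  have "sym_map g (f w) = f w" if g: "g \<in> \<Gamma>" for g w
  proof -
    have "hom_part d (sym_map g (f w)) = hom_part d (f w)" for d
    proof -
      have "induced g (A d) - A d \<in> I" using A(1) g by (simp add: invariant_def)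
      from symbol_I[OF this, of d w] have "hom_part d (symmetrize (tens_map g (A d w))) = hom_part d (symmetrize (A d w))"
        using deg_lt_diff[OF degT[OF a(2)] a(2)] by (simp add: induced_def symmetrize.ext_diff hom_part_diff)
      then show ?thesis by (simp add: symmetrize_tens_map[OF lin[OF g]] hom_part_sym_map hp)
    qed
    then show ?thesis by (metis lookup_hom_part poly_mapping_eqI)
  qed
  then have fPI: "f \<in> PI" using f by (simp add: PI_iff)
  have comm: "f \<otimes>\<^bsub>PW.R\<^esub> h = h \<otimes>\<^bsub>PW.R\<^esub> f" if h: "h \<in> PI" for h
  proof -
    define fd where "fd d = (\<lambda>w. hom_part d (f w))" for d
    define he where "he e = (\<lambda>w. hom_part e (h w))" for e
    have hc: "h \<in> carrier PW.R" using h by (simp add: PI_iff)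
    have sum: "\<exists>N. x = (\<Sum>d<N. (\<lambda>w. hom_part d (x w)))" if x: "x \<in> carrier PW.R" for x
    proof -
      have "finite (\<Union>w\<in>W. mon_deg ` Poly_Mapping.keys (x w))" by simp
      then obtain N where N: "\<forall>k\<in>(\<Union>w\<in>W. mon_deg ` Poly_Mapping.keys (x w)). k < N"
        using finite_nat_set_iff_bounded by blast
      have "x w = (\<Sum>d<N. hom_part d (x w))" for w
      proof (cases "w \<in> W")
        case True
        show ?thesis by (rule sum_hom_part) (use N True in blast)
      qed (use x in \<open>simp add: PW.carrier_R\<close>)
      then show ?thesis by (intro exI[of _ N] ext) simp
    qed
    have de: "fd d \<otimes>\<^bsub>PW.R\<^esub> he e = he e \<otimes>\<^bsub>PW.R\<^esub> fd d" for d e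
    proof
      fix w
      have hec: "he e \<in> carrier PW.R" using hc by (simp add: he_def PW.carrier_R)
      have b: "deg_lt (Suc e) (sig (he e))"
      proof (rule deg_lt_sig)
        show "mon_deg m < Suc e" if "m \<in> Poly_Mapping.keys (he e v)" for m v
          using that homog_hom_part[of e "h v"] unfolding homog_iff he_def by auto
      qed
      have "induced g (sig (he e)) = sig (he e)" if "g \<in> \<Gamma>" for g
        using h that by (simp add: induced_def tens_map_sigma lin he_def hom_part_sym_map[symmetric] PI_iff)
      \<comment> \<open>The symmetrized component of h is an invariant of H, so its commutator with
        \<open>A d\<close> vanishes there; in degree d + e the symbol of this commutator is the
        commutator of the two components.\<close>
      then have "invariant (sig (he e))" using hec by (simp add: invariant_def)
      from A(2)[OF this] have "A d \<otimes>\<^bsub>TW.R\<^esub> sig (he e) - sig (he e) \<otimes>\<^bsub>TW.R\<^esub> A d \<in> I" .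
      moreover have "deg_lt (Suc (d + e)) (A d \<otimes>\<^bsub>TW.R\<^esub> sig (he e) - sig (he e) \<otimes>\<^bsub>TW.R\<^esub> A d)"
        using deg_lt_mult[OF a(2) b, of d] deg_lt_mult[OF b a(2), of d] by (intro deg_lt_diff) (simp_all add: add.commute)
      ultimately have eq: "hom_part (d + e) (symmetrize ((A d \<otimes>\<^bsub>TW.R\<^esub> sig (he e)) w)) =
          hom_part (d + e) (symmetrize ((sig (he e) \<otimes>\<^bsub>TW.R\<^esub> A d) w))"
        using symbol_I[of "A d \<otimes>\<^bsub>TW.R\<^esub> sig (he e) - sig (he e) \<otimes>\<^bsub>TW.R\<^esub> A d" "d + e" w]
        by (simp add: symmetrize.ext_diff hom_part_diff)
      have deg: "mon_deg m < Suc d" if "m \<in> Poly_Mapping.keys (symmetrize (A d u))" for m u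
        using keys_symmetrize[OF that] a(2)[of d] unfolding deg_lt_def by metis
      have degW: "mon_deg m < Suc d" if "m \<in> Poly_Mapping.keys (sym_map (W_act v) (symmetrize (A d u)))" for m u v
        using keys_symmetrize[of m "tens_map (W_act v) (A d u)"] keys_tens_map[of _ "W_act v" "A d u"] that a(2)[of d]
        unfolding deg_lt_def symmetrize_tens_map[OF linV_W_act] by metis
      have hh: "homog e (he e u)" for u by (simp add: he_def)
      have L: "hom_part (d + e) (symmetrize ((A d \<otimes>\<^bsub>TW.R\<^esub> sig (he e)) w)) = (fd d \<otimes>\<^bsub>PW.R\<^esub> he e) w"
        unfolding symmetrize_mult_R PW.mult_R hom_part_sum
        by (intro sum.cong refl)
          (simp add: hom_part_mult[OF deg homog_sym_map[OF hh]] fd_def hp)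
      have R: "hom_part (d + e) (symmetrize ((sig (he e) \<otimes>\<^bsub>TW.R\<^esub> A d) w)) = (he e \<otimes>\<^bsub>PW.R\<^esub> fd d) w"
        unfolding symmetrize_mult_R PW.mult_R hom_part_sum
      proof (intro sum.cong refl)
        fix u
        let ?x = "sym_map (W_act u) (symmetrize (A d (matrix_inv u ** w)))"
        have "hom_part (d + e) (?x * he e u) = hom_part d ?x * he e u"
          by (rule hom_part_mult[OF _ hh]) (rule degW)
        then show "hom_part (d + e) (symmetrize (sigma (he e u)) * sym_map (W_act u) (symmetrize (A d (matrix_inv u ** w)))) =
           he e u * sym_map (W_act u) (fd d (matrix_inv u ** w))"
          by (simp add: mult.commute fd_def hp hom_part_sym_map)
      qed
      show "(fd d \<otimes>\<^bsub>PW.R\<^esub> he e) w = (he e \<otimes>\<^bsub>PW.R\<^esub> fd d) w" using eq unfolding L R .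
    qed
    obtain N N' where "f = (\<Sum>d<N. fd d)" "h = (\<Sum>e<N'. he e)" using sum[OF f] sum[OF hc] unfolding fd_def he_def by blast
    then show ?thesis
      by (simp only: PW.mult_R_sum_left PW.mult_R_sum_right de sum.swap[of _ "{..<N}"])
  qed
  show ?thesis using fPI comm by (simp add: centre_PI)
qed

theorem gr_centre:
  "gr_sub Q F (centre (Q\<lparr>carrier := Inv\<rparr>)) = pbw W \<alpha> \<alpha>v 0 c ` centre (PW W\<lparr>carrier := PI\<rparr>)"
proof (intro equalityI subsetI)
  fix \<phi> assume "\<phi> \<in> pbw W \<alpha> \<alpha>v 0 c ` centre (PW W\<lparr>carrier := PI\<rparr>)"
  then obtain f where f: "f \<in> centre (PW W\<lparr>carrier := PI\<rparr>)" and \<phi>: "\<phi> = pbw W \<alpha> \<alpha>v 0 c f" by blast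
  have fc: "f \<in> carrier PW.R" using f by (simp add: centre_PI PI_iff)
  have \<phi>d: "\<phi> d = symbol_coset d (sig (\<lambda>w. hom_part d (f w)))" for d unfolding \<phi> by (rule pbw_bc[OF fc])
  have ex: "\<exists>a\<in>centre (Q\<lparr>carrier := Inv\<rparr>) \<inter> F d. \<phi> d = below Q F d +>\<^bsub>Q\<^esub> a" for d
  proof -
    obtain a where a: "a \<in> carrier TW.R" "deg_lt (Suc d) a" "coset a \<in> centre (Q\<lparr>carrier := Inv\<rparr>)"
      "\<And>w. hom_part d (symmetrize (a w)) = hom_part d (f w)" using lift_centre[OF f, of d] by blast
    have "sig (\<lambda>w. hom_part d (f w)) \<in> carrier TW.R" using fc by (intro sig_carrier) (simp add: PW.carrier_R)
    then have "symbol_coset d a = \<phi> d" unfolding \<phi>d using symbol_coset_eq[OF a(1)] top_J[OF a(1,2)] a(4) by simp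
    then have "\<phi> d = below Q F d +>\<^bsub>Q\<^esub> coset a" by (simp add: symbol_coset_coset[OF a(1)])
    moreover have "coset a \<in> F d" using a by (auto simp: F_eq)
    ultimately show ?thesis using a(3) by blast
  qed
  have "finite {d. \<phi> d \<noteq> below Q F d}"
  proof -
    have "finite (\<Union>w\<in>W. mon_deg ` Poly_Mapping.keys (f w))" by simp
    then obtain N where N: "\<forall>k\<in>(\<Union>w\<in>W. mon_deg ` Poly_Mapping.keys (f w)). k < N"
      using finite_nat_set_iff_bounded by blast
    have "\<phi> d = below Q F d" if "N \<le> d" for d
    proof -
      have "hom_part d (f w) = 0" for w
      proof (rule poly_mapping_eqI)
        fix m
        have "w \<in> W" if "m \<in> Poly_Mapping.keys (f w)" using fc that by (auto simp: PW.carrier_R)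
        then show "Poly_Mapping.lookup (hom_part d (f w)) m = Poly_Mapping.lookup 0 m"
          using N \<open>N \<le> d\<close> by (force simp: lookup_hom_part in_keys_iff)
      qed
      then have "sig (\<lambda>w. hom_part d (f w)) = 0" by (intro ext) (simp only: sigma.ext_0 zero_fun_apply)
      then show ?thesis unfolding \<phi>d by (simp only: below_bc)
    qed
    then have "{d. \<phi> d \<noteq> below Q F d} \<subseteq> {..<N}" by (auto simp: not_less[symmetric])
    then show ?thesis by (rule finite_subset) simp
  qed
  then show "\<phi> \<in> gr_sub Q F (centre (Q\<lparr>carrier := Inv\<rparr>))"
    unfolding gr_sub_def gr_def using ex by simp blast
next
  fix \<phi> assume "\<phi> \<in> gr_sub Q F (centre (Q\<lparr>carrier := Inv\<rparr>))"
  then have fin: "finite {d. \<phi> d \<noteq> below Q F d}"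
    and ex: "\<And>d. \<exists>a\<in>centre (Q\<lparr>carrier := Inv\<rparr>) \<inter> F d. \<phi> d = below Q F d +>\<^bsub>Q\<^esub> a"
    unfolding gr_sub_def gr_def by auto
  have "\<exists>a. a \<in> carrier TW.R \<and> deg_lt (Suc d) a \<and> coset a \<in> centre (Q\<lparr>carrier := Inv\<rparr>) \<and> \<phi> d = symbol_coset d a" for d
  proof -
    obtain X where X: "X \<in> centre (Q\<lparr>carrier := Inv\<rparr>)" "X \<in> F d" "\<phi> d = below Q F d +>\<^bsub>Q\<^esub> X" using ex[of d] by blast
    then obtain a where "X = coset a" "a \<in> carrier TW.R" "deg_lt (Suc d) a" by (auto simp: F_eq)
    then show ?thesis using X symbol_coset_coset by metis
  qed
  then obtain A where A: "\<And>d. A d \<in> carrier TW.R" "\<And>d. deg_lt (Suc d) (A d)"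
    "\<And>d. coset (A d) \<in> centre (Q\<lparr>carrier := Inv\<rparr>)" "\<And>d. \<phi> d = symbol_coset d (A d)" by metis
  define D where "D = {d. \<phi> d \<noteq> below Q F d}"
  define s where "s d w = hom_part d (symmetrize (A d w))" for d w
  \<comment> \<open>The components of \<open>\<phi>\<close> are trivial outside the finite set
    \<open>D\<close>, so the symbols of the chosen representatives can be added up.\<close>
  define f where "f w = (\<Sum>d\<in>D. s d w)" for w
  have s0: "s d w = 0" if "d \<notin> D" for d w
  proof -
    have "symbol_coset d (A d) = symbol_coset d 0" using that A(4)[of d] by (simp add: D_def below_bc)
    then have "A d - 0 \<in> J d" by (simp only: symbol_coset_eq[OF A(1) TW.zero_carrier])
    then have "A d \<in> J d" by simp
    then show ?thesis unfolding s_def by (rule symbol_J[OF _ A(2)])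
  qed
  have hp: "hom_part d (f w) = s d w" for d w
  proof -
    have "hom_part d (f w) = (\<Sum>e\<in>D. if e = d then s d w else 0)"
      unfolding f_def hom_part_sum by (rule sum.cong) (auto simp: s_def hom_part_hom_part)
    then show ?thesis using fin s0[of d w] by (auto simp: D_def[symmetric])
  qed
  have fc: "f \<in> carrier PW.R" using A(1) by (simp add: PW.carrier_R TW.carrier_R f_def s_def symmetrize.ext_0)
  have "f \<in> centre (PW W\<lparr>carrier := PI\<rparr>)"
    by (rule symbol_centre[OF fc A(1-3)]) (simp add: hp s_def)
  moreover have "\<phi> = pbw W \<alpha> \<alpha>v 0 c f"
  proof
    fix d
    have t: "sig (s d) \<in> carrier TW.R"
      using A(1) by (intro sig_carrier) (simp add: PW.carrier_R TW.carrier_R s_def symmetrize.ext_0)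
    have "symbol_coset d (A d) = symbol_coset d (sig (s d))"
      unfolding symbol_coset_eq[OF A(1) t] unfolding s_def by (rule top_J[OF A(1,2)])
    then show "\<phi> d = pbw W \<alpha> \<alpha>v 0 c f d" unfolding pbw_bc[OF fc] hp A(4) .
  qed
  ultimately show "\<phi> \<in> pbw W \<alpha> \<alpha>v 0 c ` centre (PW W\<lparr>carrier := PI\<rparr>)" by blast
qed

end

section \<open>The two groups\<close>

text \<open>The point is that the inverse in the group \<open>GL\<close> is
  \<open>matrix_inv\<close>.\<close>

lemma matrix_group_subgroup:
  assumes "subgroup W GL" "finite W" shows "matrix_group W"
proof -
  have W: "invertible w" if "w \<in> W" for w
    using subgroup.subset[OF assms(1)] that by (auto simp: GL_def)
  have inv: "w ** matrix_inv w = mat 1 \<and> matrix_inv w ** w = mat 1" if "w \<in> W" for w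
    using W[OF that] unfolding invertible_def matrix_inv_def by (rule someI_ex)
  have m_inv: "m_inv GL w = matrix_inv w" if w: "w \<in> W" for w
    unfolding m_inv_def
  proof (rule the_equality)
    show "matrix_inv w \<in> carrier GL \<and> w \<otimes>\<^bsub>GL\<^esub> matrix_inv w = \<one>\<^bsub>GL\<^esub> \<and> matrix_inv w \<otimes>\<^bsub>GL\<^esub> w = \<one>\<^bsub>GL\<^esub>"
      using inv[OF w] by (auto simp: GL_def invertible_def)
  next
    fix y assume "y \<in> carrier GL \<and> w \<otimes>\<^bsub>GL\<^esub> y = \<one>\<^bsub>GL\<^esub> \<and> y \<otimes>\<^bsub>GL\<^esub> w = \<one>\<^bsub>GL\<^esub>"
    then have "matrix_inv w ** (w ** y) = matrix_inv w" by (simp add: GL_def)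
    then show "y = matrix_inv w" using inv[OF w] by (simp add: matrix_mul_assoc)
  qed
  show ?thesis
  proof
    show "mat 1 \<in> W" using subgroup.one_closed[OF assms(1)] by (simp add: GL_def)
    show "u ** v \<in> W" if "u \<in> W" "v \<in> W" for u v
      using subgroup.m_closed[OF assms(1) that] by (simp add: GL_def)
    show "matrix_inv w \<in> W" if "w \<in> W" for w
      using subgroup.m_inv_closed[OF assms(1) that] by (simp add: m_inv that)
  qed (use assms(2) inv in auto)
qed

lemma pairing_commute: "pairing x y = pairing y x"
  by (simp add: pairing_def mult.commute)

lemma pairing_axis: "pairing (axis i 1) y = y $ i"
proof -
  have "pairing (axis i 1) y = (\<Sum>j\<in>UNIV. if j = i then y $ i else 0)"
    unfolding pairing_def by (rule sum.cong) (auto simp: axis_def)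
  then show ?thesis by simp
qed

context matrix_group begin

lemma scalar_matrix:
  assumes w: "w \<in> W" and sc: "\<And>y. w *v y = a *s y"
  shows "a \<noteq> 0" "x v* matrix_inv w = (1 / a) *s x" "w ** u = u ** w"
proof -
  have "matrix_inv w *v (w *v y) = y" for y using w by (simp add: matrix_vector_mul_assoc l_inv)
  then have inv: "a *s (matrix_inv w *v y) = y" for y by (simp add: sc vector_scalar_commute)
  show a: "a \<noteq> 0"
  proof
    assume "a = 0"
    then have "axis i 1 = (0 :: complex ^ 'n)" for i using inv[of "axis i 1"] by simp
    then show False by (simp add: axis_eq_0_iff)
  qed
  show "x v* matrix_inv w = (1 / a) *s x"
  proof (rule pairing_eqI)
    fix z
    have "pairing (x v* matrix_inv w) z * a = pairing x (a *s (matrix_inv w *v z))"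
      by (simp add: pairing_matrix pairing_scale_right)
    then show "pairing (x v* matrix_inv w) z = pairing ((1 / a) *s x) z"
      using a by (simp add: inv pairing_scale_left field_simps)
  qed
  show "w ** u = u ** w"
    unfolding matrix_eq by (simp add: matrix_vector_mul_assoc[symmetric] sc vector_scalar_commute)
qed

end

section \<open>The torus\<close>

lemma torus_eq: "torus = {\<lambda>v. (inverse l *s fst v, l *s snd v) |l. l \<noteq> 0}"
  unfolding torus_def case_prod_unfold ..

text \<open>These combinations arise in the components \<open>h\<close> and \<open>h*\<close> when
  the action of a matrix of determinant 1 is composed with that of its adjugate.\<close>

lemma combination_collapse:
  fixes y z :: "complex ^ 'n"
  assumes "a * d - b * c = 1"
  shows "a *s (d *s y + (- c) *s z) + c *s ((- b) *s y + a *s z) = y"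
    and "b *s (d *s z + (- c) *s y) + d *s ((- b) *s z + a *s y) = y"
proof -
  have "a *s (d *s y + (- c) *s z) + c *s ((- b) *s y + a *s z) = (a * d - b * c) *s y"
    by (simp add: vec_eq_iff algebra_simps)
  then show "a *s (d *s y + (- c) *s z) + c *s ((- b) *s y + a *s z) = y" by (simp add: assms)
  have "b *s (d *s z + (- c) *s y) + d *s ((- b) *s z + a *s y) = (a * d - b * c) *s y"
    by (simp add: vec_eq_iff algebra_simps)
  then show "b *s (d *s z + (- c) *s y) + d *s ((- b) *s z + a *s y) = y" by (simp add: assms)
qed

context reflection_data begin

text \<open>For \<open>separation\<close>, products of a vector of \<open>h\<close> with a vector of
  \<open>h*\<close> are torus-invariant. If w fixes them all, then w multiplied by a suitable entry
  t of its inverse is the identity; so w acts by 1 / t on \<open>h\<close> and by t on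
  \<open>h*\<close>, as a torus element does.\<close>

lemma gamma_data_torus: "gamma_data W \<alpha> \<alpha>v c torus"
proof
  fix g :: "'n hhd \<Rightarrow> 'n hhd" assume "g \<in> torus"
  then obtain l where l: "l \<noteq> 0" and g: "g = (\<lambda>v. (inverse l *s fst v, l *s snd v))"
    by (auto simp: torus_eq)
  show "linV g"
    unfolding linV_def g by (simp add: scaleV_def vector_add_ldistrib vector_smult_assoc mult.commute)
  show "\<exists>g'\<in>torus. (\<forall>v. g (g' v) = v) \<and> (\<forall>v. g' (g v) = v)"
    using l by (intro bexI[of _ "\<lambda>v. (inverse (inverse l) *s fst v, inverse l *s snd v)"])
      (auto simp: g torus_eq vector_smult_assoc simp del: inverse_inverse_eq intro!: exI[of _ "inverse l"])
  show "g (W_act w v) = W_act w (g v)" if "w \<in> W" for w v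
    by (simp add: g W_act_apply vector_scalar_commute scalar_vector_matrix_assoc)
  show "kappa s (g u) (g v) = kappa s u v" if "s \<in> S" for s u v
    using l by (simp add: g kappa_def pairing_scale_left pairing_scale_right field_simps)
next
  fix w assume w: "w \<in> W"
    and inv: "\<And>p. (\<And>g. g \<in> torus \<Longrightarrow> sym_map g p = p) \<Longrightarrow> sym_map (W_act w) p = p"
  have 1: "pairing \<eta> (w *v y) * pairing x (matrix_inv w *v \<xi>) = pairing \<eta> y * pairing x \<xi>" for \<eta> y x \<xi>
  proof -
    let ?p = "sym_vec (y, 0) * sym_vec (0, x)"
    have "sym_map g ?p = ?p" if "g \<in> torus" for g
    proof -
      obtain l where l: "l \<noteq> 0" and g: "g = (\<lambda>v. (inverse l *s fst v, l *s snd v))"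
        using \<open>g \<in> torus\<close> by (auto simp: torus_eq)
      have "linV g"
        unfolding linV_def g by (simp add: scaleV_def vector_add_ldistrib vector_smult_assoc mult.commute)
      moreover have "g (y, 0) = scaleV (inverse l) (y, 0)" "g (0, x) = scaleV l (0, x)"
        by (simp_all add: g scaleV_def)
      ultimately have "sym_map g ?p = const (inverse l) * const l * ?p"
        by (simp add: sym_map_mult sym_map_vec sym_vec_scaleV mult_ac)
      then show ?thesis using l by (simp add: const_mult[symmetric])
    qed
    then have "peval (sym_map (W_act w) ?p) (\<eta>, \<xi>) = peval ?p (\<eta>, \<xi>)" using inv by simp
    then show ?thesis
      by (simp add: sym_map_mult sym_map_vec peval_mult peval_sym_vec veval_def W_act_apply pairing_matrix)
  qed
  obtain i :: 'n where True by blast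
  define t where "t = pairing (axis i 1) (matrix_inv w *v axis i 1)"
  have 2: "pairing \<eta> (w *v y) * t = pairing \<eta> y" for \<eta> y
    using 1[of \<eta> y "axis i 1" "axis i 1"] by (simp add: t_def pairing_axis)
  have t: "t \<noteq> 0"
    using 2[of "axis i 1" "axis i 1"] by (auto simp: pairing_axis)
  have sc: "w *v y = (1 / t) *s y" for y
  proof (rule pairing_eqI)
    fix z
    show "pairing (w *v y) z = pairing ((1 / t) *s y) z"
      using 2[of z y] t by (simp add: pairing_scale_right pairing_commute[of _ z] field_simps)
  qed
  have "W_act w = (\<lambda>(y, x). (inverse t *s y, t *s x))"
    using scalar_matrix(2)[OF w sc] by (auto simp: W_act_apply sc fun_eq_iff inverse_eq_divide)
  then have "W_act w \<in> torus" using t by (auto simp: torus_def)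
  then show "W_act w \<in> torus \<and> (\<forall>u\<in>W. w ** u = u ** w)" using scalar_matrix(3)[OF w sc] by blast
qed

end

section \<open>The group SL2 for a real reflection group\<close>

locale real_reflection_data = reflection_data W \<alpha> \<alpha>v c for W :: "('n::finite) cmat set" and \<alpha> \<alpha>v c +
  fixes U :: "(complex ^ 'n) set" and B :: "'n cmat"
  assumes real: "real_structure W U B" and dim: "CARD('n) > 2"
begin

definition \<beta> :: "complex ^ 'n \<Rightarrow> complex ^ 'n \<Rightarrow> complex" where
  "\<beta> u v = pairing (u v* B) v"

lemma \<beta>_add_left: "\<beta> (u + u') v = \<beta> u v + \<beta> u' v"
  and \<beta>_add_right: "\<beta> u (v + v') = \<beta> u v + \<beta> u v'"
  and \<beta>_scale_left: "\<beta> (a *s u) v = a * \<beta> u v"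
  and \<beta>_scale_right: "\<beta> u (a *s v) = a * \<beta> u v"
  by (simp_all add: \<beta>_def vector_matrix_left_distrib scalar_vector_matrix_assoc pairing_add_left pairing_add_right
      pairing_scale_left pairing_scale_right)

lemma U_decompose: "\<exists>p q. p \<in> U \<and> q \<in> U \<and> v = p + \<i> *s q"
proof -
  have "\<exists>!p. p \<in> U \<times> U \<and> v = fst p + \<i> *s snd p"
    using real unfolding real_structure_def by - (elim conjE, drule spec[of _ v], assumption)
  then have "\<exists>p. p \<in> U \<times> U \<and> v = fst p + \<i> *s snd p" by (rule ex1_implies_ex)
  then obtain p where "p \<in> U \<times> U" "v = fst p + \<i> *s snd p" by (elim exE conjE)
  then show ?thesis by (intro exI[of _ "fst p"] exI[of _ "snd p"]) (simp add: mem_Times_iff)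
qed

lemma \<beta>_U: "u \<in> U \<Longrightarrow> v \<in> U \<Longrightarrow> \<beta> u v \<in> \<real>" "u \<in> U \<Longrightarrow> v \<in> U \<Longrightarrow> \<beta> u v = \<beta> v u"
  "u \<in> U \<Longrightarrow> u \<noteq> 0 \<Longrightarrow> Re (\<beta> u u) > 0"
  "w \<in> W \<Longrightarrow> u \<in> U \<Longrightarrow> v \<in> U \<Longrightarrow> \<beta> (w *v u) (w *v v) = \<beta> u v"
proof -
  have R: "\<forall>u\<in>U. \<forall>v\<in>U. \<beta> u v \<in> \<real> \<and> \<beta> u v = \<beta> v u" "\<forall>u\<in>U. u \<noteq> 0 \<longrightarrow> Re (\<beta> u u) > 0"
    "\<forall>w\<in>W. \<forall>u\<in>U. \<forall>v\<in>U. \<beta> (w *v u) (w *v v) = \<beta> u v"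
    using real unfolding real_structure_def \<beta>_def by - (elim conjE, assumption)+
  show "u \<in> U \<Longrightarrow> v \<in> U \<Longrightarrow> \<beta> u v \<in> \<real>" "u \<in> U \<Longrightarrow> v \<in> U \<Longrightarrow> \<beta> u v = \<beta> v u" using R(1) by simp_all
  show "u \<in> U \<Longrightarrow> u \<noteq> 0 \<Longrightarrow> Re (\<beta> u u) > 0" using R(2) by simp
  show "w \<in> W \<Longrightarrow> u \<in> U \<Longrightarrow> v \<in> U \<Longrightarrow> \<beta> (w *v u) (w *v v) = \<beta> u v" using R(3) by simp
qed

lemma \<beta>_commute: "\<beta> u v = \<beta> v u"
proof -
  obtain p q p' q' where "p \<in> U" "q \<in> U" "u = p + \<i> *s q" "p' \<in> U" "q' \<in> U" "v = p' + \<i> *s q'"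
    using U_decompose by metis
  then show ?thesis
    by (simp add: \<beta>_add_left \<beta>_add_right \<beta>_scale_left \<beta>_scale_right \<beta>_U(2)[of p'] \<beta>_U(2)[of q'] algebra_simps)
qed

lemma \<beta>_W: "w \<in> W \<Longrightarrow> \<beta> (w *v u) (w *v v) = \<beta> u v"
proof -
  assume w: "w \<in> W"
  obtain p q p' q' where "p \<in> U" "q \<in> U" "u = p + \<i> *s q" "p' \<in> U" "q' \<in> U" "v = p' + \<i> *s q'"
    using U_decompose by metis
  then show ?thesis using w
    by (simp add: matrix_vector_right_distrib vector_scalar_commute
        \<beta>_add_left \<beta>_add_right \<beta>_scale_left \<beta>_scale_right \<beta>_U(4))
qed

text \<open>The form is positive definite only on \<open>U\<close> and is bilinear on
  \<open>h\<close>, so u = p + i q is tested against p and q separately: the first value has real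
  part \<beta>(p, p), the second has imaginary part \<beta>(q, q).\<close>

lemma \<beta>_nondegenerate: "u v* B = 0 \<Longrightarrow> u = 0"
proof -
  assume 0: "u v* B = 0"
  obtain p q where pq: "p \<in> U" "q \<in> U" "u = p + \<i> *s q" using U_decompose by metis
  have z: "\<beta> u v = 0" for v by (simp add: \<beta>_def 0)
  have R: "Im (\<beta> x y) = 0" if "x \<in> U" "y \<in> U" for x y using \<beta>_U(1)[OF that] by (simp add: complex_is_Real_iff)
  have "\<beta> p p + \<i> * \<beta> q p = 0" "\<beta> p q + \<i> * \<beta> q q = 0"
    using z[of p] z[of q] by (simp_all add: pq(3) \<beta>_add_left \<beta>_scale_left)
  then have "Re (\<beta> p p + \<i> * \<beta> q p) = 0" "Im (\<beta> p q + \<i> * \<beta> q q) = 0" by simp_all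
  then have "Re (\<beta> p p) = 0" "Re (\<beta> q q) = 0" using R pq by simp_all
  then have "p = 0" "q = 0" using \<beta>_U(3) pq by fastforce+
  then show "u = 0" using pq(3) by simp
qed

lemma B_inverse: "(x v* matrix_inv B) v* B = x" "(y v* B) v* matrix_inv B = y"
proof -
  have "inj ((*v) (transpose B))"
  proof (rule injI)
    fix u v assume "transpose B *v u = transpose B *v v"
    then have "u v* B = v v* B" by simp
    moreover have "(u - v) v* B + v v* B = u v* B" by (simp flip: vector_matrix_left_distrib)
    ultimately have "(u - v) v* B = 0" by simp
    then show "u = v" using \<beta>_nondegenerate[of "u - v"] by simp
  qed
  then obtain C where "C ** transpose B = mat 1" using matrix_left_invertible_injective[of "transpose B"] by blast
  then have "transpose (C ** transpose B) = mat 1" by simp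
  then have "B ** transpose C = mat 1" by (simp add: matrix_transpose_mul)
  then have "invertible B" unfolding invertible_right_inverse by blast
  then have "B ** matrix_inv B = mat 1 \<and> matrix_inv B ** B = mat 1"
    unfolding invertible_def matrix_inv_def by (rule someI_ex)
  then show "(x v* matrix_inv B) v* B = x" "(y v* B) v* matrix_inv B = y" by (simp_all add: vector_matrix_mul_assoc)
qed

lemma W_B: "w \<in> W \<Longrightarrow> (w *v y) v* B = (y v* B) v* matrix_inv w"
proof (rule pairing_eqI)
  fix z assume w: "w \<in> W"
  have "\<beta> (w *v y) (w *v (matrix_inv w *v z)) = \<beta> y (matrix_inv w *v z)" by (rule \<beta>_W[OF w])
  then show "pairing ((w *v y) v* B) z = pairing ((y v* B) v* matrix_inv w) z"
    using w by (simp add: \<beta>_def pairing_matrix[of "y v* B"])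
qed

lemma W_B_inv: "w \<in> W \<Longrightarrow> (x v* matrix_inv w) v* matrix_inv B = w *v (x v* matrix_inv B)"
  using W_B[of w "x v* matrix_inv B"] B_inverse by metis

definition sl2_act :: "complex ^ 2 ^ 2 \<Rightarrow> 'n hhd \<Rightarrow> 'n hhd" where
  "sl2_act A v = (A $ 1 $ 1 *s fst v + A $ 2 $ 1 *s (snd v v* matrix_inv B),
             A $ 1 $ 2 *s (fst v v* B) + A $ 2 $ 2 *s snd v)"

lemma SL2_eq: "SL2 B = {sl2_act A |A. det A = 1}"
  unfolding SL2_def sl2_act_def[abs_def] case_prod_unfold ..

lemma linV_sl2_act: "linV (sl2_act A)"
  unfolding linV_def sl2_act_def
  by (simp add: scaleV_def vector_matrix_left_distrib scalar_vector_matrix_assoc vec_eq_iff algebra_simps)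

lemma sl2_act_inverse:
  assumes "A $ 1 $ 1 * A $ 2 $ 2 - A $ 1 $ 2 * A $ 2 $ 1 = 1"
    and "A' $ 1 $ 1 = A $ 2 $ 2" "A' $ 2 $ 2 = A $ 1 $ 1" "A' $ 1 $ 2 = - A $ 1 $ 2" "A' $ 2 $ 1 = - A $ 2 $ 1"
  shows "sl2_act A (sl2_act A' v) = v"
proof -
  let ?y = "fst v" and ?x = "snd v" and ?yB = "fst v v* B" and ?xB = "snd v v* matrix_inv B"
  have "sl2_act A' v = (A $ 2 $ 2 *s ?y + (- A $ 2 $ 1) *s ?xB, (- A $ 1 $ 2) *s ?yB + A $ 1 $ 1 *s ?x)"
    by (simp add: sl2_act_def assms(2-5))
  then have "sl2_act A (sl2_act A' v) =
     (A $ 1 $ 1 *s (A $ 2 $ 2 *s ?y + (- A $ 2 $ 1) *s ?xB) + A $ 2 $ 1 *s ((- A $ 1 $ 2) *s ?y + A $ 1 $ 1 *s ?xB),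
      A $ 1 $ 2 *s (A $ 2 $ 2 *s ?yB + (- A $ 2 $ 1) *s ?x) + A $ 2 $ 2 *s ((- A $ 1 $ 2) *s ?yB + A $ 1 $ 1 *s ?x))"
    by (simp only: sl2_act_def fst_conv snd_conv vector_matrix_left_distrib scalar_vector_matrix_assoc B_inverse)
  then show ?thesis unfolding combination_collapse[OF assms(1)] by simp
qed

text \<open>The reflection preserves \<beta> and has an eigenvalue other than 1 on its coroot, so
  the coroot is orthogonal to the hyperplane. The isomorphism from \<open>h\<close> to
  \<open>h*\<close> therefore takes it to a multiple of the root, and the factor k enters inversely
  in the other direction.\<close>

lemma root_form:
  assumes s: "s \<in> S"
  shows "\<exists>k. k \<noteq> 0 \<and> (\<forall>v. pairing (v v* B) (\<alpha>v s) = k * pairing (\<alpha> s) v) \<and>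
    (\<forall>x. k * pairing (\<alpha> s) (x v* matrix_inv B) = pairing x (\<alpha>v s))"
proof -
  define k where "k = \<beta> (\<alpha>v s) (\<alpha>v s) / root_norm s"
  have eq: "\<beta> v (\<alpha>v s) = k * pairing (\<alpha> s) v" for v
  proof -
    let ?t = "pairing (\<alpha> s) v / root_norm s"
    let ?v = "v - ?t *s \<alpha>v s"
    have "pairing (\<alpha> s) ?v = 0" using root_norm[OF s] by (simp add: pairing_diff_right pairing_scale_right root_norm_def)
    then have "s *v ?v = ?v" using refl_ker[OF s] by simp
    then have "\<beta> ?v (\<alpha>v s) = eigval s * \<beta> ?v (\<alpha>v s)"
      using \<beta>_W[of s ?v "\<alpha>v s"] s eigval[OF s] by (simp add: \<beta>_scale_right)
    then have "(eigval s - 1) * \<beta> ?v (\<alpha>v s) = 0" by (simp add: algebra_simps)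
    then have "\<beta> ?v (\<alpha>v s) = 0" using eigval[OF s] by simp
    moreover have "v = ?v + ?t *s \<alpha>v s" by simp
    ultimately have "\<beta> v (\<alpha>v s) = ?t * \<beta> (\<alpha>v s) (\<alpha>v s)" by (metis \<beta>_add_left \<beta>_scale_left add_0)
    then show ?thesis by (simp add: k_def)
  qed
  have "k \<noteq> 0"
  proof
    assume "k = 0"
    then have "\<beta> (\<alpha>v s) v = 0" for v using eq \<beta>_commute by simp
    then have "\<alpha>v s v* B = 0" by (intro pairing_eqI) (simp add: \<beta>_def)
    then show False using \<beta>_nondegenerate \<alpha>v_nonzero[OF s] by blast
  qed
  then show ?thesis using eq eq[of "_ v* matrix_inv B"] by (intro exI[of _ k]) (simp add: \<beta>_def B_inverse)
qed

text \<open>In the coordinates given by \<open>\<alpha> s\<close> on \<open>h\<close> and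
  \<open>\<alpha>v s\<close> on \<open>h*\<close>, rescaled by k, the group acts by 2 x 2 matrices,
  and \<open>kappa s\<close> is the determinant of two coordinate vectors up to scale.\<close>

lemma kappa_sl2_act:
  assumes s: "s \<in> S" and A: "A $ 1 $ 1 * A $ 2 $ 2 - A $ 1 $ 2 * A $ 2 $ 1 = 1"
  shows "kappa s (sl2_act A u) (sl2_act A v) = kappa s u v"
proof -
  obtain k where k: "k \<noteq> 0" "\<And>v. pairing (v v* B) (\<alpha>v s) = k * pairing (\<alpha> s) v"
    "\<And>x. k * pairing (\<alpha> s) (x v* matrix_inv B) = pairing x (\<alpha>v s)" using root_form[OF s] by blast
  have k3: "pairing (\<alpha> s) (x v* matrix_inv B) = pairing x (\<alpha>v s) / k" for x using k(1) k(3)[of x] by (simp add: field_simps)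
  have "kappa s (sl2_act A u) (sl2_act A v) = (A $ 1 $ 1 * A $ 2 $ 2 - A $ 1 $ 2 * A $ 2 $ 1) * kappa s u v"
    using k(1) by (simp add: kappa_def sl2_act_def pairing_add_left pairing_add_right pairing_scale_left pairing_scale_right
        k(2) k3 field_simps)
  then show ?thesis by (simp add: A)
qed

lemma ex_third: "\<exists>i. i \<noteq> j \<and> i \<noteq> (k :: 'n)"
proof (rule ccontr)
  assume "\<nexists>i. i \<noteq> j \<and> i \<noteq> k"
  then have "UNIV = {j, k}" by auto
  then have "CARD('n) = card {j, k}" by simp
  also have "\<dots> \<le> 2" by (simp add: card_insert_if)
  finally have "CARD('n) \<le> 2" .
  then show False using dim by simp
qed

text \<open>These are the 2 x 2 minors formed from u, v and their images in \<open>h*\<close>; they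
  are multiplied by the determinant of A.\<close>

lemma sl2_invariant:
  assumes A: "A $ 1 $ 1 * A $ 2 $ 2 - A $ 1 $ 2 * A $ 2 $ 1 = 1"
  defines "p \<equiv> \<lambda>u v. sym_vec (u, 0) * sym_vec (0, v v* B) - sym_vec (v, 0) * sym_vec (0, u v* B)"
  shows "sym_map (sl2_act A) (p u v) = p u v"
proof -
  have 1: "sl2_act A (u, 0) = scaleV (A $ 1 $ 1) (u, 0) + scaleV (A $ 1 $ 2) (0, u v* B)"
    and 2: "sl2_act A (0, u v* B) = scaleV (A $ 2 $ 1) (u, 0) + scaleV (A $ 2 $ 2) (0, u v* B)" for u
    by (simp_all add: sl2_act_def scaleV_def B_inverse)
  have "sym_map (sl2_act A) (p u v) = (const (A $ 1 $ 1) * const (A $ 2 $ 2) - const (A $ 1 $ 2) * const (A $ 2 $ 1)) * p u v"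
    unfolding p_def
    by (simp add: sym_map.ext_diff sym_map_mult sym_map_vec linV_sl2_act 1 2 sym_vec_add sym_vec_scaleV)
      (simp add: algebra_simps)
  also have "const (A $ 1 $ 1) * const (A $ 2 $ 2) - const (A $ 1 $ 2) * const (A $ 2 $ 1) = (1 :: 'n sym)"
    unfolding const_mult[symmetric] const_1[symmetric] A[symmetric]
    by (simp only: diff_conv_add_uminus const_add const_uminus)
  finally show ?thesis by simp
qed

text \<open>For \<open>separation\<close>, the invariants of \<open>sl2_invariant\<close> are
  evaluated at points and yield an identity between 2 x 2 minors. Moving one occurrence of w to the
  other side makes it linear in w and its inverse, and basis vectors then show that w is a
  scalar.\<close>

lemma gamma_data_SL2: "gamma_data W \<alpha> \<alpha>v c (SL2 B)"
proof
  fix g assume "g \<in> SL2 B"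
  then obtain A where g: "g = sl2_act A" and A: "A $ 1 $ 1 * A $ 2 $ 2 - A $ 1 $ 2 * A $ 2 $ 1 = 1"
    by (auto simp: SL2_eq det_2)
  show "linV g" by (simp add: g linV_sl2_act)
  show "\<exists>g'\<in>SL2 B. (\<forall>v. g (g' v) = v) \<and> (\<forall>v. g' (g v) = v)"
  proof -
    define A' :: "complex ^ 2 ^ 2" where
      "A' = (\<chi> i j. if i = 1 then if j = 1 then A $ 2 $ 2 else - A $ 1 $ 2 else if j = 1 then - A $ 2 $ 1 else A $ 1 $ 1)"
    have A': "A' $ 1 $ 1 = A $ 2 $ 2" "A' $ 2 $ 2 = A $ 1 $ 1" "A' $ 1 $ 2 = - A $ 1 $ 2" "A' $ 2 $ 1 = - A $ 2 $ 1"
      by (simp_all add: A'_def)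
    have d: "A' $ 1 $ 1 * A' $ 2 $ 2 - A' $ 1 $ 2 * A' $ 2 $ 1 = 1" using A by (simp add: A' mult.commute)
    then have "sl2_act A' \<in> SL2 B" by (auto simp: SL2_eq det_2)
    moreover have "sl2_act A (sl2_act A' v) = v" "sl2_act A' (sl2_act A v) = v" for v
      using sl2_act_inverse[OF A A'] sl2_act_inverse[OF d] A' by simp_all
    ultimately show ?thesis unfolding g by blast
  qed
  show "g (W_act w v) = W_act w (g v)" if w: "w \<in> W" for w v
    by (simp add: g sl2_act_def W_act_apply W_B[OF w] W_B_inv[OF w] matrix_vector_right_distrib vector_matrix_left_distrib
        vector_scalar_commute scalar_vector_matrix_assoc)
  show "kappa s (g u) (g v) = kappa s u v" if "s \<in> S" for s u v
    unfolding g by (rule kappa_sl2_act[OF that A])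
next
  fix w assume w: "w \<in> W"
    and inv: "\<And>p. (\<And>g. g \<in> SL2 B \<Longrightarrow> sym_map g p = p) \<Longrightarrow> sym_map (W_act w) p = p"
  let ?T = "matrix_inv w" and ?e = "\<lambda>i. axis i (1 :: complex) :: complex ^ 'n"
  have minor: "pairing \<eta> (w *v u) * pairing \<theta> (w *v v) - pairing \<eta> (w *v v) * pairing \<theta> (w *v u) =
    pairing \<eta> u * pairing \<theta> v - pairing \<eta> v * pairing \<theta> u" for \<theta> \<eta> u v
  proof -
    let ?p = "sym_vec (u, 0) * sym_vec (0, v v* B) - sym_vec (v, 0) * sym_vec (0, u v* B)"
    define \<xi> where "\<xi> = \<theta> v* matrix_inv B"
    have \<theta>: "pairing (z v* B) \<xi> = pairing \<theta> z" for z
      using \<beta>_commute[of z \<xi>] by (simp add: \<beta>_def \<xi>_def B_inverse)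
    have "sym_map g ?p = ?p" if "g \<in> SL2 B" for g
      using that sl2_invariant by (auto simp: SL2_eq det_2)
    then have "peval (sym_map (W_act w) ?p) (\<eta>, \<xi>) = peval ?p (\<eta>, \<xi>)" using inv by simp
    then show ?thesis
      by (simp add: sym_map.ext_diff peval.ext_diff sym_map_mult sym_map_vec peval_mult peval_sym_vec veval_def W_act_apply
          W_B[OF w, symmetric] \<theta>)
  qed
  \<comment> \<open>Transforming \<open>\<eta>\<close> by the inverse of w removes one occurrence of
    w on the left-hand side.\<close>
  have half: "pairing \<eta> u * pairing \<theta> (w *v v) - pairing \<eta> v * pairing \<theta> (w *v u) =
    pairing \<eta> (?T *v u) * pairing \<theta> v - pairing \<eta> (?T *v v) * pairing \<theta> u" for \<theta> \<eta> u v
    using minor[of "\<eta> v* ?T" u \<theta> v] w by (simp add: pairing_matrix matrix_vector_mul_assoc l_inv)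
  have \<delta>: "?e i $ k = (if k = i then 1 else 0)" for i k by (simp add: axis_def)
  have col: "(M *v ?e j) $ k = M $ k $ j" for M :: "'n cmat" and k j
    by (simp add: matrix_vector_mult_def axis_def if_distrib cong: if_cong)
  \<comment> \<open>A third index isolates a single entry of \<open>w\<close>; this fails in dimension 2.\<close>
  have off: "w $ k $ j = 0" if "k \<noteq> j" for k j
  proof -
    obtain i where "i \<noteq> k" "i \<noteq> j" using ex_third by blast
    then show ?thesis using half[of "?e i" "?e i" "?e k" "?e j"] that by (simp add: pairing_axis col \<delta>)
  qed
  have diag: "w $ j $ j = ?T $ i $ i" if "i \<noteq> j" for i j
    using half[of "?e i" "?e i" "?e j" "?e j"] that by (simp add: pairing_axis col \<delta>)
  obtain j0 :: 'n where True by blast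
  define z where "z = w $ j0 $ j0"
  have wd: "w $ j $ j = z" for j
  proof -
    obtain i where "i \<noteq> j" "i \<noteq> j0" using ex_third by blast
    then show ?thesis using diag[of i j] diag[of i j0] by (simp add: z_def)
  qed
  have sc: "w *v y = z *s y" for y
  proof -
    have "(w *v y) $ k = z * y $ k" for k
    proof -
      have "(w *v y) $ k = (\<Sum>j\<in>UNIV. if j = k then z * y $ k else 0)"
        unfolding matrix_vector_mult_def vec_lambda_beta by (rule sum.cong) (auto simp: wd off)
      then show ?thesis by simp
    qed
    then show ?thesis by (simp add: vec_eq_iff)
  qed
  \<comment> \<open>The inverse has the same diagonal entry as w, so z is its own inverse, and w
    acts as the scalar matrix z, whose determinant is 1.\<close>
  have Td: "?T $ j0 $ j0 = z"
  proof -
    obtain i where "i \<noteq> j0" using ex_third[of j0 j0] by blast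
    then show ?thesis using diag[of j0 i] wd by simp
  qed
  have "pairing (?e j0 v* ?T) (?e j0) = ?T $ j0 $ j0"
    by (simp add: pairing_matrix pairing_axis col)
  then have z: "z = 1 / z" using scalar_matrix(2)[OF w sc, of "?e j0"] Td by (simp add: pairing_scale_left pairing_axis \<delta>)
  have z0: "z \<noteq> 0" by (rule scalar_matrix(1)[OF w sc])
  have "W_act w = sl2_act (mat z)"
    using scalar_matrix(2)[OF w sc] z by (auto simp: W_act_apply sc fun_eq_iff sl2_act_def mat_def)
  moreover have "det (mat z :: complex ^ 2 ^ 2) = 1"
    using z z0 by (simp add: det_2 mat_def) (metis nonzero_divide_eq_eq)
  ultimately show "W_act w \<in> SL2 B \<and> (\<forall>u\<in>W. w ** u = u ** w)"
    using scalar_matrix(3)[OF w sc] by (auto simp: SL2_eq)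
qed

end

theorem theorem7p6:
  fixes W :: "('n::finite) cmat set"
    and \<Gamma> :: "('n hhd \<Rightarrow> 'n hhd) set"
    and \<alpha> \<alpha>v :: "'n cmat \<Rightarrow> complex ^ 'n"
    and c :: "'n cmat \<Rightarrow> complex"
  assumes "complex_reflection_group W" and "irreducible_rep W"
    and "(\<Gamma> = torus \<and> CARD('n) > 1) \<or>
         (\<exists>U B. real_structure W U B \<and> \<Gamma> = SL2 B \<and> CARD('n) > 2)"
    and "root_data W \<alpha> \<alpha>v"
    and "conj_invariant W c"
  shows "gr_sub (cherednik W \<alpha> \<alpha>v 0 c) (cherednik_filtration W \<alpha> \<alpha>v 0 c)
           (centre (cherednik W \<alpha> \<alpha>v 0 c
              \<lparr>carrier := cherednik_invariants W \<alpha> \<alpha>v 0 c \<Gamma>\<rparr>)) =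
         pbw W \<alpha> \<alpha>v 0 c ` centre (PW W \<lparr>carrier := PW_invariant_coeffs W \<Gamma>\<rparr>)"
proof -
  have "matrix_group W"
    using assms(1) unfolding complex_reflection_group_def by (intro matrix_group_subgroup) auto
  then have R: "reflection_data W \<alpha> \<alpha>v c"
    using assms(4,5) by (intro reflection_data.intro reflection_data_axioms.intro)
  have "gamma_data W \<alpha> \<alpha>v c \<Gamma>" using assms(3)
  proof (elim disjE exE conjE)
    assume "\<Gamma> = torus"
    then show ?thesis using reflection_data.gamma_data_torus[OF R] by simp
  next
    fix U B assume "real_structure W U B" "\<Gamma> = SL2 B" "CARD('n) > 2"
    then have "real_reflection_data W \<alpha> \<alpha>v c U B"
      using R by (intro real_reflection_data.intro real_reflection_data_axioms.intro)
    then show ?thesis using \<open>\<Gamma> = SL2 B\<close> real_reflection_data.gamma_data_SL2 by metis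
  qed
  then show ?thesis by (rule gamma_data.gr_centre)
qed

end
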